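(* Let $p\ge 1$ and let $F\in\mathcal{S}_p$ be a Misiurewicz map. Assume that the curve $\mathcal{S}_p$ has been parametrized locally near $F$ by a local parameter $\mathbf{t}$, $\mathbf{t}\mapsto F_{\mathbf{t}}$, with $F=F_{\mathbf{t}=0}$. Then there exist a non-constant entire function $\phi:\mathbb{C}\to\mathbb{C}$, a sequence of nonzero complex numbers $\rho_k\to 0$, and a constant $q\in\mathbb{C}$, $q\neq 0$, such that, setting $\mathscr{K}=\phi^{-1}(K_F)\subset\mathbb{C}$, for any sufficiently large $r>0$ we have: 1. $[\rho_k^{-1}(K_F-2a_F)]_r\to[\mathscr{K}]_r$, and 2. $[\rho_k^{-1}q\,(\mathscr{C}(\mathcal{S}_p)-F)]_r\to[\mathscr{K}]_r$, as $k\to\infty$ in the Hausdorff topology.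
   Context: Cubic maps and $\mathcal{S}_p$: for $(a,v)\in\mathbb{C}^2$ let $F_{a,v}(z)=z^3-3a^2z+(2a^3+v)$. Its critical points are $a$ (the marked critical point) and $-a$ (the free critical point), and $F_{a,v}(a)=v$. For $F=F_{a,v}$ write $a_F=a$, $v_F=v$. The point $2a_F$ is the free co-critical point; $F(2a_F)=F(-a_F)$. For $p\ge1$, $\mathcal{S}_p\subset\mathbb{C}^2$ is the smooth affine curve of all pairs $(a,v)$ such that $a$ is periodic of minimal period $p$ under $F_{a,v}$; a pair $(a,v)$ is identified with the map $F_{a,v}$. Filled Julia set: $K_F=\{z\in\mathbb{C}:\{F^n(z)\}_{n\ge 0}\text{ is bounded}\}$. Connectedness locus: $\mathscr{C}(\mathcal{S}_p)=\{F\in\mathcal{S}_p: K_F\text{ is connected}\}$, equivalently the set of $F\in\mathcal{S}_p$ such that $\{F^n(-a_F)\}$ (equivalently $\{F^n(2a_F)\}$) is bounded. Misiurewicz map: $F\in\mathcal{S}_p$ is a Misiurewicz map if there exist $\ell\ge1$ and a minimal $m\ge1$ such that $F^\ell(-a_F)=F^\ell(2a_F)=a_0$, $F^m(a_0)=a_0$ and $|(F^m)'(a_0)|>1$. Local parameter: let $\eta(a,v)=F_{a,v}^p(a)-a$, a holomorphic function that vanishes on $\mathcal{S}_p$ and has no critical points in a neighborhood of $\mathcal{S}_p$. The local parameter $\mathbf{t}\in\mathbb{C}$ on $\mathcal{S}_p$ is defined near any point of $\mathcal{S}_p$, uniquely up to translation, by the Hamiltonian system $\frac{da}{d\mathbf{t}}=\frac{\partial\eta}{\partial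 v}$, $\frac{dv}{d\mathbf{t}}=-\frac{\partial\eta}{\partial a}$. It is normalized so that $F$ corresponds to $\mathbf{t}=0$, and $F_{\mathbf{t}}$ denotes the map in $\mathcal{S}_p$ near $F$ with parameter $\mathbf{t}$; $\mathbf{t}\mapsto F_{\mathbf{t}}$ is a holomorphic parametrization of a neighborhood of $F$ in $\mathcal{S}_p$ by a neighborhood $U$ of $0\in\mathbb{C}$. Meaning of $\mathscr{C}(\mathcal{S}_p)-F$: it is the connectedness locus near $F$ read in the coordinate $\mathbf{t}$ centered at $F$, i.e. the set $\{\mathbf{t}\in U: F_{\mathbf{t}}\in\mathscr{C}(\mathcal{S}_p)\}$. The set $[\rho_k^{-1}q(\mathscr{C}(\mathcal{S}_p)-F)]_r$ is considered for $k$ large enough that $\overline{\mathbb{D}(r)}\subset\rho_k^{-1}qU$. Notation: $\mathbb{D}(r)=\{z\in\mathbb{C}:|z|<r\}$; for a closed set $A\subset\mathbb{C}$, $[A]_r=(\overline{\mathbb{D}(r)}\cap A)\cup\partial\mathbb{D}(r)$ (likewise when $A\cap\overline{\mathbb{D}(r)}$ is closed). For $A\subset \mathbb{C}$ and $\lambda,z_0\in\mathbb{C}$, $\lambda(A-z_0)=\{\lambda(z-z_0):z\in A\}$. Non-empty compact sets $E_k$ converge to a compact set $E$ in the Hausdorff topology, $E_k\to E$, if for every $\epsilon>0$ there is $k_0$ such that $E\subset N_\epsilon(E_k)$ and $E_k\subset N_\epsilon(E)$ for all $k\ge k_0$, where $N_\epsilon$ denotes the open $\epsilon$-neighborhood.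 *)

theory Defs
  imports "HOL-Analysis.Analysis"
begin

text \<open>
  A pair \<open>F = (a, v)\<close> is identified with the monic centred cubic polynomial with critical points
  \<open>a\<close> (marked) and \<open>- a\<close> (free) that maps \<open>a\<close> to \<open>v\<close>.
\<close>

definition cubic :: "complex \<times> complex \<Rightarrow> complex \<Rightarrow> complex" where
  "cubic F z = z ^ 3 - 3 * (fst F)\<^sup>2 * z + (2 * (fst F) ^ 3 + snd F)"

definition has_min_period :: "('a \<Rightarrow> 'a) \<Rightarrow> 'a \<Rightarrow> nat \<Rightarrow> bool" where
  "has_min_period f x p \<longleftrightarrow>
     p \<ge> 1 \<and> (f ^^ p) x = x \<and> (\<forall>j. 1 \<le> j \<and> j < p \<longrightarrow> (f ^^ j) x \<noteq> x)"

definition period_curve :: "nat \<Rightarrow> (complex \<times> complex) set" where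
  "period_curve p = {F. has_min_period (cubic F) (fst F) p}"

definition filled_julia :: "complex \<times> complex \<Rightarrow> complex set" where
  "filled_julia F = {z. bounded (range (\<lambda>n. (cubic F ^^ n) z))}"

definition connectedness_locus :: "nat \<Rightarrow> (complex \<times> complex) set" where
  "connectedness_locus p = {F \<in> period_curve p. connected (filled_julia F)}"

definition misiurewicz :: "nat \<Rightarrow> complex \<times> complex \<Rightarrow> bool" where
  "misiurewicz p F \<longleftrightarrow> F \<in> period_curve p \<and>
     (\<exists>l m a0. l \<ge> 1 \<and> (cubic F ^^ l) (- fst F) = a0 \<and> (cubic F ^^ l) (2 * fst F) = a0 \<and>
        has_min_period (cubic F) a0 m \<and> norm (deriv (cubic F ^^ m) a0) > 1)"

definition eta :: "nat \<Rightarrow> complex \<Rightarrow> complex \<Rightarrow> complex" where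
  "eta p a v = (cubic (a, v) ^^ p) a - a"

text \<open>
  The local parameter near \<open>F\<close>: \<open>\<gamma>\<close> is the map from the parameter \<open>t \<in> U\<close> to the curve, a
  solution of the Hamiltonian system of \<open>eta p\<close> that is bijective onto a relatively open
  neighbourhood of \<open>F = \<gamma> 0\<close>. Holomorphy of \<open>\<gamma>\<close> follows from the two differential equations,
  as \<open>U\<close> is open.
\<close>

definition local_parametrization ::
  "nat \<Rightarrow> complex \<times> complex \<Rightarrow> complex set \<Rightarrow> (complex \<Rightarrow> complex \<times> complex) \<Rightarrow> bool" where
  "local_parametrization p F U \<gamma> \<longleftrightarrow>
     open U \<and> 0 \<in> U \<and> \<gamma> 0 = F \<and> inj_on \<gamma> U \<and>
     openin (top_of_set (period_curve p)) (\<gamma> ` U) \<and>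
     (\<forall>t\<in>U. ((\<lambda>s. fst (\<gamma> s)) has_field_derivative
                 deriv (\<lambda>v. eta p (fst (\<gamma> t)) v) (snd (\<gamma> t))) (at t) \<and>
            ((\<lambda>s. snd (\<gamma> s)) has_field_derivative
                 - deriv (\<lambda>a. eta p a (snd (\<gamma> t))) (fst (\<gamma> t))) (at t))"

definition rescale :: "complex \<Rightarrow> complex set \<Rightarrow> complex \<Rightarrow> complex set" where
  "rescale c A z0 = (\<lambda>z. c * (z - z0)) ` A"

definition truncate :: "complex set \<Rightarrow> real \<Rightarrow> complex set" where
  "truncate A r = (cball 0 r \<inter> A) \<union> sphere 0 r"

definition eps_nbhd :: "real \<Rightarrow> 'a::metric_space set \<Rightarrow> 'a set" where
  "eps_nbhd \<epsilon> A = (\<Union>x\<in>A. ball x \<epsilon>)"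

text \<open>
  Hausdorff convergence of non-empty compact sets. The members of the sequence are only required
  to be compact eventually, since a truncated rescaling of a locally defined set need not be
  compact until the domain of definition, rescaled, covers the truncating disc.
\<close>

definition hausdorff_converges :: "(nat \<Rightarrow> 'a::metric_space set) \<Rightarrow> 'a set \<Rightarrow> bool" where
  "hausdorff_converges E L \<longleftrightarrow>
     compact L \<and> L \<noteq> {} \<and> (\<forall>\<^sub>F k in sequentially. compact (E k) \<and> E k \<noteq> {}) \<and>
     (\<forall>\<epsilon>>0. \<forall>\<^sub>F k in sequentially. L \<subseteq> eps_nbhd \<epsilon> (E k) \<and> E k \<subseteq> eps_nbhd \<epsilon> L)"

end

theory Submission
  imports Defs "HOL-Complex_Analysis.Complex_Analysis"
    "HOL-Computational_Algebra.Fundamental_Theorem_Algebra"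
begin

text \<open>
  Let \<open>lam\<close> be the multiplier of the repelling point \<open>a0 = F\<^sup>l(2a)\<close>, of period \<open>m\<close>. A point \<open>w\<close>
  lies in the filled Julia set magnified by \<open>\<kappa>1 lam\<^sup>k\<close> about \<open>2a\<close> if and only if the iterate
  of order \<open>m k + l\<close> maps \<open>2a + w / (\<kappa>1 lam\<^sup>k)\<close> into \<open>K\<^sub>F\<close>. It lies in the connectedness
  locus magnified by \<open>\<kappa>2 lam\<^sup>k\<close> if and only if the map \<open>F\<^sub>t\<close> with \<open>t = w / (\<kappa>2 lam\<^sup>k)\<close> sends its
  free critical point into its own filled Julia set in \<open>m k + l\<close> steps. In the first case let \<open>\<kappa>1\<close>
  be the derivative of \<open>F\<^sup>l\<close> at \<open>2a\<close>; in the second let \<open>\<kappa>2\<close> be the derivative in \<open>t\<close> of the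
  \<open>l\<close>-th point of the free critical orbit relative to the moving repelling point. Then both orbit
  points converge, as functions of \<open>w\<close>, to the same entire function: the Poincare function \<open>\<phi>\<close> of the
  repelling cycle (\<open>poincare_function\<close>, \<open>perturbed_orbit_limit\<close>, \<open>rescaled_orbit_limit\<close>). So
  \<open>\<rho>\<^sub>k = 1 / (\<kappa>1 lam\<^sup>k)\<close> and \<open>q = \<kappa>2 / \<kappa>1\<close> have the required properties as soon as the
  convergence of functions yields convergence of sets.

  One inclusion is the upper semicontinuity of the filled Julia set (\<open>upper_limit\<close>). The other one
  would fail if points of \<open>K\<^sub>F\<close> could be lost under perturbation. But the basin of the marked
  superattracting cycle is open and persists, and it is dense in \<open>K\<^sub>F\<close> (\<open>basin_dense\<close>); hence the
  points \<open>w\<close> for which \<open>\<phi> w\<close> is in the basin are dense in the limit set, and each of them belongs to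
  the magnified sets for all large \<open>k\<close> (\<open>lower_limit\<close>).

  Three facts about the cubics carry this argument.

  The constant \<open>\<kappa>2\<close> does not vanish (\<open>cubic_transversality\<close>). This is an arithmetic fact: the
  parameters of \<open>F\<close> are integral at places over 3, where the derivative of a cubic of this form is
  divisible by 3, and the derivatives involved can be computed modulo such a place.

  A map on the curve is in the connectedness locus if and only if its free critical orbit is bounded
  (\<open>connectedness_locus_iff\<close>). If it is bounded, the complement of each set of points that stay
  bounded for a given time can be pushed to infinity through the covering given by the iterate, which
  excludes a separation. Conversely, if the filled Julia set is connected, the Riemann map of its
  complement conjugates the cubic to a proper self-map of the disc with a single, triple zero, which
  is \<open>c x\<^sup>3\<close> and leaves no room for another critical point.

  The basin is dense because the critical orbits of \<open>F\<close> are finite. Away from a finite set, bounded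
  inverse branches of all iterates exist on common discs; an orbit in the interior of \<open>K\<^sub>F\<close> that
  stayed away from the marked cycle would force iterates to converge to the identity near some point
  and then, by continuation along these inverse branches, everywhere.
\<close>

section \<open>Valuation rings\<close>

definition subring :: "'a::field set \<Rightarrow> bool" where
  "subring B \<longleftrightarrow> 1 \<in> B \<and> (\<forall>x\<in>B. \<forall>y\<in>B. x - y \<in> B \<and> x * y \<in> B)"

lemma subringD:
  assumes "subring B"
  shows "1 \<in> B" "0 \<in> B" "x \<in> B \<Longrightarrow> - x \<in> B"
    "x \<in> B \<Longrightarrow> y \<in> B \<Longrightarrow> x + y \<in> B" "x \<in> B \<Longrightarrow> y \<in> B \<Longrightarrow> x - y \<in> B"
    "x \<in> B \<Longrightarrow> y \<in> B \<Longrightarrow> x * y \<in> B" "x \<in> B \<Longrightarrow> x ^ n \<in> B" "numeral k \<in> B" "of_nat j \<in> B"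
proof -
  show 1: "1 \<in> B" and d: "\<And>x y. x \<in> B \<Longrightarrow> y \<in> B \<Longrightarrow> x - y \<in> B"
    and m: "\<And>x y. x \<in> B \<Longrightarrow> y \<in> B \<Longrightarrow> x * y \<in> B"
    using assms by (auto simp: subring_def)
  show 0: "0 \<in> B" using d[OF 1 1] by simp
  have n: "- x \<in> B" if "x \<in> B" for x using d[OF 0 that] by simp
  then show "x \<in> B \<Longrightarrow> - x \<in> B" .
  have a: "x + y \<in> B" if "x \<in> B" "y \<in> B" for x y using d[OF that(1) n[OF that(2)]] by simp
  then show "x \<in> B \<Longrightarrow> y \<in> B \<Longrightarrow> x + y \<in> B" .
  show "x ^ n \<in> B" if "x \<in> B" by (induction n) (use that 1 m in auto)
  have nat: "of_nat j \<in> B" for j by (induction j) (use 0 1 a in auto)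
  then show "of_nat j \<in> B" .
  show "numeral k \<in> B" using nat[of "numeral k"] by simp
qed

lemma subring_sum: "subring B \<Longrightarrow> (\<And>i. i \<in> I \<Longrightarrow> f i \<in> B) \<Longrightarrow> sum f I \<in> B"
  by (induction I rule: infinite_finite_induct) (auto simp: subringD)

definition adjoin :: "'a::field set \<Rightarrow> 'a \<Rightarrow> 'a set" where
  "adjoin B x = {poly p x | p. \<forall>i. coeff p i \<in> B}"

lemma subring_adjoin:
  assumes B: "subring B"
  shows "subring (adjoin B x)"
  unfolding subring_def adjoin_def
proof (intro conjI ballI)
  show "1 \<in> {poly p x |p. \<forall>i. coeff p i \<in> B}"
    using subringD[OF B] by (auto intro!: exI[of _ 1])
next
  fix y z assume "y \<in> {poly p x |p. \<forall>i. coeff p i \<in> B}" "z \<in> {poly p x |p. \<forall>i. coeff p i \<in> B}"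
  then obtain p q where p: "y = poly p x" "\<And>i. coeff p i \<in> B" and q: "z = poly q x" "\<And>i. coeff q i \<in> B"
    by auto
  show "y - z \<in> {poly p x |p. \<forall>i. coeff p i \<in> B}"
    using p q subringD[OF B] by (auto intro!: exI[of _ "p - q"])
  show "y * z \<in> {poly p x |p. \<forall>i. coeff p i \<in> B}"
    using p q subringD[OF B] by (auto intro!: exI[of _ "p * q"] subring_sum[OF B] simp: coeff_mult)
qed

lemma adjoin_superset:
  assumes B: "subring B"
  shows "B \<subseteq> adjoin B x" "x \<in> adjoin B x"
proof -
  show "B \<subseteq> adjoin B x"
    using subringD[OF B] by (auto simp: adjoin_def coeff_pCons split: nat.splits intro!: exI[of _ "[:_:]"])
  show "x \<in> adjoin B x"
    using subringD[OF B] by (auto simp: adjoin_def coeff_pCons split: nat.splits intro!: exI[of _ "[:0,1:]"])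
qed

text \<open>
  In a subring that is maximal among those not containing \<open>1/\<pi>\<close>, every \<open>u = 1 - \<pi> b\<close> is a unit:
  otherwise adjoining \<open>1/u\<close> would produce \<open>1/\<pi>\<close>, that is \<open>u\<^sup>n = \<pi> c\<close>, while \<open>u\<^sup>n\<close> is
  also of the form \<open>1 - \<pi> d\<close>, so that \<open>1/\<pi> = c + d\<close>.
\<close>

lemma unit_of_maximal:
  assumes B: "subring B" and pi: "\<pi> \<in> B" "inverse \<pi> \<notin> B"
    and max: "\<And>C. subring C \<Longrightarrow> B \<subseteq> C \<Longrightarrow> inverse \<pi> \<notin> C \<Longrightarrow> C = B"
    and b: "b \<in> B"
  shows "1 - \<pi> * b \<noteq> 0" "inverse (1 - \<pi> * b) \<in> B"
proof -
  have pi0: "\<pi> \<noteq> 0" using pi subringD(2)[OF B] by auto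
  note [intro] = subringD[OF B]
  define u where "u = 1 - \<pi> * b"
  have uB: "u \<in> B" unfolding u_def using b pi by auto
  show u0: "1 - \<pi> * b \<noteq> 0"
  proof
    assume "1 - \<pi> * b = 0"
    then have "inverse \<pi> = b" using pi0 by (simp add: field_simps)
    then show False using pi b by simp
  qed
  show "inverse (1 - \<pi> * b) \<in> B"
  proof (rule ccontr)
    assume ni: "inverse (1 - \<pi> * b) \<notin> B"
    have "inverse \<pi> \<in> adjoin B (inverse u)"
    proof (rule ccontr)
      assume "inverse \<pi> \<notin> adjoin B (inverse u)"
      then have "adjoin B (inverse u) = B" by (intro max subring_adjoin adjoin_superset B)
      then show False using ni adjoin_superset(2)[OF B, of "inverse u"] by (simp add: u_def)
    qed
    then obtain p where p: "inverse \<pi> = poly p (inverse u)" "\<And>i. coeff p i \<in> B"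
      by (auto simp: adjoin_def)
    define n where "n = degree p"
    define c where "c = (\<Sum>i\<le>n. coeff p i * u ^ (n - i))"
    have cB: "c \<in> B" unfolding c_def using p uB by (intro subring_sum[OF B]) auto
    have "inverse \<pi> * u ^ n = (\<Sum>i\<le>n. coeff p i * inverse u ^ i * u ^ n)"
      by (simp add: p poly_altdef n_def sum_distrib_right)
    also have "\<dots> = c"
      unfolding c_def
    proof (rule sum.cong)
      fix i assume "i \<in> {..n}"
      then have "u ^ n = u ^ i * u ^ (n - i)" by (simp flip: power_add)
      then show "coeff p i * inverse u ^ i * u ^ n = coeff p i * u ^ (n - i)"
        using u0 by (simp add: u_def field_simps)
    qed simp
    finally have c: "u ^ n = \<pi> * c" using pi0 by (simp add: field_simps)
    have "\<exists>d\<in>B. u ^ k = 1 - \<pi> * d" for k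
    proof (induction k)
      case 0 then show ?case by (intro bexI[of _ 0]) auto
    next
      case (Suc k)
      then obtain d where d: "d \<in> B" "u ^ k = 1 - \<pi> * d" by auto
      have "u ^ Suc k = 1 - \<pi> * (b + d - \<pi> * b * d)"
        unfolding power_Suc d(2) by (simp add: u_def algebra_simps)
      then show ?case using b d pi by (intro bexI[of _ "b + d - \<pi> * b * d"]) auto
    qed
    then obtain d where d: "d \<in> B" "u ^ n = 1 - \<pi> * d" by auto
    have "\<pi> * (c + d) = 1" using c d by (simp add: algebra_simps)
    then have "inverse \<pi> = c + d" using pi0 by (simp add: field_simps)
    then show False using pi cB d by auto
  qed
qed

text \<open>
  Both \<open>x\<close> and \<open>1/x\<close> cannot generate \<open>1/\<pi>\<close>. Given expressions of \<open>1/\<pi>\<close> as a polynomial in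
  \<open>x\<close> and as one in \<open>1/x\<close>, the constant term of the one of smaller degree can be absorbed into a unit
  (\<open>unit_of_maximal\<close>), which gives a relation that eliminates the leading
  term of the other. The sum of the two degrees descends until one of them is a constant.
\<close>

lemma valuation_alternative:
  assumes B: "subring B" and pi: "\<pi> \<in> B" "inverse \<pi> \<notin> B"
    and max: "\<And>C. subring C \<Longrightarrow> B \<subseteq> C \<Longrightarrow> inverse \<pi> \<notin> C \<Longrightarrow> C = B"
    and x: "x \<noteq> 0"
    and p: "\<And>i. coeff p i \<in> B" "inverse \<pi> = poly p x"
    and q: "\<And>i. coeff q i \<in> B" "inverse \<pi> = poly q (inverse x)"
  shows False
  using x p q
proof (induction "degree p + degree q" arbitrary: x p q rule: less_induct)
  case less
  have pi0: "\<pi> \<noteq> 0" using pi subringD(2)[OF B] by auto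
  note [intro] = subringD[OF B]
  have red: False if le: "degree q \<le> degree p" and x: "x \<noteq> 0"
      and p: "\<And>i. coeff p i \<in> B" "inverse \<pi> = poly p x"
      and q: "\<And>i. coeff q i \<in> B" "inverse \<pi> = poly q (inverse x)"
      and IH: "\<And>p'. degree p' < degree p \<Longrightarrow> (\<And>i. coeff p' i \<in> B) \<Longrightarrow> inverse \<pi> = poly p' x \<Longrightarrow> False"
    for x p q
  proof -
    define n where "n = degree p"
    define m where "m = degree q"
    have n0: "n > 0"
    proof (rule ccontr)
      assume "\<not> n > 0"
      then obtain c where "p = [:c:]" using degree_eq_zeroE[of p] by (auto simp: n_def)
      then have "inverse \<pi> = c" "c \<in> B" using p(2) p(1)[of 0] by auto
      then show False using pi by simp
    qed
    define s where "s = inverse (1 - \<pi> * coeff q 0)"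
    have u: "1 - \<pi> * coeff q 0 \<noteq> 0" "s \<in> B"
      using unit_of_maximal[OF B pi max q(1)[of 0]] by (auto simp: s_def)
    have "1 = \<pi> * poly q (inverse x)" using q(2) pi0 by (simp add: field_simps flip: q(2))
    also have "poly q (inverse x) = coeff q 0 + (\<Sum>i=1..m. coeff q i * inverse x ^ i)"
      by (simp add: poly_altdef m_def atMost_atLeast0 sum.atLeast_Suc_atMost)
    finally have "1 - \<pi> * coeff q 0 = \<pi> * (\<Sum>i=1..m. coeff q i * inverse x ^ i)"
      by (simp add: algebra_simps)
    then have one: "1 = s * \<pi> * (\<Sum>i=1..m. coeff q i * inverse x ^ i)"
      using u by (simp add: s_def field_simps)
    define p' where "p' = (\<Sum>i<n. monom (coeff p i) i) +
        (\<Sum>i=1..m. monom (coeff p n * s * \<pi> * coeff q i) (n - i))"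
    \<comment> \<open>Multiplying the leading term by this form of 1 replaces it by terms of degree below \<open>n\<close>.\<close>
    have "coeff p n * x ^ n = coeff p n * x ^ n * (s * \<pi> * (\<Sum>i=1..m. coeff q i * inverse x ^ i))"
      using one by simp
    also have "\<dots> = (\<Sum>i=1..m. coeff p n * s * \<pi> * coeff q i * x ^ (n - i))"
      unfolding sum_distrib_left
    proof (rule sum.cong)
      fix i assume "i \<in> {1..m}"
      then have "i \<le> n" using le by (auto simp: n_def m_def)
      then have "x ^ n = x ^ i * x ^ (n - i)" by (simp flip: power_add)
      then show "coeff p n * x ^ n * (s * \<pi> * (coeff q i * inverse x ^ i)) =
           coeff p n * s * \<pi> * coeff q i * x ^ (n - i)"
        using x by (simp add: field_simps)
    qed simp
    finally have top: "coeff p n * x ^ n = (\<Sum>i=1..m. coeff p n * s * \<pi> * coeff q i * x ^ (n - i))" .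
    have "poly p x = (\<Sum>i<n. coeff p i * x ^ i) + coeff p n * x ^ n"
      by (simp add: poly_altdef n_def lessThan_Suc_atMost[symmetric])
    also have "\<dots> = poly p' x"
      unfolding top p'_def by (simp add: poly_sum poly_monom)
    finally have v: "inverse \<pi> = poly p' x" using p by simp
    have c: "coeff p' i \<in> B" for i
      unfolding p'_def using p q u pi by (auto simp: coeff_sum intro!: subring_sum[OF B] subringD[OF B])
    have "degree p' \<le> n - 1"
      unfolding p'_def
    proof (intro degree_add_le degree_sum_le)
      show "degree (monom (coeff p i) i) \<le> n - 1" if "i \<in> {..<n}" for i
        using that by (intro order_trans[OF degree_monom_le]) auto
      show "degree (monom (coeff p n * s * \<pi> * coeff q i) (n - i)) \<le> n - 1" if "i \<in> {1..m}" for i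
        using that by (intro order_trans[OF degree_monom_le]) auto
    qed auto
    then have "degree p' < degree p" using n0 by (auto simp: n_def)
    then show False using IH c v by blast
  qed
  show False
  proof (cases "degree q \<le> degree p")
    case True
    show False
      using red[OF True less.prems] less.hyps[of _ q x] less.prems by (metis add_less_cancel_right)
  next
    case False
    show False
      using red[of p q "inverse x"] False less.hyps[of p _ x] less.prems
      by (metis add_less_cancel_left inverse_inverse_eq inverse_zero_imp_zero nle_le)
  qed
qed

text \<open>
  Existence of a place over a given prime (Chevalley): take, by Zorn's lemma, a maximal overring in
  which \<open>\<pi>\<close> is still not invertible. It serves below as a substitute for an extension of the 3-adic
  absolute value to the complex numbers; only divisibility is ever needed.
\<close>

theorem valuation_ring_exists:
  assumes B0: "subring B0" and pi: "\<pi> \<in> B0" "inverse \<pi> \<notin> B0"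
  obtains B where "subring B" "B0 \<subseteq> B" "inverse \<pi> \<notin> B" "\<And>x. x \<in> B \<or> inverse x \<in> B"
proof -
  define A where "A = {B. subring B \<and> B0 \<subseteq> B \<and> inverse \<pi> \<notin> B}"
  have "\<exists>M\<in>A. \<forall>X\<in>A. M \<subseteq> X \<longrightarrow> X = M"
  proof (rule subset_Zorn_nonempty)
    show "A \<noteq> {}" using assms by (auto simp: A_def)
    fix C assume C: "C \<noteq> {}" "subset.chain A C"
    then have CA: "C \<subseteq> A" and lin: "\<And>X Y. X \<in> C \<Longrightarrow> Y \<in> C \<Longrightarrow> X \<subseteq> Y \<or> Y \<subseteq> X"
      by (auto simp: subset.chain_def subset_chain_def)
    have "subring (\<Union>C)"
      unfolding subring_def
    proof (intro conjI ballI)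
      show "1 \<in> \<Union>C" using C CA by (force simp: A_def subring_def)
      fix x y assume "x \<in> \<Union>C" "y \<in> \<Union>C"
      then obtain X where "X \<in> C" "x \<in> X" "y \<in> X" using lin by (metis UnionE subsetD)
      moreover from this have "subring X" using CA by (auto simp: A_def)
      ultimately show "x - y \<in> \<Union>C" "x * y \<in> \<Union>C" using subringD(5,6) by blast+
    qed
    then show "\<Union>C \<in> A" using C CA by (auto simp: A_def)
  qed
  then obtain B where B: "subring B" "B0 \<subseteq> B" "inverse \<pi> \<notin> B"
    and max: "\<And>X. subring X \<Longrightarrow> B \<subseteq> X \<Longrightarrow> inverse \<pi> \<notin> X \<Longrightarrow> X = B"
    by (auto simp: A_def)
  have "x \<in> B \<or> inverse x \<in> B" for x
  proof (rule ccontr)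
    assume n: "\<not> (x \<in> B \<or> inverse x \<in> B)"
    have "inverse \<pi> \<in> adjoin B y" if "y \<notin> B" for y
      using max[of "adjoin B y"] adjoin_superset[OF B(1), of y] subring_adjoin[OF B(1)] that by auto
    then have "inverse \<pi> \<in> adjoin B x" "inverse \<pi> \<in> adjoin B (inverse x)" using n by auto
    then obtain p q where "\<And>i. coeff p i \<in> B" "inverse \<pi> = poly p x"
      "\<And>i. coeff q i \<in> B" "inverse \<pi> = poly q (inverse x)" unfolding adjoin_def by blast
    moreover have "x \<noteq> 0" using n subringD(2)[OF B(1)] by auto
    ultimately show False using valuation_alternative[OF B(1) _ B(3) max, of x p q] pi B by blast
  qed
  then show ?thesis using that B by blast
qed

section \<open>Transversality by reduction modulo three\<close>

text \<open>
  A valuation ring of the complex numbers in which 3 is not invertible. For nonzero \<open>w\<close>, membership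
  of \<open>z / w\<close> in \<open>B\<close> means that \<open>z\<close> is at most as large as \<open>w\<close> for the corresponding valuation.
\<close>

locale three_adic_place =
  fixes B :: "complex set"
  assumes sub: "subring B" and val: "\<And>x. x \<in> B \<or> inverse x \<in> B" and third: "inverse 3 \<notin> B"
begin

definition \<mm> :: "complex set" where "\<mm> = {x \<in> B. x = 0 \<or> inverse x \<notin> B}"

lemmas B_intros [intro, simp] = subringD[OF sub]

lemma mm_B: "x \<in> \<mm> \<Longrightarrow> x \<in> B" by (simp add: \<mm>_def)

lemma inverse_mm: "x \<notin> B \<Longrightarrow> inverse x \<in> \<mm>"
  using val[of x] by (auto simp: \<mm>_def)

lemma not_mm_imp_inverse: "x \<in> B \<Longrightarrow> x \<notin> \<mm> \<Longrightarrow> x \<noteq> 0 \<and> inverse x \<in> B"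
  by (auto simp: \<mm>_def)

lemma one_notin_mm: "1 \<notin> \<mm>" by (auto simp: \<mm>_def)

lemma mult_mm:
  assumes "b \<in> B" "x \<in> \<mm>" shows "b * x \<in> \<mm>" "x * b \<in> \<mm>"
proof -
  show "b * x \<in> \<mm>"
  proof (rule ccontr)
    assume n: "b * x \<notin> \<mm>"
    then have "b * x \<noteq> 0" "inverse (b * x) \<in> B"
      using not_mm_imp_inverse assms mm_B by blast+
    then have "inverse x \<in> B" "x \<noteq> 0"
      using assms(1) B_intros(6)[of b "inverse (b * x)"] by (auto simp: field_simps)
    then show False using assms by (auto simp: \<mm>_def)
  qed
  then show "x * b \<in> \<mm>" by (simp add: mult.commute)
qed

lemma add_mm:
  assumes "x \<in> \<mm>" "y \<in> \<mm>" shows "x + y \<in> \<mm>"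
proof (cases "x = 0 \<or> y = 0")
  case True then show ?thesis using assms by auto
next
  case False
  have *: "x + y \<in> \<mm>" if "x \<in> \<mm>" "y \<in> \<mm>" "x / y \<in> B" "y \<noteq> 0" for x y
  proof -
    have "x + y = (x / y + 1) * y" using that by (simp add: field_simps)
    then show ?thesis using mult_mm(1)[of "x / y + 1" y] that by auto
  qed
  have "x / y \<in> B \<or> y / x \<in> B" using val[of "x / y"] by simp
  then show ?thesis using *[of x y] *[of y x] assms False by (auto simp: add.commute)
qed

lemma minus_mm: "x \<in> \<mm> \<Longrightarrow> - x \<in> \<mm>"
  using mult_mm(1)[of "-1" x] B_intros(3)[of 1] by auto

lemma diff_mm: "x \<in> \<mm> \<Longrightarrow> y \<in> \<mm> \<Longrightarrow> x - y \<in> \<mm>"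
  using add_mm[of x "- y"] minus_mm[of y] by simp

lemma prime_mm:
  assumes "x \<in> B" "y \<in> B" "x * y \<in> \<mm>" shows "x \<in> \<mm> \<or> y \<in> \<mm>"
proof (rule ccontr)
  assume "\<not> ?thesis"
  then have "x \<noteq> 0" "inverse x \<in> B" "y \<noteq> 0" "inverse y \<in> B" using not_mm_imp_inverse assms by auto
  then have "x * y \<noteq> 0" "inverse (x * y) \<in> B" by auto
  then show False using assms by (auto simp: \<mm>_def)
qed

lemma three_mm: "3 \<in> \<mm>" using third by (auto simp: \<mm>_def)

lemma unit_one_plus:
  assumes "x \<in> \<mm>" shows "1 + x \<noteq> 0" "1 + x \<in> B" "inverse (1 + x) \<in> B"
proof -
  show B: "1 + x \<in> B" using assms mm_B by auto
  have "1 + x \<notin> \<mm>"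
  proof
    assume "1 + x \<in> \<mm>"
    then have "1 + x - x \<in> \<mm>" using assms diff_mm by blast
    then show False using one_notin_mm by simp
  qed
  then show "1 + x \<noteq> 0" "inverse (1 + x) \<in> B" using not_mm_imp_inverse B by auto
qed

text \<open>
  If \<open>w\<close> is not integral and is at least as large as \<open>a\<close> and \<open>c\<close>, then the cubic term dominates in
  \<open>G w = w\<^sup>3 + 3 a w\<^sup>2 + c\<close>, because the coefficient 3 is small: \<open>G w\<close> is \<open>w\<^sup>3\<close> times a unit.
  So \<open>G w\<close> is strictly larger than \<open>w\<close> and has the same properties.
\<close>

lemma three_adic_escape:
  fixes a c w :: complex
  assumes G_def: "\<And>w. G w = w ^ 3 + 3 * a * w\<^sup>2 + c"
    and w: "w \<notin> B" "a / w \<in> B" "c / w \<in> B"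
  shows "G w \<notin> B" "a / G w \<in> B" "c / G w \<in> B" "w / G w \<in> \<mm>"
proof -
  have w0: "w \<noteq> 0" using w by auto
  have iw: "inverse w \<in> \<mm>" using inverse_mm w by blast
  then have iwB: "inverse w \<in> B" by (rule mm_B)
  define e where "e = 1 + (3 * (a / w) + (c / w) * inverse w * inverse w)"
  have m: "3 * (a / w) + (c / w) * inverse w * inverse w \<in> \<mm>"
    using w iw iwB three_mm by (intro add_mm mult_mm) auto
  note e = unit_one_plus[OF m, folded e_def]
  have G: "G w = w ^ 3 * e"
    using w0 unfolding G_def e_def by (simp add: field_simps power2_eq_square power3_eq_cube)
  have G0: "G w \<noteq> 0" using G w0 e by simp
  have wG: "w / G w = inverse w * (inverse w * inverse e)"
    using G w0 e by (simp add: field_simps power2_eq_square power3_eq_cube)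
  show wGm: "w / G w \<in> \<mm>" unfolding wG using e iwB iw by (intro mult_mm) auto
  then have wGB: "w / G w \<in> B" by (rule mm_B)
  show "a / G w \<in> B" using B_intros(6)[OF w(2) wGB] w0 by simp
  show "c / G w \<in> B" using B_intros(6)[OF w(3) wGB] w0 by simp
  show "G w \<notin> B"
  proof
    assume "G w \<in> B"
    then have "G w * (inverse w * (w / G w)) \<in> \<mm>" using iwB wGm by (intro mult_mm) auto
    then show False using G0 w0 one_notin_mm by (simp add: field_simps)
  qed
qed

lemma three_adic_escape_not_periodic:
  fixes a c w :: complex
  assumes G_def: "\<And>w. G w = w ^ 3 + 3 * a * w\<^sup>2 + c"
    and w: "w \<notin> B" "a / w \<in> B" "c / w \<in> B"
    and "k \<ge> 1"
  shows "(G ^^ k) w \<noteq> w"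
proof -
  have w0: "w \<noteq> 0" using w by auto
  have *: "(G ^^ k) w \<notin> B \<and> a / (G ^^ k) w \<in> B \<and> c / (G ^^ k) w \<in> B \<and> (k \<ge> 1 \<longrightarrow> w / (G ^^ k) w \<in> \<mm>)"
    (is "?P k") for k
  proof (induction k)
    case 0 then show ?case using w by simp
  next
    case (Suc k)
    define u where "u = (G ^^ k) w"
    have u: "u \<notin> B" "a / u \<in> B" "c / u \<in> B" using Suc by (auto simp: u_def)
    have u0: "u \<noteq> 0" using u by auto
    note E = three_adic_escape[OF G_def u]
    have "w / G u \<in> \<mm>"
    proof (cases k)
      case 0 then show ?thesis using E by (simp add: u_def)
    next
      case (Suc j)
      then have "w / u \<in> B" using \<open>?P k\<close> mm_B by (simp add: u_def)
      then have "(w / u) * (u / G u) \<in> \<mm>" using E by (intro mult_mm) auto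
      then show ?thesis using u0 by simp
    qed
    then show ?case using E by (simp add: u_def)
  qed
  show ?thesis
  proof
    assume "(G ^^ k) w = w"
    then have "1 \<in> \<mm>" using *[of k] w0 \<open>k \<ge> 1\<close> by simp
    then show False using one_notin_mm by simp
  qed
qed

text \<open>
  In the coordinate centred at the marked critical point the cubic is \<open>w\<^sup>3 + 3 a w\<^sup>2 + (v - a)\<close>,
  with critical points 0 and \<open>- 2 a\<close>.
\<close>

lemma cubic_translate:
  "(cubic (a, v) ^^ n) z = a + ((\<lambda>w. w ^ 3 + 3 * a * w\<^sup>2 + (v - a)) ^^ n) (z - a)"
proof (induction n)
  case (Suc n)
  define w where "w = ((\<lambda>w. w ^ 3 + 3 * a * w\<^sup>2 + (v - a)) ^^ n) (z - a)"
  have "cubic (a, v) (a + w) = a + (w ^ 3 + 3 * a * w\<^sup>2 + (v - a))"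
    unfolding cubic_def by (simp add: algebra_simps power2_eq_square power3_eq_cube)
  then show ?case unfolding funpow.simps o_apply Suc w_def[symmetric] .
qed simp

text \<open>
  Integrality of the parameters of a postcritically finite cubic at places over 3. If \<open>c = v - a\<close> is
  not integral and at least as large as \<open>a\<close>, the critical value \<open>c\<close> of 0 escapes; if \<open>a\<close> is not
  integral and at least as large as \<open>c\<close>, the critical value \<open>4 a\<^sup>3 + c\<close> of \<open>- 2 a\<close> escapes.
\<close>

lemma parameters_integral:
  assumes p: "p \<ge> 1" "(cubic (a, v) ^^ p) a = a"
    and m: "m \<ge> 1" "(cubic (a, v) ^^ (l + m)) (- a) = (cubic (a, v) ^^ l) (- a)"
  shows "a \<in> B" "v \<in> B"
proof -
  define c where "c = v - a"
  define G where "G = (\<lambda>w. w ^ 3 + 3 * a * w\<^sup>2 + c)"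
  have G: "\<And>w. G w = w ^ 3 + 3 * a * w\<^sup>2 + c" by (simp add: G_def)
  have conj: "(cubic (a, v) ^^ n) z = a + (G ^^ n) (z - a)" for n z
    unfolding G_def c_def by (rule cubic_translate)
  have per: "(G ^^ p) 0 = 0" using p conj[of p a] by simp
  have pre: "(G ^^ (l + m)) (- (2 * a)) = (G ^^ l) (- (2 * a))"
    using m conj[of "l + m" "- a"] conj[of l "- a"] by simp
  have no_c: False if "c \<notin> B" "a / c \<in> B"
  proof -
    have c0: "c \<noteq> 0" using that by auto
    have "(G ^^ p) c \<noteq> c"
      using three_adic_escape_not_periodic[OF G, of c p] that p c0 by simp
    moreover have "(G ^^ p) c = (G ^^ p) (G 0)" by (simp add: G_def)
    moreover have "\<dots> = G ((G ^^ p) 0)" by (simp add: funpow_swap1)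
    moreover have "\<dots> = c" using per by (simp add: G_def)
    ultimately show False by simp
  qed
  have no_a: False if a: "a \<notin> B" "c / a \<in> B"
  proof -
    have a0: "a \<noteq> 0" using that by auto
    have ia: "inverse a \<in> \<mm>" "inverse a \<in> B" using inverse_mm mm_B a by blast+
    define e where "e = 1 + (3 * 1 + (c / a) * inverse a * inverse a)"
    have "3 * 1 + (c / a) * inverse a * inverse a \<in> \<mm>"
      using a ia three_mm by (intro add_mm mult_mm) auto
    note e = unit_one_plus[OF this, folded e_def]
    define w where "w = G (- (2 * a))"
    have we: "w = a ^ 3 * e"
      using a0 unfolding w_def e_def G_def by (simp add: field_simps power2_eq_square power3_eq_cube)
    have w0: "w \<noteq> 0" using we a0 e by simp
    have aw: "a / w = inverse a * (inverse a * inverse e)"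
      using we a0 e by (simp add: field_simps power2_eq_square power3_eq_cube)
    have aw_mm: "a / w \<in> \<mm>" unfolding aw using e ia by (intro mult_mm) auto
    have awB: "a / w \<in> B" using mm_B aw_mm by blast
    have cw: "c / w \<in> B" using B_intros(6)[OF a(2) awB] a0 by simp
    have wB: "w \<notin> B"
    proof
      assume "w \<in> B"
      then have "w * (inverse a * (a / w)) \<in> \<mm>" using ia aw_mm by (intro mult_mm) auto
      then show False using w0 a0 one_notin_mm by (simp add: field_simps)
    qed
    define u where "u = (G ^^ l) w"
    have "(G ^^ j) w \<notin> B \<and> a / (G ^^ j) w \<in> B \<and> c / (G ^^ j) w \<in> B" for j
      by (induction j) (use wB awB cw three_adic_escape[OF G] in auto)
    then have u: "u \<notin> B" "a / u \<in> B" "c / u \<in> B" by (auto simp: u_def)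
    have "(G ^^ m) u \<noteq> u" using three_adic_escape_not_periodic[OF G u m(1)] by simp
    moreover have "(G ^^ m) u = (G ^^ (m + l)) (G (- (2 * a)))" by (simp add: u_def w_def funpow_add)
    moreover have "\<dots> = G ((G ^^ (l + m)) (- (2 * a)))" by (simp add: funpow_swap1 add.commute)
    moreover have "\<dots> = u" unfolding pre u_def w_def by (simp add: funpow_swap1)
    ultimately show False by simp
  qed
  have "a \<in> B \<and> c \<in> B"
  proof (rule ccontr)
    assume n: "\<not> (a \<in> B \<and> c \<in> B)"
    consider "a / c \<in> B" | "c / a \<in> B" using val[of "a / c"] by auto
    then show False
    proof cases
      case 1
      show False
      proof (cases "c \<in> B")
        case True
        then have aB: "a \<notin> B" using n by simp
        have "c = 0" using aB B_intros(6)[OF 1 True] by (cases "c = 0") auto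
        then show False using no_a aB by simp
      qed (use no_c 1 in blast)
    next
      case 2
      show False
      proof (cases "a \<in> B")
        case True
        then have cB: "c \<notin> B" using n by simp
        have "a = 0" using cB B_intros(6)[OF 2 True] by (cases "a = 0") auto
        then show False using no_c cB by simp
      qed (use no_a 2 in blast)
    qed
  qed
  then show "a \<in> B" "v \<in> B" using B_intros(4)[of a c] by (auto simp: c_def)
qed

lemma iterate_integral:
  assumes "a \<in> B" "v \<in> B" "z \<in> B" shows "(cubic (a, v) ^^ n) z \<in> B"
  by (induction n) (use assms in \<open>auto simp: cubic_def intro!: B_intros\<close>)

lemma cubic_diff: "cubic F z - cubic F w = (z - w) * (z\<^sup>2 + z * w + w\<^sup>2 - 3 * (fst F)\<^sup>2)"
  by (simp add: cubic_def algebra_simps power2_eq_square power3_eq_cube)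

lemma iterate_diff_integral:
  assumes "a \<in> B" "v \<in> B" "z \<in> B" "w \<in> B"
  shows "\<exists>b\<in>B. (cubic (a, v) ^^ n) z - (cubic (a, v) ^^ n) w = (z - w) * b"
proof (induction n)
  case 0 then show ?case by (intro bexI[of _ 1]) auto
next
  case (Suc n)
  define z' w' where "z' = (cubic (a, v) ^^ n) z" "w' = (cubic (a, v) ^^ n) w"
  have zw: "z' \<in> B" "w' \<in> B" unfolding z'_w'_def using assms iterate_integral by auto
  obtain b where b: "b \<in> B" "z' - w' = (z - w) * b" using Suc by (auto simp: z'_w'_def)
  have "cubic (a, v) z' - cubic (a, v) w' = (z - w) * (b * (z'\<^sup>2 + z' * w' + w'\<^sup>2 - 3 * a\<^sup>2))"
    using cubic_diff[of "(a, v)" z' w'] b by simp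
  then show ?case using zw b assms
    by (intro bexI[of _ "b * (z'\<^sup>2 + z' * w' + w'\<^sup>2 - 3 * a\<^sup>2)"]) (auto simp: z'_w'_def)
qed

text \<open>
  The residue disc of the periodic critical point contains no other periodic point: the quotient of
  the differences after and before an iterate of the return map is divisible by \<open>y - a\<close>, so that
  periodicity of \<open>y\<close> would make \<open>y - a\<close> a unit.
\<close>

lemma residue_disc_attracted:
  assumes "a \<in> B" "v \<in> B" "y \<in> B" "y - a \<in> \<mm>"
    and n: "n \<ge> 1" "(cubic (a, v) ^^ n) a = a" "(cubic (a, v) ^^ n) y = y"
  shows "y = a"
proof (rule ccontr)
  assume ne: "y \<noteq> a"
  obtain k where k: "n = Suc k" using n by (cases n) auto
  have c: "cubic (a, v) y - cubic (a, v) a = (y - a)\<^sup>2 * (y + 2 * a)"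
    by (simp add: cubic_def algebra_simps power2_eq_square power3_eq_cube)
  have "cubic (a, v) y \<in> B" "cubic (a, v) a \<in> B" using assms iterate_integral[of a v _ 1] by auto
  then obtain b where b: "b \<in> B" "(cubic (a, v) ^^ k) (cubic (a, v) y) - (cubic (a, v) ^^ k) (cubic (a, v) a)
     = (cubic (a, v) y - cubic (a, v) a) * b"
    using iterate_diff_integral[of a v] assms by blast
  then have "y - a = (y - a)\<^sup>2 * (y + 2 * a) * b"
    using n c unfolding k funpow_Suc_right o_apply by simp
  then have "(y - a) * ((y - a) * ((y + 2 * a) * b)) = (y - a) * 1"
    by (simp add: power2_eq_square algebra_simps)
  then have "(y - a) * ((y + 2 * a) * b) = 1" using ne by (metis mult_cancel_left right_minus_eq)
  moreover have "(y - a) * ((y + 2 * a) * b) \<in> \<mm>" using assms b by (intro mult_mm) auto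
  ultimately show False using one_notin_mm by simp
qed

end

lemma funpow_mult_fixed: "(f ^^ m) x = x \<Longrightarrow> (f ^^ (k * m)) x = x"
  by (induction k) (auto simp: funpow_add)

text \<open>
  Transversality for Misiurewicz parameters, by reduction modulo a place over 3 (the method is
  Epstein's). The sequences \<open>X\<close> and \<open>Z\<close> are the derivatives of the orbit of \<open>a\<close> with respect to \<open>v\<close>
  and \<open>a\<close>, and \<open>D\<close> is the derivative of the orbit of \<open>- a\<close> along the Hamiltonian vector field
  \<open>(X p, 1 - Z p)\<close> of the period-\<open>p\<close> curve. The derivative of the cubic is divisible by 3, so
  \<open>X p\<close>, \<open>1 - Z p\<close> and all \<open>D (n + 1)\<close> are congruent to 1. This makes \<open>D (l + m) - D l\<close> itself
  congruent to 0, and the difference has to be divided by its trivial factors first.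
  
  At the first time \<open>k + 1\<close> at which the orbit is periodic, \<open>u = y k\<close> and \<open>Y = y (k + m)\<close> are distinct
  points with the same image, which gives \<open>Y\<^sup>2 + Y u + u\<^sup>2 = 3 a\<^sup>2\<close>. With this relation the
  difference becomes \<open>(Y - u) ((2 Y + u) D (k + m) + (2 u + Y) D k - 6 a X p)\<close>. For \<open>k = 0\<close> the bracket
  is \<open>3 a (D m - 2 X p)\<close>, and \<open>D m - 2 X p\<close> is congruent to \<open>- 1\<close>. For \<open>k > 0\<close> the bracket is 3 times
  a number congruent to \<open>2 (u - a)\<close>, and \<open>u\<close> is not congruent to \<open>a\<close>: it is congruent to the
  periodic point \<open>Y\<close>, and the residue disc of \<open>a\<close> contains no periodic point except \<open>a\<close>.
\<close>

theorem cubic_transversality: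
  fixes a v :: complex and p l m :: nat and X Z D :: "nat \<Rightarrow> complex"
  defines "x \<equiv> \<lambda>n. (cubic (a, v) ^^ n) a" and "y \<equiv> \<lambda>n. (cubic (a, v) ^^ n) (- a)"
  assumes X: "X 0 = 0" "\<And>n. X (Suc n) = 3 * ((x n)\<^sup>2 - a\<^sup>2) * X n + 1"
    and Z: "Z 0 = 1" "\<And>n. Z (Suc n) = 3 * ((x n)\<^sup>2 - a\<^sup>2) * Z n + 6 * a * (a - x n)"
    and D: "D 0 = - X p"
      "\<And>n. D (Suc n) = 3 * ((y n)\<^sup>2 - a\<^sup>2) * D n + 6 * a * (a - y n) * X p + (1 - Z p)"
    and p: "p \<ge> 1" "x p = a" and m: "m \<ge> 1" "y (l + m) = y l"
    and ya: "\<And>n. y n \<noteq> a" and yma: "\<And>n. n \<ge> 1 \<Longrightarrow> y n \<noteq> - a"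
  shows "D (l + m) \<noteq> D l"
proof -
  have sub0: "subring (\<int> :: complex set)" by (auto simp: subring_def)
  have "inverse 3 \<notin> (\<int> :: complex set)"
  proof
    assume "inverse 3 \<in> (\<int> :: complex set)"
    then obtain k where "inverse 3 = (of_int k :: complex)" by (auto elim: Ints_cases)
    then have "of_int (3 * k) = (of_int 1 :: complex)" by (simp add: field_simps)
    then have "3 * k = 1" using of_int_eq_iff by blast
    then show False by presburger
  qed
  then obtain B where B: "subring B" "inverse 3 \<notin> B" "\<And>x. x \<in> B \<or> inverse x \<in> (B :: complex set)"
    using valuation_ring_exists[OF sub0, of 3] by (metis Ints_numeral)
  interpret three_adic_place B using B by unfold_locales auto
  have aB [simp]: "a \<in> B" and vB [simp]: "v \<in> B"
    using parameters_integral[OF p(1) _ m(1), of a v l] p m by (auto simp: x_def y_def)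
  have xB [simp]: "x n \<in> B" for n unfolding x_def by (intro iterate_integral) auto
  have yB [simp]: "y n \<in> B" for n unfolding y_def by (intro iterate_integral) auto
  have XB [simp]: "X n \<in> B" for n by (induction n) (auto simp: X)
  have ZB [simp]: "Z n \<in> B" for n by (induction n) (auto simp: Z)
  have DB [simp]: "D n \<in> B" for n by (induction n) (auto simp: D)
  have three: "3 * b \<in> \<mm>" if "b \<in> B" for b using that three_mm by (intro mult_mm)
  \<comment> \<open>\<open>3 A n\<close> is what \<open>D (n + 1)\<close> adds to the constant \<open>1 - Z p\<close>; dividing the differences of the
    \<open>D\<close> by 3 leaves differences of the \<open>A\<close>.\<close>
  define A where "A n = ((y n)\<^sup>2 - a\<^sup>2) * D n + 2 * a * (a - y n) * X p" for n
  have AB [simp]: "A n \<in> B" for n by (auto simp: A_def)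
  have DA: "D (Suc n) = (1 - Z p) + 3 * A n" for n by (simp add: D A_def algebra_simps)
  obtain p' where p': "p = Suc p'" using p by (cases p) auto
  have X1: "X p - 1 \<in> \<mm>"
  proof -
    have "X p - 1 = 3 * (((x p')\<^sup>2 - a\<^sup>2) * X p')" by (simp add: p' X)
    then show ?thesis using three by auto
  qed
  have Z1: "Z p \<in> \<mm>"
  proof -
    have "Z p = 3 * (((x p')\<^sup>2 - a\<^sup>2) * Z p' + 2 * a * (a - x p'))" by (simp add: p' Z algebra_simps)
    also have "\<dots> \<in> \<mm>" by (rule three) simp
    finally show ?thesis .
  qed
  have D1: "D (Suc n) - 1 \<in> \<mm>" for n
  proof -
    have "D (Suc n) - 1 = 3 * A n - Z p" by (simp add: DA)
    then show ?thesis using three Z1 diff_mm by auto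
  qed
  have yS: "y (Suc n) = cubic (a, v) (y n)" for n by (simp add: y_def)
  have two: "u \<in> \<mm>" if "2 * u \<in> \<mm>" "u \<in> B" for u
  proof -
    have "3 * u - 2 * u \<in> \<mm>" using that three diff_mm by blast
    then show ?thesis by simp
  qed
  have a0: "a \<noteq> 0" using ya[of 0] by (auto simp: y_def)
  define l0 where "l0 = (LEAST j. y (j + m) = y j)"
  have l0: "y (l0 + m) = y l0" using LeastI[of "\<lambda>j. y (j + m) = y j" l] m by (simp add: l0_def)
  have l0_le: "l0 \<le> l" using Least_le[of "\<lambda>j. y (j + m) = y j" l] m by (simp add: l0_def)
  have l0_min: "y (j + m) \<noteq> y j" if "j < l0" for j
    using not_less_Least[of j "\<lambda>j. y (j + m) = y j"] that by (simp add: l0_def)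
  have "l0 \<noteq> 0"
  proof
    assume "l0 = 0"
    then have "y m = - a" using l0 by (simp add: y_def)
    then show False using yma m by blast
  qed
  then obtain k where k: "l0 = Suc k" by (cases l0) auto
  define Y u where "Y = y (k + m)" "u = y k"
  have YB [simp]: "Y \<in> B" and uB [simp]: "u \<in> B" by (auto simp: Y_u_def)
  have Yu: "Y \<noteq> u" using l0_min[of k] k by (auto simp: Y_u_def)
  have "cubic (a, v) Y = cubic (a, v) u" using l0 by (simp add: k Y_u_def yS)
  then have rel: "Y\<^sup>2 + Y * u + u\<^sup>2 = 3 * a\<^sup>2"
    using Yu cubic_diff[of "(a, v)" Y u] by auto
  have base: "D (l0 + m) - D l0 = (Y - u) * ((2 * Y + u) * D (k + m) + (2 * u + Y) * D k - 6 * a * X p)"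
  proof -
    have "D (l0 + m) - D l0 = 3 * (Y\<^sup>2 - a\<^sup>2) * D (k + m) - 3 * (u\<^sup>2 - a\<^sup>2) * D k + 6 * a * (u - Y) * X p"
      by (simp add: k D Y_u_def algebra_simps)
    also have "3 * (Y\<^sup>2 - a\<^sup>2) = (2 * Y + u) * (Y - u)"
      using rel by (simp add: algebra_simps power2_eq_square)
    also have "3 * (u\<^sup>2 - a\<^sup>2) = - ((2 * u + Y) * (Y - u))"
      using rel by (simp add: algebra_simps power2_eq_square)
    finally show ?thesis by (simp add: algebra_simps)
  qed
  have "D (l0 + m) \<noteq> D l0"
  proof
    assume "D (l0 + m) = D l0"
    then have br: "(2 * Y + u) * D (k + m) + (2 * u + Y) * D k - 6 * a * X p = 0"
      using base Yu by simp
    obtain m' where m': "m = Suc m'" using m by (cases m) auto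
    show False
    proof (cases k)
      case 0
      then have u: "u = - a" by (simp add: Y_u_def y_def)
      have "(Y - 2 * a) * (Y - u) = 0" using rel by (simp add: u algebra_simps power2_eq_square)
      then have Y2: "Y = 2 * a" using Yu by simp
      have "3 * a * (D m - 2 * X p) = 0" using br by (simp add: 0 u Y2 algebra_simps)
      then have "D m = 2 * X p" using a0 by simp
      then have "(D (Suc m') - 1) - 2 * (X p - 1) = 1" by (simp add: m')
      moreover have "(D (Suc m') - 1) - 2 * (X p - 1) \<in> \<mm>"
        by (rule diff_mm[OF D1 mult_mm(1)[OF _ X1]]) auto
      ultimately show False using one_notin_mm by simp
    next
      case (Suc k')
      have Dk: "D k = (1 - Z p) + 3 * A k'" "D (k + m) = (1 - Z p) + 3 * A (k' + m)"
        using DA[of k'] DA[of "k' + m"] by (auto simp: Suc)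
      have "(2 * Y + u) * D (k + m) + (2 * u + Y) * D k - 6 * a * X p
         = 3 * ((2 * Y + u) * (A (k' + m) - A k') + (Y + u) * D k - 2 * a * X p)"
        by (simp add: Dk algebra_simps)
      then have "3 * ((2 * Y + u) * (A (k' + m) - A k') + (Y + u) * D k - 2 * a * X p) = 0"
        using br by (rule trans[OF sym])
      then have E: "(2 * Y + u) * (A (k' + m) - A k') + (Y + u) * D k - 2 * a * X p = 0"
        by (metis mult_eq_0_iff zero_neq_numeral)
      have "(Y - u)\<^sup>2 = 3 * (a\<^sup>2 - Y * u)" using rel by (simp add: algebra_simps power2_eq_square)
      then have "(Y - u) * (Y - u) \<in> \<mm>" using three[of "a\<^sup>2 - Y * u"] by (simp add: power2_eq_square)
      then have Yum: "Y - u \<in> \<mm>" using prime_mm[of "Y - u" "Y - u"] by auto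
      have "2 * (Y - u) + 3 * u \<in> \<mm>" by (rule add_mm[OF mult_mm(1)[OF _ Yum] three]) auto
      then have Y2m: "2 * Y + u \<in> \<mm>" by (simp add: algebra_simps)
      have "2 * (u - a) = (Y + u) * D k - 2 * a * X p - (Y - u) - (Y + u) * (D (Suc k') - 1) + 2 * a * (X p - 1)"
        by (simp add: Suc algebra_simps)
      also have "(Y + u) * D k - 2 * a * X p = - ((2 * Y + u) * (A (k' + m) - A k'))"
        using E by (simp add: algebra_simps eq_neg_iff_add_eq_0)
      also have "- ((2 * Y + u) * (A (k' + m) - A k')) - (Y - u) - (Y + u) * (D (Suc k') - 1) + 2 * a * (X p - 1) \<in> \<mm>"
        by (intro add_mm[OF diff_mm[OF diff_mm[OF minus_mm Yum]]] mult_mm(1)[OF _ D1] mult_mm(1)[OF _ X1]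
              mult_mm(2)[OF _ Y2m]) auto
      finally have "u - a \<in> \<mm>" using two by auto
      then have "(Y - u) + (u - a) \<in> \<mm>" using Yum by (intro add_mm)
      then have Ya: "Y - a \<in> \<mm>" by simp
      have "y (k + m + m) = y (k + m)"
      proof -
        have "y (l0 + m + m') = y (l0 + m')"
          using l0 unfolding y_def by (simp add: add.commute[of _ m'] funpow_add)
        then show ?thesis by (simp add: k m' add.commute add.left_commute)
      qed
      then have "(cubic (a, v) ^^ m) Y = Y" unfolding Y_u_def y_def by (simp add: add.commute[of _ m] funpow_add)
      then have 1: "(cubic (a, v) ^^ (p * m)) Y = Y" by (rule funpow_mult_fixed)
      have 2: "(cubic (a, v) ^^ (p * m)) a = a"
        using p funpow_mult_fixed[of p "cubic (a, v)" a m] by (simp add: x_def mult.commute)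
      have "Y = a" using residue_disc_attracted[OF aB vB YB Ya _ 2 1] p m by simp
      then show False using ya by (simp add: Y_u_def)
    qed
  qed
  \<comment> \<open>Along the periodic part the difference is multiplied by the derivative of the cubic, which does
    not vanish there.\<close>
  moreover have "y (l0 + j + m) = y (l0 + j) \<and> D (l0 + j + m) \<noteq> D (l0 + j)" for j
  proof (induction j)
    case 0 then show ?case using l0 calculation by simp
  next
    case (Suc j)
    have "D (l0 + Suc j + m) - D (l0 + Suc j) = 3 * ((y (l0 + j))\<^sup>2 - a\<^sup>2) * (D (l0 + j + m) - D (l0 + j))"
      using Suc by (simp add: D algebra_simps)
    moreover have "(y (l0 + j))\<^sup>2 - a\<^sup>2 \<noteq> 0"
      using ya[of "l0 + j"] yma[of "l0 + j"] \<open>l0 \<noteq> 0\<close> by (auto simp: power2_eq_iff)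
    ultimately show ?case using Suc by (auto simp: yS)
  qed
  from this[of "l - l0"] show ?thesis using l0_le by simp
qed

section \<open>Escape and iteration of cubics\<close>

lemma cubic_free_cocritical: "cubic F (2 * fst F) = cubic F (- fst F)"
  by (simp add: cubic_def algebra_simps power2_eq_square power3_eq_cube)

lemma iterate_free_cocritical:
  assumes "n \<ge> 1" shows "(cubic F ^^ n) (2 * fst F) = (cubic F ^^ n) (- fst F)"
  using assms by (cases n) (simp_all add: funpow_Suc_right cubic_free_cocritical del: funpow.simps)

text \<open>
  The radius \<open>3 (B + 1)\<close> depends only on a bound \<open>B\<close> for the parameters, so one escape radius serves
  for all maps near a given one.
\<close>

lemma cubic_escape:
  assumes B: "norm (fst F) + norm (snd F) \<le> B" and z: "norm z \<ge> 3 * (B + 1)"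
  shows "norm (cubic F z) \<ge> 2 * norm z"
proof -
  define x where "x = norm z"
  have B0: "B \<ge> 0" "norm (fst F) \<le> B" "norm (snd F) \<le> B"
    using B norm_ge_zero[of "fst F"] norm_ge_zero[of "snd F"] by linarith+
  have x: "x \<ge> 3 * (B + 1)" using z by (simp add: x_def)
  have "norm (3 * (fst F)\<^sup>2 * z) \<le> 3 * B\<^sup>2 * x"
    using B0 by (auto simp: norm_mult norm_power x_def intro!: mult_mono power_mono)
  moreover have "norm (2 * (fst F) ^ 3 + snd F) \<le> 2 * B ^ 3 + B"
    using B0 by (intro order_trans[OF norm_triangle_ineq] add_mono)
      (auto simp: norm_mult norm_power intro!: power_mono)
  moreover have "norm (z ^ 3) = x ^ 3" by (simp add: norm_power x_def)
  moreover have "norm (cubic F z) \<ge> norm (z ^ 3) - norm (3 * (fst F)\<^sup>2 * z) - norm (2 * (fst F) ^ 3 + snd F)"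
  proof -
    have "z ^ 3 = cubic F z + 3 * (fst F)\<^sup>2 * z - (2 * (fst F) ^ 3 + snd F)" by (simp add: cubic_def)
    then have "norm (z ^ 3) \<le> norm (cubic F z) + norm (3 * (fst F)\<^sup>2 * z) + norm (2 * (fst F) ^ 3 + snd F)"
      using norm_triangle_ineq4[of "cubic F z + 3 * (fst F)\<^sup>2 * z" "2 * (fst F) ^ 3 + snd F"]
        norm_triangle_ineq[of "cubic F z" "3 * (fst F)\<^sup>2 * z"] by simp
    then show ?thesis by simp
  qed
  ultimately have "norm (cubic F z) \<ge> x ^ 3 - 3 * B\<^sup>2 * x - (2 * B ^ 3 + B)" by linarith
  moreover have "x ^ 3 - 3 * B\<^sup>2 * x - (2 * B ^ 3 + B) \<ge> 2 * x"
  proof -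
    define T where "T = x * (B\<^sup>2 + 2 * B + 1)"
    have "x\<^sup>2 \<ge> (3 * (B + 1))\<^sup>2" using x B0 by (intro power_mono) auto
    then have "x * x\<^sup>2 \<ge> x * (3 * (B + 1))\<^sup>2" using x B0 by (intro mult_left_mono) auto
    then have 1: "x ^ 3 \<ge> 9 * T"
      by (simp add: T_def power2_eq_square power3_eq_cube algebra_simps)
    have "T \<ge> 3 * (B + 1) * (B\<^sup>2 + 2 * B + 1)"
      unfolding T_def using x B0 by (intro mult_right_mono) auto
    moreover have "3 * (B + 1) * (B\<^sup>2 + 2 * B + 1) - (2 * B ^ 3 + B) = B ^ 3 + 9 * B\<^sup>2 + 8 * B + 3"
      by (simp add: power2_eq_square power3_eq_cube algebra_simps)
    moreover have "B ^ 3 + 9 * B\<^sup>2 + 8 * B + 3 \<ge> 0" using B0 by simp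
    ultimately have 2: "T \<ge> 2 * B ^ 3 + B" by linarith
    have "x * (B\<^sup>2 + 1) \<le> T" unfolding T_def using x B0 by (intro mult_left_mono) auto
    then have 3: "3 * B\<^sup>2 * x + 3 * x \<le> 3 * T" by (simp add: algebra_simps)
    have "x \<ge> 0" "T \<ge> 0" using x B0 by (auto simp: T_def)
    then show ?thesis using 1 2 3 by linarith
  qed
  ultimately show ?thesis by (simp add: x_def)
qed

lemma escape_iterate:
  assumes B: "norm (fst F) + norm (snd F) \<le> B" and z: "norm z \<ge> 3 * (B + 1)"
  shows "norm ((cubic F ^^ n) z) \<ge> 2 ^ n * norm z"
proof (induction n)
  case (Suc n)
  have "(1::real) * norm z \<le> 2 ^ n * norm z" by (intro mult_right_mono) auto
  then have "norm ((cubic F ^^ n) z) \<ge> 3 * (B + 1)" using Suc z by linarith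
  from cubic_escape[OF B this] show ?case using Suc by simp
qed simp

lemma filled_julia_iff_bounded_by:
  assumes B: "norm (fst F) + norm (snd F) \<le> B"
  shows "z \<in> filled_julia F \<longleftrightarrow> (\<forall>n. norm ((cubic F ^^ n) z) \<le> 3 * (B + 1))"
proof
  assume z: "z \<in> filled_julia F"
  then obtain M where M: "\<And>n. norm ((cubic F ^^ n) z) \<le> M"
    by (auto simp: filled_julia_def bounded_iff)
  have B0: "B \<ge> 0" using B norm_ge_zero[of "fst F"] norm_ge_zero[of "snd F"] by linarith
  show "\<forall>n. norm ((cubic F ^^ n) z) \<le> 3 * (B + 1)"
  proof (rule allI, rule ccontr)
    fix n assume "\<not> norm ((cubic F ^^ n) z) \<le> 3 * (B + 1)"
    then have big: "norm ((cubic F ^^ n) z) \<ge> 3 * (B + 1)" by simp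
    obtain k :: nat where k: "M < 2 ^ k" using real_arch_pow[of 2 M] by auto
    have "norm ((cubic F ^^ (k + n)) z) \<ge> 2 ^ k * norm ((cubic F ^^ n) z)"
      using escape_iterate[OF B big, of k] by (simp add: funpow_add)
    moreover have "2 ^ k * norm ((cubic F ^^ n) z) \<ge> 2 ^ k * 1"
      using big B0 by (intro mult_left_mono) auto
    ultimately show False using M[of "k + n"] k by linarith
  qed
next
  assume "\<forall>n. norm ((cubic F ^^ n) z) \<le> 3 * (B + 1)"
  then show "z \<in> filled_julia F" by (auto simp: filled_julia_def bounded_iff)
qed

lemma escape_stays:
  assumes B: "norm (fst F) + norm (snd F) \<le> B" and z: "norm ((cubic F ^^ n) z) > 3 * (B + 1)" "n \<le> k"
  shows "norm ((cubic F ^^ k) z) > 3 * (B + 1)"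
proof -
  have "(1::real) * norm ((cubic F ^^ n) z) \<le> 2 ^ (k - n) * norm ((cubic F ^^ n) z)"
    by (intro mult_right_mono) auto
  moreover have "norm ((cubic F ^^ (k - n + n)) z) \<ge> 2 ^ (k - n) * norm ((cubic F ^^ n) z)"
    using escape_iterate[OF B, of "(cubic F ^^ n) z" "k - n"] z unfolding funpow_add o_apply by simp
  ultimately show ?thesis using z by simp
qed

lemma filled_julia_iterate: "(cubic F ^^ n) z \<in> filled_julia F \<longleftrightarrow> z \<in> filled_julia F"
proof
  assume z: "z \<in> filled_julia F"
  show "(cubic F ^^ n) z \<in> filled_julia F"
  proof -
    obtain M where M: "\<And>k. norm ((cubic F ^^ k) z) \<le> M"
      using z by (auto simp: filled_julia_def bounded_iff)
    have "norm ((cubic F ^^ k) ((cubic F ^^ n) z)) \<le> M" for k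
      using M[of "k + n"] by (simp add: funpow_add)
    then show ?thesis by (auto simp: filled_julia_def bounded_iff)
  qed
next
  assume z: "(cubic F ^^ n) z \<in> filled_julia F"
  let ?B = "norm (fst F) + norm (snd F)"
  have "norm ((cubic F ^^ k) z) \<le> 3 * (?B + 1)" for k
  proof (rule ccontr)
    assume "\<not> ?thesis"
    then have "norm ((cubic F ^^ (k + n)) z) > 3 * (?B + 1)" using escape_stays[of F ?B k z "k + n"] by simp
    moreover have "norm ((cubic F ^^ k) ((cubic F ^^ n) z)) \<le> 3 * (?B + 1)"
      using z filled_julia_iff_bounded_by[of F ?B "(cubic F ^^ n) z"] by simp
    ultimately show False by (simp add: funpow_add)
  qed
  then show "z \<in> filled_julia F" using filled_julia_iff_bounded_by[of F ?B z] by simp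
qed

lemma filled_julia_cubic: "cubic F z \<in> filled_julia F \<longleftrightarrow> z \<in> filled_julia F"
  using filled_julia_iterate[of 1 F z] by simp

lemma periodic_in_filled_julia:
  assumes "p \<ge> 1" "(cubic F ^^ p) z = z" shows "z \<in> filled_julia F"
proof -
  have "(cubic F ^^ n) z \<in> (\<lambda>k. (cubic F ^^ k) z) ` {..<p}" for n
  proof -
    have "(cubic F ^^ n) z = (cubic F ^^ (n mod p)) z"
      using funpow_mod_eq[OF assms(2), of n] by simp
    then show ?thesis using assms by auto
  qed
  then have "range (\<lambda>n. (cubic F ^^ n) z) \<subseteq> (\<lambda>k. (cubic F ^^ k) z) ` {..<p}" by blast
  then show ?thesis
    unfolding filled_julia_def using finite_imp_bounded bounded_subset by blast
qed

lemma has_field_derivative_cubic: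
  "(cubic F has_field_derivative 3 * (z\<^sup>2 - (fst F)\<^sup>2)) (at z within S)"
  unfolding cubic_def
  by (rule derivative_eq_intros refl | simp add: algebra_simps)+

lemma holomorphic_iterate: "(cubic F ^^ n) holomorphic_on S"
proof (induction n)
  case 0 then show ?case by (auto simp: id_def)
next
  case (Suc n)
  have "cubic F holomorphic_on UNIV" unfolding cubic_def by (intro holomorphic_intros)
  then show ?case using holomorphic_on_compose_gen[OF Suc, of "cubic F" UNIV] by (simp add: o_def)
qed

lemma continuous_iterate: "continuous_on S (cubic F ^^ n)"
  by (rule holomorphic_on_imp_continuous_on[OF holomorphic_iterate])

text \<open>
  The derivative of the \<open>n\<close>-th iterate, by the chain rule along the orbit.
\<close>

fun iterate_deriv :: "complex \<times> complex \<Rightarrow> nat \<Rightarrow> complex \<Rightarrow> complex" where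
  "iterate_deriv F 0 z = 1"
| "iterate_deriv F (Suc n) z = 3 * (((cubic F ^^ n) z)\<^sup>2 - (fst F)\<^sup>2) * iterate_deriv F n z"

lemma has_field_derivative_iterate:
  "((cubic F ^^ n) has_field_derivative iterate_deriv F n z) (at z within S)"
proof (induction n)
  case 0 then show ?case by (auto simp: id_def)
next
  case (Suc n)
  show ?case using DERIV_chain[OF has_field_derivative_cubic Suc] by (simp add: o_def)
qed

lemma deriv_iterate: "deriv (cubic F ^^ n) z = iterate_deriv F n z"
  by (rule DERIV_imp_deriv[OF has_field_derivative_iterate])

lemma iterate_deriv_eq_0_iff:
  "iterate_deriv F n z = 0 \<longleftrightarrow> (\<exists>j<n. (cubic F ^^ j) z = fst F \<or> (cubic F ^^ j) z = - fst F)"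
  by (induction n) (auto simp: less_Suc_eq power2_eq_iff)

lemma closed_filled_julia: "closed (filled_julia F)"
proof -
  let ?B = "norm (fst F) + norm (snd F)"
  have "filled_julia F = (\<Inter>n. (cubic F ^^ n) -` cball 0 (3 * (?B + 1)))"
    using filled_julia_iff_bounded_by[of F ?B] by auto
  moreover have "closed ((cubic F ^^ n) -` cball 0 (3 * (?B + 1)))" for n
    by (intro closed_vimage continuous_iterate) auto
  ultimately show ?thesis by auto
qed

lemma compact_filled_julia: "compact (filled_julia F)"
proof -
  let ?B = "norm (fst F) + norm (snd F)"
  have "filled_julia F \<subseteq> cball 0 (3 * (?B + 1))"
    using filled_julia_iff_bounded_by[of F ?B] by (force dest: spec[of _ 0])
  then show ?thesis using closed_filled_julia bounded_subset[OF bounded_cball]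
    by (auto simp: compact_eq_bounded_closed)
qed

section \<open>Polynomials as covering maps\<close>

lemma card_roots_eq_degree:
  fixes P :: "complex poly"
  assumes "P \<noteq> 0" "\<And>z. poly P z = 0 \<Longrightarrow> poly (pderiv P) z \<noteq> 0"
  shows "card {z. poly P z = 0} = degree P"
proof -
  have sf: "rsquarefree P" using assms by (auto simp: rsquarefree_roots)
  have "degree P = size (proots P)" by (rule size_proots_complex[symmetric])
  also have "\<dots> = (\<Sum>z\<in>{z. poly P z = 0}. order z P)"
    using assms by (simp add: size_multiset_overloaded_eq set_count_proots)
  also have "\<dots> = (\<Sum>z\<in>{z. poly P z = 0}. 1)"
    using sf by (intro sum.cong) (auto simp: rsquarefree_root_order assms)
  finally show ?thesis by simp
qed

text \<open>
  Over a set of regular values a polynomial is a covering. The fibre over \<open>w\<close> consists of as many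
  points as the degree; small discs around them are mapped injectively, and over the intersection \<open>N\<close>
  of their images each disc contains one preimage of every point. These are already as many
  preimages as the degree permits, so there are no further sheets.
\<close>

theorem polynomial_covering_space:
  fixes P :: "complex poly"
  assumes deg: "degree P > 0" and T: "open T"
    and reg: "\<And>z. poly P z \<in> T \<Longrightarrow> poly (pderiv P) z \<noteq> 0"
  shows "covering_space (poly P -` T) (poly P) T"
proof
  show "continuous_on (poly P -` T) (poly P)" by (intro continuous_intros)
  have nz: "P - [:w:] \<noteq> 0" for w
    using deg by (metis degree_pCons_0 eq_iff_diff_eq_0 not_gr_zero)
  have dg: "degree (P - [:w:]) = degree P" for w
  proof (rule antisym)
    show "degree (P - [:w:]) \<le> degree P" by (intro degree_diff_le) auto
    have "coeff (P - [:w:]) (degree P) = lead_coeff P" using deg by (cases "degree P") auto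
    then show "degree P \<le> degree (P - [:w:])" using deg by (metis le_degree leading_coeff_0_iff degree_0 less_irrefl)
  qed
  have fin: "finite {z. poly P z = w}" for w
    using poly_roots_finite[OF nz[of w]] by simp
  have card: "card {z. poly P z = w} = degree P" if "w \<in> T" for w
    using card_roots_eq_degree[OF nz, of w] reg that by (auto simp: dg pderiv_diff pderiv_pCons)
  have ne: "{z. poly P z = w} \<noteq> {}" if "w \<in> T" for w
    using card[OF that] deg by force
  show "poly P ` (poly P -` T) = T" using ne by force
  fix w assume w: "w \<in> T"
  define Z where "Z = {z. poly P z = w}"
  have Zfin: "finite Z" and Zcard: "card Z = degree P" using fin card[OF w] by (auto simp: Z_def)
  have hol: "poly P holomorphic_on S" for S by (intro holomorphic_intros)
  obtain d where d: "d > 0" "\<And>x y. x \<in> Z \<Longrightarrow> y \<in> Z \<Longrightarrow> x \<noteq> y \<Longrightarrow> d \<le> dist x y"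
  proof -
    define D where "D = insert 1 ((\<lambda>(x,y). dist x y) ` {(x,y) \<in> Z \<times> Z. x \<noteq> y})"
    have "finite ({(x,y) \<in> Z \<times> Z. x \<noteq> y})" using Zfin by (auto intro: finite_subset[of _ "Z \<times> Z"])
    then have "finite D" by (simp add: D_def)
    moreover have "D \<noteq> {}" by (simp add: D_def)
    ultimately have "Min D \<in> D" and le: "\<And>t. t \<in> D \<Longrightarrow> Min D \<le> t" by (rule Min_in, simp)
    then have "Min D > 0" by (force simp: D_def)
    moreover have "Min D \<le> dist x y" if "x \<in> Z" "y \<in> Z" "x \<noteq> y" for x y
      using that by (intro le) (force simp: D_def)
    ultimately show ?thesis using that by blast
  qed
  have "\<exists>r. r > 0 \<and> inj_on (poly P) (ball z r)" if "z \<in> Z" for z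
  proof -
    have "deriv (poly P) z \<noteq> 0"
      using reg[of z] that w by (simp add: Z_def DERIV_imp_deriv[OF poly_DERIV])
    from has_complex_derivative_locally_injective[OF hol _ open_UNIV this] show ?thesis by auto
  qed
  then obtain r where r: "\<And>z. z \<in> Z \<Longrightarrow> r z > 0 \<and> inj_on (poly P) (ball z (r z))" by metis
  define O' where "O' z = ball z (min (r z) (d / 2))" for z
  have O_inj: "inj_on (poly P) (O' z)" if "z \<in> Z" for z
    using r[OF that] by (auto simp: O'_def intro: inj_on_subset)
  have O_in: "z \<in> O' z" if "z \<in> Z" for z using r[OF that] d by (simp add: O'_def)
  have O_disj: "O' x \<inter> O' y = {}" if "x \<in> Z" "y \<in> Z" "x \<noteq> y" for x y
  proof -
    have False if u: "u \<in> O' x" "u \<in> O' y" for u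
    proof -
      have "dist x y \<le> dist x u + dist y u" by (metis dist_commute dist_triangle)
      also have "\<dots> < d" using u by (simp add: O'_def)
      finally show False using d(2)[OF \<open>x \<in> Z\<close> \<open>y \<in> Z\<close> \<open>x \<noteq> y\<close>] by simp
    qed
    then show ?thesis by auto
  qed
  define N where "N = T \<inter> (\<Inter>z\<in>Z. poly P ` O' z)"
  have N_open: "open N"
    unfolding N_def using Zfin O_inj T
    by (intro open_Int open_INT) (auto intro!: open_mapping_thm3[OF hol] simp: O'_def)
  have wN: "w \<in> N" using w O_in by (force simp: N_def Z_def)
  define S where "S z = O' z \<inter> poly P -` N" for z
  have S_open: "open (S z)" for z
    unfolding S_def O'_def by (intro open_Int open_vimage N_open continuous_intros) auto
  have S_im: "poly P ` S z = N" if "z \<in> Z" for z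
  proof (intro equalityI subsetI)
    fix x assume x: "x \<in> N"
    then have "x \<in> poly P ` O' z" using that by (simp add: N_def)
    then obtain u where "u \<in> O' z" "x = poly P u" by (rule imageE)
    then show "x \<in> poly P ` S z" using x by (simp add: S_def)
  qed (auto simp: S_def)
  have preim: "u \<in> (\<Union>z\<in>Z. S z)" if u: "poly P u \<in> N" for u
  proof -
    have "\<exists>x. x \<in> S z \<and> poly P x = poly P u" if "z \<in> Z" for z
      using S_im[OF that] u by (metis imageE)
    then obtain g where g: "\<And>z. z \<in> Z \<Longrightarrow> g z \<in> S z \<and> poly P (g z) = poly P u" by metis
    have "inj_on g Z"
      using g O_disj by (fastforce simp: inj_on_def S_def)
    then have "card (g ` Z) = degree P" using Zcard by (simp add: card_image)
    moreover have "g ` Z \<subseteq> {z. poly P z = poly P u}" using g by auto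
    moreover have "card {z. poly P z = poly P u} = degree P" using card u by (simp add: N_def)
    ultimately have "g ` Z = {z. poly P z = poly P u}" using fin by (metis card_subset_eq)
    then obtain z where "z \<in> Z" "u = g z" by blast
    then show ?thesis using g by auto
  qed
  show "\<exists>N. w \<in> N \<and> openin (top_of_set T) N \<and>
        (\<exists>v. \<Union> v = poly P -` T \<inter> poly P -` N \<and> (\<forall>u\<in>v. openin (top_of_set (poly P -` T)) u) \<and>
            pairwise disjnt v \<and> (\<forall>u\<in>v. \<exists>q. homeomorphism u N (poly P) q))"
  proof (intro exI[of _ N] exI[of _ "S ` Z"] conjI ballI)
    show "w \<in> N" by (rule wN)
    show "openin (top_of_set T) N" using N_open by (intro open_openin_trans T) (auto simp: N_def T)
    show "\<Union> (S ` Z) = poly P -` T \<inter> poly P -` N"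
      using preim by (auto simp: S_def N_def)
    show "openin (top_of_set (poly P -` T)) u" if "u \<in> S ` Z" for u
      using that S_open T
      by (auto intro!: open_openin_trans open_vimage continuous_intros simp: S_def N_def)
    show "pairwise disjnt (S ` Z)"
    proof (rule pairwiseI)
      fix A B assume AB: "A \<in> S ` Z" "B \<in> S ` Z" "A \<noteq> B"
      then obtain x y where xy: "x \<in> Z" "y \<in> Z" "A = S x" "B = S y" by blast
      then have "O' x \<inter> O' y = {}" using O_disj[of x y] AB by auto
      then show "disjnt A B" unfolding disjnt_def xy S_def by blast
    qed
    fix u assume "u \<in> S ` Z"
    then obtain z where z: "z \<in> Z" "u = S z" by auto
    have inj: "inj_on (poly P) (S z)" using O_inj[OF z(1)] by (rule inj_on_subset) (auto simp: S_def)
    have op: "openin (top_of_set N) (poly P ` X)" if "openin (top_of_set (S z)) X" for X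
    proof -
      have X: "open X" "X \<subseteq> S z" using that S_open openin_open_eq by blast+
      then have "open (poly P ` X)" using inj by (intro open_mapping_thm3[OF hol]) (auto intro: inj_on_subset)
      then show ?thesis using X S_im[OF z(1)] N_open by (auto intro!: open_openin_trans)
    qed
    have "continuous_on (S z) (poly P)" by (intro continuous_intros)
    from homeomorphism_injective_open_map[OF this S_im[OF z(1)] inj op]
    obtain q where "homeomorphism (S z) N (poly P) q" by blast
    then show "\<exists>q. homeomorphism u N (poly P) q" unfolding z(2) by blast
  qed
qed

definition cubic_poly :: "complex \<times> complex \<Rightarrow> complex poly" where
  "cubic_poly F = [: 2 * (fst F) ^ 3 + snd F, - 3 * (fst F)\<^sup>2, 0, 1 :]"

lemma poly_cubic_poly: "poly (cubic_poly F) = cubic F"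
  by (auto simp: cubic_poly_def cubic_def algebra_simps power3_eq_cube)

fun iterate_poly :: "complex \<times> complex \<Rightarrow> nat \<Rightarrow> complex poly" where
  "iterate_poly F 0 = [:0, 1:]"
| "iterate_poly F (Suc n) = pcompose (cubic_poly F) (iterate_poly F n)"

lemma poly_iterate_poly: "poly (iterate_poly F n) = (cubic F ^^ n)"
  by (induction n) (auto simp: poly_pcompose poly_cubic_poly fun_eq_iff)

lemma degree_iterate_poly: "degree (iterate_poly F n) > 0"
proof (induction n)
  case (Suc n)
  have "degree (cubic_poly F) = 3" by (simp add: cubic_poly_def)
  then show ?case using Suc by (simp add: degree_pcompose)
qed simp

lemma iterate_covering_space:
  assumes "open T" "\<And>n. 1 \<le> n \<Longrightarrow> (cubic F ^^ n) (fst F) \<notin> T" "\<And>n. 1 \<le> n \<Longrightarrow> (cubic F ^^ n) (- fst F) \<notin> T"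
  shows "covering_space ((cubic F ^^ n) -` T) (cubic F ^^ n) T"
proof -
  have "poly (pderiv (iterate_poly F n)) z \<noteq> 0" if z: "poly (iterate_poly F n) z \<in> T" for z
  proof
    assume "poly (pderiv (iterate_poly F n)) z = 0"
    moreover have "poly (pderiv (iterate_poly F n)) z = iterate_deriv F n z"
      using DERIV_imp_deriv[OF poly_DERIV[of "iterate_poly F n" z]] by (simp add: poly_iterate_poly deriv_iterate)
    ultimately obtain j where j: "j < n" "(cubic F ^^ j) z = fst F \<or> (cubic F ^^ j) z = - fst F"
      using iterate_deriv_eq_0_iff[of F n z] by auto
    have "(cubic F ^^ n) z = (cubic F ^^ (n - j)) ((cubic F ^^ j) z)"
      using j(1) by (simp flip: funpow_add o_apply[of "cubic F ^^ (n - j)"])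
    then show False using z j assms(2,3)[of "n - j"] by (auto simp: poly_iterate_poly)
  qed
  from polynomial_covering_space[OF degree_iterate_poly assms(1) this] show ?thesis
    by (simp add: poly_iterate_poly)
qed

section \<open>Bounded critical orbits and connectedness\<close>

text \<open>
  The complement \<open>C\<close> of the sublevel set is pushed towards infinity: scaling the values of \<open>g\<close>
  radially is a homotopy in \<open>{w. R < norm w}\<close>, and lifting it through the covering moves every
  point of \<open>C\<close> out of a large disc without leaving \<open>C\<close>.
  
  Suppose the sublevel set is the disjoint union of two closed pieces, containing \<open>c\<close> and \<open>c'\<close>. The
  function \<open>f z = (z - c) / (z - c')\<close> on \<open>C\<close> is then homotopic, without zeros, to a function with values
  in the right half plane, so it has a continuous logarithm \<open>L\<close> on \<open>C\<close>. Take a bounded neighbourhood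
  \<open>U\<close> of the piece of \<open>c\<close> and a continuous extension \<open>L1\<close> of \<open>L\<close>. The function
  \<open>H\<close> that is \<open>(z - c') exp (L1 z)\<close> on \<open>U\<close> and \<open>z - c\<close> elsewhere is continuous and has no zeros in
  the plane, yet it winds once around 0 on large circles. Normalizing it gives a retraction of a disc
  onto its boundary.
\<close>

lemma connected_closed_sublevel:
  fixes g :: "complex \<Rightarrow> complex"
  assumes cov: "covering_space (g -` {w. R < norm w}) g {w. R < norm w}"
    and cont: "continuous_on UNIV g" and R: "R > 0"
    and sub: "{z. norm (g z) \<le> R} \<subseteq> cball 0 R"
  shows "connected {z. norm (g z) \<le> R}"
proof (rule ccontr)
  define K where "K = {z. norm (g z) \<le> R}"
  define C where "C = g -` {w. R < norm w}"
  have CK: "C = - K" by (auto simp: C_def K_def)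
  have K_closed: "closed K"
    unfolding K_def by (intro closed_Collect_le continuous_intros cont)
  have K_sub: "K \<subseteq> cball 0 R" using sub by (simp add: K_def)
  assume "\<not> connected {z. norm (g z) \<le> R}"
  then obtain A' B' where AB': "closed A'" "closed B'" "K \<subseteq> A' \<union> B'" "A' \<inter> B' \<inter> K = {}"
    "A' \<inter> K \<noteq> {}" "B' \<inter> K \<noteq> {}"
    unfolding K_def[symmetric] connected_closed by blast
  obtain c c' where c: "c \<in> A'" "c \<in> K" and c': "c' \<in> B'" "c' \<in> K" using AB' by blast
  obtain U0 V where UV: "open U0" "open V" "A' \<inter> K \<subseteq> U0" "B' \<inter> K \<subseteq> V" "U0 \<inter> V = {}"
    using separation_normal[of "A' \<inter> K" "B' \<inter> K"] AB' K_closed by (auto simp: Int_ac)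
  define U where "U = U0 \<inter> ball 0 (R + 1)"
  have U: "open U" "U \<inter> V = {}" "K \<subseteq> U \<union> V" "c \<in> U" "c' \<in> V"
    using UV K_sub AB' c c' by (auto simp: U_def)
  have cR: "norm c \<le> R" "norm c' \<le> R" using c c' K_sub by auto
  have cC: "c \<notin> C" "c' \<notin> C" using c c' by (auto simp: CK)
  have "bounded (g ` cball 0 (3 * R))"
    by (intro compact_imp_bounded compact_continuous_image continuous_on_subset[OF cont]) auto
  then obtain Mb where Mb: "\<And>z. z \<in> cball 0 (3 * R) \<Longrightarrow> norm (g z) \<le> Mb"
    unfolding bounded_iff by blast
  define N where "N = \<bar>Mb\<bar> / R"
  have "(1 + N) * R = R + \<bar>Mb\<bar>" using R by (simp add: N_def distrib_right)
  then have N: "N \<ge> 0" "(1 + N) * R > Mb" using R by (auto simp: N_def)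
  \<comment> \<open>\<open>N\<close> is chosen so that at time 1 the values of \<open>g\<close> exceed its maximum on the disc of radius \<open>3 R\<close>.\<close>
  define h where "h = (\<lambda>(s::real, z). complex_of_real (1 + s * N) * g z)"
  have h_norm: "norm (h (s, z)) = (1 + s * N) * norm (g z)" if "s \<in> {0..1}" for s z
    using that N by (simp add: h_def norm_mult del: of_real_add of_real_mult)
  have cont_h: "continuous_on ({0..1} \<times> C) h"
    unfolding h_def case_prod_unfold
    by (intro continuous_intros continuous_on_compose2[OF cont]) auto
  have him: "h \<in> {0..1} \<times> C \<rightarrow> {w. R < norm w}"
  proof clarify
    fix s :: real and z assume sz: "s \<in> {0..1}" "z \<in> C"
    have "norm (g z) \<le> (1 + s * N) * norm (g z)" using sz N by (simp add: algebra_simps)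
    then show "R < norm (h (s, z))" using sz by (simp add: h_norm C_def)
  qed
  obtain k where k: "continuous_on ({0..1} \<times> C) k" "k \<in> {0..1} \<times> C \<rightarrow> C"
      "\<And>z. z \<in> C \<Longrightarrow> k (0, z) = z" "\<And>y. y \<in> {0..1} \<times> C \<Longrightarrow> h y = g (k y)"
    using covering_space_lift_homotopy[OF cov[folded C_def] cont_h him, of "\<lambda>z. z"]
    by (auto simp: h_def)
  have far: "norm (k (1, z)) > 3 * R" if z: "z \<in> C" for z
  proof (rule ccontr)
    assume "\<not> ?thesis"
    then have "norm (g (k (1, z))) \<le> Mb" by (intro Mb) auto
    moreover have "norm (g (k (1, z))) = (1 + N) * norm (g z)"
      using h_norm[of 1 z] k(4)[of "(1, z)"] z by simp
    moreover have "(1 + N) * norm (g z) \<ge> (1 + N) * R"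
      using z N by (intro mult_left_mono) (auto simp: C_def)
    ultimately show False using N by linarith
  qed
  define f where "f z = (z - c) / (z - c')" for z
  have f_cont: "continuous_on C f" unfolding f_def using cC by (intro continuous_intros) auto
  have f_nz: "f z \<noteq> 0" if "z \<in> C" for z using that cC by (auto simp: f_def)
  have hom: "homotopic_with_canon (\<lambda>_. True) C (- {0}) f (\<lambda>z. f (k (1, z)))"
  proof (rule homotopic_with[THEN iffD2])
    show "\<exists>h. continuous_map (prod_topology (top_of_set {0..1::real}) (top_of_set C)) (top_of_set (- {0})) h \<and>
      (\<forall>x\<in>topspace (top_of_set C). h (0, x) = f x) \<and>
      (\<forall>x\<in>topspace (top_of_set C). h (1, x) = f (k (1, x))) \<and> (\<forall>t\<in>{0..1}. True)"
    proof (intro exI[of _ "f \<circ> k"] conjI ballI)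
      show "continuous_map (prod_topology (top_of_set {0..1::real}) (top_of_set C)) (top_of_set (- {0})) (f \<circ> k)"
      proof -
        have kC: "k y \<in> C" if "y \<in> {0..1} \<times> C" for y using k(2) that by blast
        then have "continuous_on ({0..1} \<times> C) (f \<circ> k)"
          by (intro continuous_on_compose k(1) continuous_on_subset[OF f_cont]) auto
        moreover have "(f \<circ> k) y \<in> - {0}" if "y \<in> {0..1} \<times> C" for y using f_nz kC[OF that] by simp
        ultimately show ?thesis by (auto simp flip: subtopology_Times simp del: o_apply)
      qed
    qed (use k in auto)
  qed auto
  \<comment> \<open>The points \<open>c\<close> and \<open>c'\<close> lie in the disc of radius \<open>R\<close>, so \<open>f\<close> is within distance 1 of 1 beyond
    radius \<open>3 R\<close>.\<close>
  have Re_pos: "Re (f (k (1, z))) > 0" if z: "z \<in> C" for z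
  proof -
    define u where "u = k (1, z)"
    have u: "norm u > 3 * R" using far[OF z] by (simp add: u_def)
    have "norm (c' - c) \<le> 2 * R" using cR norm_triangle_ineq4[of c' c] by linarith
    moreover have "norm (u - c') > 2 * R" using u cR norm_triangle_ineq2[of u c'] by linarith
    ultimately have lt: "norm ((c' - c) / (u - c')) < 1" using R by (simp add: norm_divide divide_simps)
    have "u - c' \<noteq> 0" using \<open>norm (u - c') > 2 * R\<close> R by auto
    then have "f u = 1 + (c' - c) / (u - c')" by (simp add: f_def field_simps)
    moreover have "Re ((c' - c) / (u - c')) > - 1"
      using abs_Re_le_cmod[of "(c' - c) / (u - c')"] lt by linarith
    ultimately show ?thesis by (simp add: u_def)
  qed
  have "continuous_on C (\<lambda>z. Ln (f (k (1, z))))"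
  proof (intro continuous_intros continuous_on_compose2[OF f_cont] continuous_on_compose2[OF k(1)])
    show "(\<lambda>x. k (1, x)) ` C \<subseteq> C" using k(2) by auto
    show "f (k (1, z)) \<notin> \<real>\<^sub>\<le>\<^sub>0" if "z \<in> C" for z
      using Re_pos[OF that] by (auto simp: complex_nonpos_Reals_iff)
  qed auto
  moreover have "\<forall>z\<in>C. f (k (1, z)) = exp (Ln (f (k (1, z))))"
    using Re_pos by (metis exp_Ln less_irrefl zero_complex.simps(1))
  ultimately obtain b where "homotopic_with_canon (\<lambda>_. True) C (- {0}) (\<lambda>z. f (k (1, z))) (\<lambda>_. b)"
    using inessential_eq_continuous_logarithm[of C "\<lambda>z. f (k (1, z))"] by blast
  then have "homotopic_with_canon (\<lambda>_. True) C (- {0}) f (\<lambda>_. b)"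
    using hom homotopic_with_trans by blast
  then obtain L where L: "continuous_on C L" "\<And>z. z \<in> C \<Longrightarrow> f z = exp (L z)"
    using inessential_eq_continuous_logarithm[of C f] by blast
  define X where "X = - (U \<union> V)"
  have X: "closed X" "X \<subseteq> C" using U UV by (auto simp: X_def CK)
  obtain L1 where L1: "continuous_on UNIV L1" "\<And>z. z \<in> X \<Longrightarrow> L1 z = L z"
    using Tietze_unbounded[of X L UNIV] X L continuous_on_subset by (metis closed_closedin subtopology_UNIV)
  define H where "H z = (if z \<in> U then (z - c') * exp (L1 z) else z - c)" for z
  have "continuous_on (closure U \<union> - U) H"
    unfolding H_def
  proof (rule continuous_on_cases)
    show "closed (closure U)" "closed (- U)" using U by auto
    show "continuous_on (closure U) (\<lambda>z. (z - c') * exp (L1 z))"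
      by (intro continuous_intros continuous_on_subset[OF L1(1)]) auto
    show "continuous_on (- U) (\<lambda>z. z - c)" by (intro continuous_intros)
    show "\<forall>x. x \<in> closure U \<and> x \<notin> U \<or> x \<in> - U \<and> x \<in> U \<longrightarrow> (x - c') * exp (L1 x) = x - c"
    proof clarify
      fix x assume x: "x \<in> closure U \<and> x \<notin> U \<or> x \<in> - U \<and> x \<in> U"
      then have "x \<notin> V" using U UV open_Int_closure_eq_empty[of V U] by blast
      then have "x \<in> X" using x by (auto simp: X_def)
      moreover from this have "exp (L x) = f x" using L X by auto
      moreover have "x \<noteq> c'" using \<open>x \<notin> V\<close> U by auto
      ultimately show "(x - c') * exp (L1 x) = x - c" using L1 by (simp add: f_def)
    qed
  qed
  moreover have "closure U \<union> - U = UNIV" using closure_subset by auto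
  ultimately have H_cont: "continuous_on UNIV H" by simp
  have H_nz: "H z \<noteq> 0" for z using U by (auto simp: H_def)
  define \<rho> where "\<rho> = norm c + R + 2"
  have \<rho>: "\<rho> > 0" using R norm_ge_zero[of c] by (simp add: \<rho>_def add_nonneg_pos add_pos_pos)
  define r where "r z = c + of_real (\<rho> / norm (H z)) * H z" for z
  have "frontier (cball c \<rho>) retract_of cball c \<rho>"
    unfolding retract_of_def
  proof (intro exI[of _ r] retraction[THEN iffD2] conjI)
    show "frontier (cball c \<rho>) \<subseteq> cball c \<rho>" by auto
    show "continuous_on (cball c \<rho>) r"
      unfolding r_def by (intro continuous_intros continuous_on_subset[OF H_cont]) (auto simp: H_nz)
    have rn: "r x \<in> sphere c \<rho>" for x
      using \<rho> H_nz[of x] by (simp add: r_def dist_norm norm_mult norm_divide)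
    have fixr: "r x = x" if "x \<in> sphere c \<rho>" for x
    proof -
      have "norm x \<ge> \<rho> - norm c" using that norm_triangle_ineq4[of x c] by (simp add: dist_norm norm_minus_commute)
      then have "x \<notin> U" by (auto simp: U_def \<rho>_def)
      then have "H x = x - c" by (simp add: H_def)
      then show ?thesis using that \<rho> by (simp add: r_def dist_norm norm_minus_commute)
    qed
    show "r ` cball c \<rho> = frontier (cball c \<rho>)" using rn fixr \<rho> by (force simp: frontier_cball)
    show "\<forall>x\<in>frontier (cball c \<rho>). r x = x" using fixr \<rho> by (auto simp: frontier_cball)
  qed
  then show False using no_retraction_cball[OF \<rho>] by blast
qed

text \<open>
  The filled Julia set is the decreasing intersection of the compact sets \<open>K n\<close> of points that stay
  in the disc of radius \<open>R\<close> up to time \<open>n\<close>; when both critical orbits are bounded, all critical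
  values of the iterates lie in that disc and \<open>connected_closed_sublevel\<close> applies to each of them.
\<close>

theorem connected_filled_juliaI:
  assumes "fst F \<in> filled_julia F" "- fst F \<in> filled_julia F"
  shows "connected (filled_julia F)"
proof -
  define B where "B = norm (fst F) + norm (snd F)"
  define R where "R = 3 * (B + 1)"
  have R: "R > 0" by (simp add: R_def B_def add_nonneg_pos)
  define K where "K n = {z. norm ((cubic F ^^ n) z) \<le> R}" for n
  have KF: "filled_julia F = (\<Inter>n. K n)"
    using filled_julia_iff_bounded_by[of F B] by (auto simp: K_def R_def B_def)
  have nest: "K n \<subseteq> K m" if "m \<le> n" for m n
    using escape_stays[of F B m _ n] that by (force simp: K_def R_def B_def not_less)
  have sub: "K n \<subseteq> cball 0 R" for n using nest[of 0 n] by (auto simp: K_def)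
  have crit: "norm ((cubic F ^^ n) z) \<le> R" if "z \<in> filled_julia F" for n z
    using that filled_julia_iff_bounded_by[of F B z] by (simp add: R_def B_def)
  have conn: "connected (K n)" for n
    unfolding K_def
  proof (rule connected_closed_sublevel[OF _ continuous_iterate R])
    show "covering_space ((cubic F ^^ n) -` {w. R < norm w}) (cubic F ^^ n) {w. R < norm w}"
      using crit[OF assms(1)] crit[OF assms(2)]
      by (intro iterate_covering_space open_Collect_less continuous_intros) (auto simp: not_less)
    show "{z. norm ((cubic F ^^ n) z) \<le> R} \<subseteq> cball 0 R" using sub[of n] by (simp add: K_def)
  qed
  have "closed (K n)" for n
    unfolding K_def by (intro closed_Collect_le continuous_intros continuous_iterate)
  then have "compact (K n)" for n
    using sub[of n] bounded_subset[OF bounded_cball] by (auto simp: compact_eq_bounded_closed)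
  then show ?thesis unfolding KF by (intro connected_nest conn nest)
qed

section \<open>Connectedness and the free critical orbit\<close>

text \<open>
  By the maximum principle for the iterates, the complement has no bounded component.
\<close>

lemma connected_complement_filled_julia: "connected (- filled_julia F)"
proof -
  let ?K = "filled_julia F"
  define B where "B = norm (fst F) + norm (snd F)"
  have unb: "\<not> bounded C" if C: "C \<in> components (- ?K)" for C
  proof
    assume b: "bounded C"
    have oC: "open C" using C closed_filled_julia open_components open_Compl by blast
    have fr: "frontier C \<subseteq> ?K"
      using C closed_filled_julia frontier_of_components_closed_complement by blast
    have "norm ((cubic F ^^ n) z) \<le> 3 * (B + 1)" if z: "z \<in> C" for n z
    proof (rule maximum_modulus_frontier[OF holomorphic_iterate continuous_iterate b _ z])
      show "norm ((cubic F ^^ n) x) \<le> 3 * (B + 1)" if "x \<in> frontier C" for x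
        using fr that filled_julia_iff_bounded_by[of F B x] by (auto simp: B_def)
    qed
    then have "C \<subseteq> ?K" using filled_julia_iff_bounded_by[of F B] by (auto simp: B_def)
    moreover have "C \<subseteq> - ?K" "C \<noteq> {}" using C in_components_subset in_components_nonempty by blast+
    ultimately show False by blast
  qed
  have "bounded (- (- ?K))" using compact_imp_bounded[OF compact_filled_julia[of F]] by simp
  then have "C = C'" if "C \<in> components (- ?K)" "C' \<in> components (- ?K)" for C C'
    using cobounded_unique_unbounded_components[of "- ?K" C C'] that unb by auto
  then show ?thesis unfolding connected_eq_connected_components_eq by blast
qed

text \<open>
  The situation to be refuted: \<open>K\<close> is connected and contains \<open>a\<close> but not \<open>- a\<close>. In the coordinate
  \<open>y = 1 / (z - a)\<close> the complement of \<open>K\<close>, with the point at infinity added, becomes the open set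
  \<open>S\<close>, and the cubic becomes \<open>G\<close>, a self-map of \<open>S\<close> with a triple zero at 0. Division by zero
  yields 0, so \<open>a + inverse 0\<close> is \<open>a\<close>, a point of \<open>K\<close>; the point 0 therefore has to be added to
  \<open>S\<close> separately.
\<close>

locale escaping_critical_point =
  fixes a v :: complex and K :: "complex set"
  defines "K \<equiv> filled_julia (a, v)"
  assumes conn: "connected K" and aK: "a \<in> K" and maK: "- a \<notin> K"
begin

definition S :: "complex set" where "S = {y. y = 0 \<or> a + inverse y \<notin> K}"
definition den :: "complex \<Rightarrow> complex" where "den y = 1 + 3 * a * y + (v - a) * y ^ 3"
definition G :: "complex \<Rightarrow> complex" where "G y = y ^ 3 / den y"

lemma a_nz: "a \<noteq> 0" using aK maK by auto

lemma K_compact: "compact K" unfolding K_def by (rule compact_filled_julia)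
lemma K_closed: "closed K" unfolding K_def by (rule closed_filled_julia)

lemma zero_S [simp]: "0 \<in> S" by (simp add: S_def)

lemma K_radius: obtains M where "M > 0" "\<And>z. z \<in> K \<Longrightarrow> norm (z - a) \<le> M"
proof -
  obtain M where "\<forall>z\<in>K. norm z \<le> M" using K_compact compact_imp_bounded bounded_iff by blast
  then have "norm (z - a) \<le> \<bar>M\<bar> + norm a + 1" if "z \<in> K" for z
    using that norm_triangle_ineq4[of z a] by fastforce
  moreover have "\<bar>M\<bar> + norm a + 1 > 0" using norm_ge_zero[of a] by linarith
  ultimately show ?thesis using that by blast
qed

lemma open_S: "open S"
proof -
  obtain M where M: "M > 0" "\<And>z. z \<in> K \<Longrightarrow> norm (z - a) \<le> M" using K_radius by blast
  have "ball 0 (1 / M) \<subseteq> S"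
  proof
    fix y assume y: "y \<in> ball (0::complex) (1 / M)"
    show "y \<in> S"
    proof (rule ccontr)
      assume n: "y \<notin> S"
      then have "norm (inverse y) \<le> M" "y \<noteq> 0" using M(2)[of "a + inverse y"] by (auto simp: S_def)
      moreover from this have "norm (inverse y) * norm y = 1" by (simp flip: norm_mult)
      ultimately have "1 \<le> M * norm y" by (metis mult_right_mono norm_ge_zero)
      then show False using y M(1) by (simp add: field_simps)
    qed
  qed
  then have eq: "S = ball 0 (1 / M) \<union> (- {0} \<inter> (\<lambda>y. a + inverse y) -` (- K))"
    using M(1) by (auto simp: S_def)
  have "open (- {0} \<inter> (\<lambda>y. a + inverse y) -` (- K))"
    using K_closed by (intro continuous_open_preimage continuous_intros) auto
  then show ?thesis by (subst eq) (rule open_Un[OF open_ball])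
qed

lemma connected_S: "connected S"
proof -
  have "(\<lambda>z. inverse (z - a)) ` (- K) = S - {0}" 
  proof (intro equalityI subsetI)
    fix y assume "y \<in> S - {0}"
    then show "y \<in> (\<lambda>z. inverse (z - a)) ` (- K)"
      by (intro image_eqI[of _ _ "a + inverse y"]) (auto simp: S_def)
  qed (use aK in \<open>auto simp: S_def\<close>)
  moreover have "connected ((\<lambda>z. inverse (z - a)) ` (- K))"
    using aK connected_complement_filled_julia[of "(a, v)"]
    by (intro connected_continuous_image continuous_intros) (auto simp: K_def)
  ultimately have "connected (S - {0})" by simp
  moreover have "S \<subseteq> closure (S - {0})"
  proof -
    have "0 islimpt S" using open_S by (simp add: open_imp_islimpt)
    then have "0 \<in> closure (S - {0})" by (simp add: islimpt_in_closure)
    moreover have "S - {0} \<subseteq> closure (S - {0})" by (rule closure_subset)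
    ultimately show ?thesis by fast
  qed
  ultimately show ?thesis 
    using connected_intermediate_closure[of "S - {0}" S] Diff_subset by metis
qed

text \<open>
  The winding number of a loop \<open>g\<close> in \<open>S\<close> around \<open>1 / (z - a)\<close>, as a function of \<open>z\<close> in \<open>K\<close>, is
  locally constant, and it is 0 for \<open>z\<close> close to \<open>a\<close> because \<open>1 / (z - a)\<close> is then large. As \<open>K\<close> is
  connected, it is 0 throughout.
\<close>

lemma simply_connected_S: "simply_connected S"
  unfolding simply_connected_eq_winding_number_zero[OF open_S]
proof (intro conjI allI impI connected_S)
  fix g w assume g: "path g \<and> path_image g \<subseteq> S \<and> pathfinish g = pathstart g \<and> w \<notin> S"
  then have pg: "path g" "path_image g \<subseteq> S" "pathfinish g = pathstart g" by auto
  define Z where "Z = {\<zeta>. \<zeta> \<notin> path_image g \<and> winding_number g \<zeta> = 0}"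
  define N where "N = {\<zeta>. \<zeta> \<notin> path_image g \<and> winding_number g \<zeta> \<noteq> 0}"
  have oZ: "open Z" unfolding Z_def using pg by (intro open_winding_number_levelsets) auto
  have "N = (\<Union>k\<in>-{0}. {\<zeta>. \<zeta> \<notin> path_image g \<and> winding_number g \<zeta> = k})" by (auto simp: N_def)
  then have oN: "open N" using pg by (auto intro!: open_UN open_winding_number_levelsets)
  obtain b where b: "b > 0" "\<And>\<zeta>. b \<le> norm \<zeta> \<Longrightarrow> \<zeta> \<in> Z"
  proof -
    obtain b0 where b0: "\<And>z. norm z \<ge> b0 \<Longrightarrow> winding_number g z = 0"
      using winding_number_zero_at_infinity[OF pg(1,3)] by blast
    obtain b1 where b1: "\<forall>z\<in>path_image g. norm z \<le> b1"
      using bounded_path_image[OF pg(1)] bounded_iff by blast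
    show ?thesis
      by (rule that[of "max 1 (max b0 (b1 + 1))"]) (use b0 b1 in \<open>force simp: Z_def\<close>)+
  qed
  define A1 where "A1 = ball a (1 / b) \<union> (- {a} \<inter> (\<lambda>z. inverse (z - a)) -` Z)"
  define A2 where "A2 = - {a} \<inter> (\<lambda>z. inverse (z - a)) -` N"
  have o1: "open A1" unfolding A1_def using oZ
    by (intro open_Un continuous_open_preimage continuous_intros) auto
  have o2: "open A2" unfolding A2_def using oN
    by (intro continuous_open_preimage continuous_intros) auto
  have disj: "A1 \<inter> A2 = {}"
  proof -
    have "inverse (z - a) \<in> Z" if "z \<in> ball a (1 / b)" "z \<noteq> a" for z
    proof (rule b(2))
      have "norm (z - a) < 1 / b" "norm (z - a) > 0" using that by (auto simp: dist_norm norm_minus_commute)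
      then have "b \<le> inverse (norm (z - a))" using b(1) by (simp add: field_simps)
      then show "b \<le> norm (inverse (z - a))" by (simp add: norm_inverse)
    qed
    moreover have "Z \<inter> N = {}" by (auto simp: Z_def N_def)
    ultimately show ?thesis unfolding A1_def A2_def by blast
  qed
  have cover: "K \<subseteq> A1 \<union> A2"
  proof
    fix z assume z: "z \<in> K"
    show "z \<in> A1 \<union> A2"
    proof (cases "z = a")
      case True then show ?thesis using b by (simp add: A1_def)
    next
      case False
      then have "inverse (z - a) \<notin> S" using z by (simp add: S_def)
      then have "inverse (z - a) \<in> Z \<union> N" using pg by (auto simp: Z_def N_def)
      then show ?thesis using False by (auto simp: A1_def A2_def)
    qed
  qed
  have "a \<in> A1" using b by (simp add: A1_def)
  moreover have "A1 \<inter> K = {} \<or> A2 \<inter> K = {}"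
    using disj by (intro connectedD[OF conn o1 o2 _ cover]) auto
  ultimately have "A2 \<inter> K = {}" using aK by blast
  moreover have w: "w \<noteq> 0" "a + inverse w \<in> K" using g by (auto simp: S_def)
  ultimately have "a + inverse w \<notin> A2" by blast
  then have "w \<notin> N" using w by (simp add: A2_def)
  then show "winding_number g w = 0" using g by (auto simp: N_def)
qed

lemma cubic_eq: "y \<noteq> 0 \<Longrightarrow> cubic (a, v) (a + inverse y) - a = den y / y ^ 3"
proof -
  assume y: "y \<noteq> 0"
  define u where "u = inverse y"
  have yu: "y * u = 1" using y by (simp add: u_def)
  have "den y * u ^ 3 = u ^ 3 + 3 * a * (y * u) * u\<^sup>2 + (v - a) * (y * u) ^ 3"
    by (simp add: den_def algebra_simps power2_eq_square power3_eq_cube)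
  then have "cubic (a, v) (a + u) - a = den y * u ^ 3"
    unfolding yu by (simp add: cubic_def algebra_simps power2_eq_square power3_eq_cube)
  also have "\<dots> = den y / y ^ 3" by (simp add: u_def divide_inverse power_inverse)
  finally show ?thesis by (simp add: u_def)
qed

lemma K_inv: "cubic (a, v) z \<in> K \<longleftrightarrow> z \<in> K"
  unfolding K_def by (rule filled_julia_cubic)

lemma den_nz: assumes "y \<in> S" shows "den y \<noteq> 0"
proof (cases "y = 0")
  case False
  then have "cubic (a, v) (a + inverse y) \<notin> K" using assms K_inv by (simp add: S_def)
  then have "cubic (a, v) (a + inverse y) - a \<noteq> 0" using aK by auto
  then show ?thesis unfolding cubic_eq[OF False] by auto
qed (simp add: den_def)

lemma G_eq_0_iff: "y \<in> S \<Longrightarrow> G y = 0 \<longleftrightarrow> y = 0"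
  using den_nz by (simp add: G_def)

lemma inverse_G: "y \<in> S \<Longrightarrow> y \<noteq> 0 \<Longrightarrow> a + inverse (G y) = cubic (a, v) (a + inverse y)"
proof -
  assume "y \<noteq> 0"
  then have "cubic (a, v) (a + inverse y) = a + den y / y ^ 3" using cubic_eq[of y] by (metis add.commute diff_add_cancel)
  then show ?thesis by (simp add: G_def)
qed

lemma G_S: "y \<in> S \<Longrightarrow> G y \<in> S"
proof (cases "y = 0")
  case False
  assume y: "y \<in> S"
  then have "a + inverse (G y) \<notin> K" using inverse_G[OF y False] K_inv False by (simp add: S_def)
  then show ?thesis by (simp add: S_def)
qed (simp add: G_def)

lemma G_holomorphic: "G holomorphic_on S"
proof -
  have "den holomorphic_on S" unfolding den_def by (intro holomorphic_intros)
  moreover have "(\<lambda>y. y ^ 3) holomorphic_on S" by (intro holomorphic_intros)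
  ultimately have "(\<lambda>y. y ^ 3 / den y) holomorphic_on S" using den_nz by (simp add: holomorphic_on_divide)
  then show ?thesis by (simp add: G_def[abs_def])
qed

text \<open>
  Points that \<open>G\<close> maps into a compact subset of \<open>S\<close> cannot approach the boundary of \<open>S\<close>, since
  \<open>K\<close> is invariant. In the coordinate \<open>z\<close> the preimage is \<open>E'\<close>, a closed set disjoint from \<open>K\<close>.
\<close>

lemma G_proper:
  assumes D: "compact D" "D \<subseteq> S" "0 \<in> D"
  shows "compact {y \<in> S. G y \<in> D}"
proof -
  define D' where "D' = {z. z \<noteq> a \<and> inverse (z - a) \<in> D}"
  define E' where "E' = cubic (a, v) -` D'"
  have "closed D'"
    unfolding closed_sequential_limits
  proof clarify
    fix x l assume x: "\<forall>n. x n \<in> D'" "x \<longlonglongrightarrow> l"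
    obtain M where M: "\<forall>y\<in>D. norm y \<le> M" using compact_imp_bounded[OF D(1)] bounded_iff by blast
    have M0: "1 \<le> M * norm (x n - a)" for n
    proof -
      have le: "norm (inverse (x n - a)) \<le> M" and ne: "x n \<noteq> a" using x M by (auto simp: D'_def)
      have "norm (inverse (x n - a)) * norm (x n - a) = 1" using ne by (simp flip: norm_mult)
      then show ?thesis using le by (metis mult_right_mono norm_ge_zero)
    qed
    have "(\<lambda>n. M * norm (x n - a)) \<longlonglongrightarrow> M * norm (l - a)" by (intro tendsto_intros x)
    then have "1 \<le> M * norm (l - a)" using M0 by (intro LIMSEQ_le_const) auto
    then have la: "l \<noteq> a" by auto
    have "(\<lambda>n. inverse (x n - a)) \<longlonglongrightarrow> inverse (l - a)" using la by (intro tendsto_intros x) auto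
    moreover have "inverse (x n - a) \<in> D" for n using x by (auto simp: D'_def)
    ultimately have "inverse (l - a) \<in> D"
      using closed_sequentially[OF compact_imp_closed[OF D(1)], of "\<lambda>n. inverse (x n - a)"] by simp
    then show "l \<in> D'" using la by (simp add: D'_def)
  qed
  then have cE': "closed E'" unfolding E'_def
    using continuous_iterate[of UNIV 1 "(a, v)"] by (intro closed_vimage) auto
  have D'K: "D' \<inter> K = {}" using D(2) by (auto simp: D'_def S_def)
  then have E'K: "E' \<inter> K = {}" using K_inv by (auto simp: E'_def)
  have E: "{y \<in> S. G y \<in> D} = {y. y = 0 \<or> a + inverse y \<in> E'}"
  proof (intro set_eqI)
    fix y show "y \<in> {y \<in> S. G y \<in> D} \<longleftrightarrow> y \<in> {y. y = 0 \<or> a + inverse y \<in> E'}"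
    proof (cases "y = 0")
      case True then show ?thesis using D by (simp add: G_def)
    next
      case False
      show ?thesis
      proof (cases "y \<in> S")
        case True
        have "cubic (a, v) (a + inverse y) = a + inverse (G y)" "G y \<noteq> 0"
          using inverse_G[OF True False] G_eq_0_iff[OF True] False by auto
        then show ?thesis using True False by (auto simp: E'_def D'_def)
      next
        case F: False
        then have "a + inverse y \<in> K" by (simp add: S_def)
        then show ?thesis using F False E'K by auto
      qed
    qed
  qed
  have "closed {y. y = 0 \<or> a + inverse y \<in> E'}"
    unfolding closed_sequential_limits
  proof clarify
    fix x l assume x: "\<forall>n. x n \<in> {y. y = 0 \<or> a + inverse y \<in> E'}" "x \<longlonglongrightarrow> l" and l: "a + inverse l \<notin> E'"
    show "l = 0"
    proof (rule ccontr)
      assume "l \<noteq> 0"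
      then have "(\<lambda>n. a + inverse (x n)) \<longlonglongrightarrow> a + inverse l" by (intro tendsto_intros x)
      moreover have "\<forall>\<^sub>F n in sequentially. a + inverse (x n) \<in> E'"
        using tendsto_imp_eventually_ne[OF x(2) \<open>l \<noteq> 0\<close>] by eventually_elim (use x in auto)
      ultimately show False using Lim_in_closed_set[OF cE'] l by (metis trivial_limit_sequentially)
    qed
  qed
  moreover have "bounded {y. y = 0 \<or> a + inverse y \<in> E'}"
  proof -
    have "a \<in> - E'" "open (- E')" using aK E'K cE' by auto
    then obtain e where e: "e > 0" "ball a e \<subseteq> - E'" using open_contains_ball by blast
    have "norm y \<le> 1 / e" if "y = 0 \<or> a + inverse y \<in> E'" for y
    proof (cases "y = 0")
      case False
      then have "a + inverse y \<notin> ball a e" using that e by blast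
      then have "norm (inverse y) \<ge> e" by (simp add: dist_norm)
      then show ?thesis using False e by (simp add: norm_inverse norm_divide field_simps)
    qed (use e in simp)
    then show ?thesis unfolding bounded_iff by blast
  qed
  ultimately show ?thesis unfolding E by (simp add: compact_eq_bounded_closed)
qed

text \<open>
  Let \<open>f\<close> be a Riemann map from \<open>S\<close> to the unit disc that fixes 0, and \<open>g\<close> its inverse. Then
  \<open>b = f \<circ> G \<circ> g\<close> is a proper self-map of the disc whose only zero is a triple one at 0. So
  \<open>q x = b x / x\<^sup>3\<close> has no zeros and its modulus tends to 1 at the boundary; the maximum principle
  for \<open>q\<close> and for \<open>1 / q\<close> shows that \<open>q\<close> is a constant \<open>c\<close>. Hence \<open>b x = c x\<^sup>3\<close> has no
  critical point except 0, whereas the free critical point \<open>- a\<close> gives one.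
\<close>

lemma no_escaping_critical_point: False
proof -
  have S_nUNIV: "S \<noteq> UNIV"
  proof -
    have "cubic (a, v) (- 2 * a) = cubic (a, v) a"
      by (simp add: cubic_def algebra_simps power2_eq_square power3_eq_cube)
    then have "- 2 * a \<in> K" using K_inv[of "- 2 * a"] K_inv[of a] aK by simp
    moreover have "a + inverse (inverse (- 3 * a)) = - 2 * a"
      unfolding inverse_inverse_eq by simp
    ultimately have "a + inverse (inverse (- 3 * a)) \<in> K" by (simp only:)
    moreover have "inverse (- 3 * a) \<noteq> 0" using a_nz by simp
    ultimately have "inverse (- 3 * a) \<notin> S" unfolding S_def by blast
    then show ?thesis by blast
  qed
  obtain f1 g1 where fg1: "f1 holomorphic_on S" "g1 holomorphic_on ball 0 1"
      "\<And>z. z \<in> S \<Longrightarrow> f1 z \<in> ball 0 1 \<and> g1 (f1 z) = z"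
      "\<And>z. z \<in> ball 0 1 \<Longrightarrow> g1 z \<in> S \<and> f1 (g1 z) = z"
    using Riemann_mapping_theorem[of S] open_S simply_connected_S S_nUNIV zero_S by blast
  obtain f2 g2 where fg2: "f2 (f1 0) = 0" "f2 holomorphic_on ball 0 1" "f2 ` ball 0 1 \<subseteq> ball 0 1"
      "g2 holomorphic_on ball 0 1" "g2 ` ball 0 1 \<subseteq> ball 0 1"
      "\<And>z. z \<in> ball 0 1 \<Longrightarrow> f2 (g2 z) = z" "\<And>z. z \<in> ball 0 1 \<Longrightarrow> g2 (f2 z) = z"
    using ball_biholomorphism_exists[of "f1 0"] fg1(3) zero_S by metis
  define f where "f = f2 \<circ> f1"
  define g where "g = g1 \<circ> g2"
  have f_hol: "f holomorphic_on S" unfolding f_def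
    using fg1 fg2 by (intro holomorphic_on_compose_gen[of f1 S f2 "ball 0 1"]) auto
  have g_hol: "g holomorphic_on ball 0 1" unfolding g_def
    using fg1 fg2 by (intro holomorphic_on_compose_gen[of g2 "ball 0 1" g1 "ball 0 1"]) auto
  have f_ball: "f y \<in> ball 0 1" and gf: "g (f y) = y" if "y \<in> S" for y
    using that fg1(3)[OF that] fg2(3,7) by (auto simp: f_def g_def image_subset_iff)
  have g_S: "g x \<in> S" and fg: "f (g x) = x" if "x \<in> ball 0 1" for x
    using that fg1(4)[of "g2 x"] fg2(5,6) by (auto simp: f_def g_def image_subset_iff)
  have f0: "f 0 = 0" and g0: "g 0 = 0" using fg2(1) gf[OF zero_S] by (auto simp: f_def)
  have f_inj: "inj_on f S" using gf by (metis inj_onI)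
  have g_inj: "inj_on g (ball 0 1)" using fg by (metis inj_onI)
  define b where "b x = f (G (g x))" for x
  have b_ball: "b x \<in> ball 0 1" if "x \<in> ball 0 1" for x
    unfolding b_def using that by (intro f_ball G_S g_S)
  define e1 where "e1 y = (if y = 0 then deriv f 0 else f y / y)" for y
  define e2 where "e2 x = (if x = 0 then deriv g 0 else g x / x)" for x
  have e1: "e1 holomorphic_on S" "\<And>y. y \<in> S \<Longrightarrow> e1 y \<noteq> 0" "\<And>y. f y = y * e1 y"
  proof -
    show "e1 holomorphic_on S"
    proof -
      have "e1 = (\<lambda>z. if z = 0 then deriv f 0 else (f z - f 0) / (z - 0))"
        by (auto simp: e1_def f0 fun_eq_iff)
      then show ?thesis using pole_lemma_open[OF f_hol open_S, of 0] by (simp only:)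
    qed
    show "e1 y \<noteq> 0" if "y \<in> S" for y
    proof (cases "y = 0")
      case True
      then show ?thesis using holomorphic_injective_imp_regular[OF f_hol open_S f_inj zero_S] by (simp add: e1_def)
    next
      case False
      then have "f y \<noteq> f 0" using f_inj that zero_S by (auto simp: inj_on_def)
      then show ?thesis using False by (simp add: e1_def f0)
    qed
    show "f y = y * e1 y" for y by (simp add: e1_def f0)
  qed
  have e2: "e2 holomorphic_on ball 0 1" "\<And>x. x \<in> ball 0 1 \<Longrightarrow> e2 x \<noteq> 0" "\<And>x. g x = x * e2 x"
  proof -
    show "e2 holomorphic_on ball 0 1"
    proof -
      have "e2 = (\<lambda>z. if z = 0 then deriv g 0 else (g z - g 0) / (z - 0))"
        by (auto simp: e2_def g0 fun_eq_iff)
      then show ?thesis using pole_lemma_open[OF g_hol open_ball, of 0] by (simp only:)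
    qed
    show "e2 x \<noteq> 0" if "x \<in> ball 0 1" for x
    proof (cases "x = 0")
      case True
      then show ?thesis using holomorphic_injective_imp_regular[OF g_hol open_ball g_inj that] by (simp add: e2_def)
    next
      case False
      then have "g x \<noteq> g 0" using g_inj that by (auto simp: inj_on_def)
      then show ?thesis using False by (simp add: e2_def g0)
    qed
    show "g x = x * e2 x" for x by (simp add: e2_def g0)
  qed
  \<comment> \<open>The quotient \<open>b x / x\<^sup>3\<close> in a form that is defined at 0 and visibly has no zeros, in terms of the
    factors \<open>e1\<close> and \<open>e2\<close> that are left of \<open>f\<close> and \<open>g\<close> after dividing out their zeros at 0.\<close>
  define q where "q x = e2 x ^ 3 * e1 (G (g x)) / den (g x)" for x
  have bq: "b x = x ^ 3 * q x" for x
  proof -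
    have 1: "b x = G (g x) * e1 (G (g x))" unfolding b_def by (rule e1(3))
    have 2: "G (g x) = x ^ 3 * e2 x ^ 3 / den (g x)"
      unfolding G_def by (subst e2(3)) (simp add: power_mult_distrib)
    show ?thesis
      using trans[OF 1 arg_cong[OF 2, of "\<lambda>t. t * e1 (G (g x))"]] by (simp add: q_def)
  qed
  have gim: "g ` ball 0 1 \<subseteq> S" using g_S by blast
  have Gg_hol: "(\<lambda>x. G (g x)) holomorphic_on ball 0 1"
    using holomorphic_on_compose_gen[OF g_hol G_holomorphic gim] by (simp add: o_def)
  have e1Gg: "(\<lambda>x. e1 (G (g x))) holomorphic_on ball 0 1"
    using holomorphic_on_compose_gen[OF Gg_hol e1(1)] image_subsetI[of "ball 0 1" "\<lambda>x. G (g x)" S] G_S g_S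
    by (simp add: o_def)
  have deng: "(\<lambda>x. den (g x)) holomorphic_on ball 0 1"
    unfolding den_def by (intro holomorphic_intros g_hol)
  have q_hol: "q holomorphic_on ball 0 1"
    unfolding q_def using den_nz[OF g_S]
    by (intro holomorphic_on_divide holomorphic_on_mult holomorphic_on_power e2 e1Gg deng) auto
  have q_nz: "q x \<noteq> 0" if "x \<in> ball 0 1" for x
    using that e2(2) e1(2)[OF G_S[OF g_S]] den_nz[OF g_S] by (simp add: q_def)
  have upper: "norm (q x) \<le> 1" if x: "x \<in> ball 0 1" for x
  proof (rule field_le_mult_one_interval)
    fix t :: real assume t: "0 < t" "t < 1"
    have "\<forall>\<^sub>F r in at_left (1::real). t \<le> r ^ 3 \<and> norm x < r \<and> 0 < r \<and> r < 1"
    proof (intro eventually_conj)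
      have "((\<lambda>r::real. r ^ 3) \<longlongrightarrow> 1 ^ 3) (at_left 1)" by (intro tendsto_intros)
      then have "\<forall>\<^sub>F r in at_left (1::real). r ^ 3 > t" using t order_tendstoD(1) by fastforce
      then show "\<forall>\<^sub>F r in at_left (1::real). t \<le> r ^ 3" by eventually_elim auto
      show "\<forall>\<^sub>F r in at_left (1::real). norm x < r"
        using x by (intro order_tendstoD(1)[OF tendsto_ident_at]) auto
      show "\<forall>\<^sub>F r in at_left (1::real). 0 < r" by (intro order_tendstoD(1)[OF tendsto_ident_at]) auto
      show "\<forall>\<^sub>F r in at_left (1::real). r < 1" by (simp add: eventually_at_filter)
    qed
    then obtain r where r: "t \<le> r ^ 3" "norm x < r" "0 < r" "r < 1"
      using eventually_happens trivial_limit_at_left_real by blast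
    have "norm (q x) \<le> 1 / t"
    proof (rule maximum_modulus_frontier[of q "cball 0 r"])
      have sub: "cball 0 r \<subseteq> ball (0::complex) 1" using r by auto
      show "q holomorphic_on interior (cball 0 r)" "continuous_on (closure (cball 0 r)) q"
        using sub by (auto intro!: holomorphic_on_imp_continuous_on holomorphic_on_subset[OF q_hol])
      show "norm (q z) \<le> 1 / t" if "z \<in> frontier (cball 0 r)" for z
      proof -
        have z: "norm z = r" using that r by (simp add: frontier_cball)
        then have "norm (b z) \<le> 1" using b_ball[of z] r by simp
        then have "r ^ 3 * norm (q z) \<le> 1" using z by (simp add: bq norm_mult norm_power)
        moreover have "t * norm (q z) \<le> r ^ 3 * norm (q z)" using r by (intro mult_right_mono) auto
        ultimately show ?thesis using t by (simp add: field_simps)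
      qed
    qed (use r in auto)
    then show "t * norm (q x) \<le> 1" using t by (simp add: field_simps)
  qed
  have lower: "norm (inverse (q x)) \<le> 1" if x: "x \<in> ball 0 1" for x
  proof (rule field_le_mult_one_interval)
    fix t :: real assume t: "0 < t" "t < 1"
    have gt: "continuous_on (cball 0 t) g"
      using t by (intro holomorphic_on_imp_continuous_on holomorphic_on_subset[OF g_hol]) auto
    define D where "D = g ` cball 0 t"
    have D: "compact D" "D \<subseteq> S" "0 \<in> D"
      using t g_S g0 by (auto simp: D_def intro!: compact_continuous_image gt image_eqI[of 0 g 0])
    \<comment> \<open>Properness of \<open>G\<close> confines the preimage under \<open>b\<close> of the disc of radius \<open>t\<close> to a smaller disc,
      so \<open>b\<close> has modulus at least \<open>t\<close> on a circle around \<open>x\<close>.\<close>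
    define E where "E = {y \<in> S. G y \<in> D}"
    have E: "compact E" "E \<subseteq> S" using G_proper[OF D] by (auto simp: E_def)
    have "compact (f ` E)"
      using E by (intro compact_continuous_image holomorphic_on_imp_continuous_on holomorphic_on_subset[OF f_hol])
    moreover have "f ` E \<noteq> {}" using D by (auto simp: E_def G_def intro!: exI[of _ 0])
    ultimately obtain s where s: "s \<in> f ` E" "\<And>u. u \<in> f ` E \<Longrightarrow> norm u \<le> norm s"
      using continuous_attains_sup[of "f ` E" norm] continuous_on_norm_id by blast
    have s1: "norm s < 1" using s(1) E f_ball by fastforce
    define r where "r = (max (norm s) (norm x) + 1) / 2"
    have r: "norm s < r" "norm x < r" "r < 1" "0 < r"
      using s1 x unfolding r_def by (auto simp: max_def add_nonneg_pos)
    have big: "norm (b z) \<ge> t" if "norm z = r" for z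
    proof (rule ccontr)
      assume n: "\<not> norm (b z) \<ge> t"
      have zb: "z \<in> ball 0 1" using that r by simp
      have "g (b z) = G (g z)" unfolding b_def using zb by (intro gf G_S g_S)
      moreover have "g (b z) \<in> D" using n by (auto simp: D_def)
      ultimately have "g z \<in> E" using g_S[OF zb] by (simp add: E_def)
      then have "z \<in> f ` E" using fg[OF zb] by force
      then show False using s(2)[of z] that r by simp
    qed
    have "norm (inverse (q x)) \<le> 1 / t"
    proof (rule maximum_modulus_frontier[of "\<lambda>z. inverse (q z)" "cball 0 r"])
      have sub: "cball 0 r \<subseteq> ball (0::complex) 1" using r by auto
      have "(\<lambda>z. inverse (q z)) holomorphic_on ball 0 1" using q_nz by (intro holomorphic_intros q_hol) auto
      then have "(\<lambda>z. inverse (q z)) holomorphic_on cball 0 r" using sub by (rule holomorphic_on_subset)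
      then show "(\<lambda>z. inverse (q z)) holomorphic_on interior (cball 0 r)"
        "continuous_on (closure (cball 0 r)) (\<lambda>z. inverse (q z))"
        using holomorphic_on_subset[OF _ interior_subset]
        by (auto intro!: holomorphic_on_imp_continuous_on simp del: interior_cball)
      show "norm (inverse (q z)) \<le> 1 / t" if "z \<in> frontier (cball 0 r)" for z
      proof -
        have z: "norm z = r" using that r by (simp add: frontier_cball)
        have "t \<le> r ^ 3 * norm (q z)" using big[OF z] z by (simp add: bq norm_mult norm_power)
        also have "\<dots> \<le> 1 * norm (q z)" using r by (intro mult_right_mono power_le_one) auto
        finally have "t \<le> norm (q z)" by simp
        then show ?thesis using t by (simp add: norm_inverse divide_inverse le_imp_inverse_le)
      qed
    qed (use r in auto)
    then show "t * norm (inverse (q x)) \<le> 1" using t by (simp add: field_simps)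
  qed
  have q1: "norm (q x) = 1" if "x \<in> ball 0 1" for x
  proof (rule antisym[OF upper[OF that]])
    have "norm (inverse (q x)) * norm (q x) = 1" using q_nz[OF that] by (simp flip: norm_mult)
    moreover have "norm (inverse (q x)) * norm (q x) \<le> 1 * norm (q x)" using lower[OF that] by (intro mult_right_mono) auto
    ultimately show "1 \<le> norm (q x)" by simp
  qed
  have "q constant_on ball 0 1"
    by (rule maximum_modulus_principle[OF q_hol _ _ open_ball[of 0 1], of 0]) (auto simp: q1)
  then obtain c where c: "\<And>x. x \<in> ball 0 1 \<Longrightarrow> q x = c" by (auto simp: constant_on_def)
  have c0: "c \<noteq> 0" using q_nz[of 0] c[of 0] by auto
  define y0 where "y0 = inverse (- 2 * a)"
  have y0: "y0 \<in> S" "y0 \<noteq> 0"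
  proof -
    have eq: "a + inverse y0 = - a" unfolding y0_def inverse_inverse_eq by simp
    have "a + inverse y0 \<notin> K" unfolding eq by (rule maK)
    then show "y0 \<in> S" by (simp add: S_def)
    show "y0 \<noteq> 0" using a_nz by (simp add: y0_def)
  qed
  define x0 where "x0 = f y0"
  have x0: "x0 \<in> ball 0 1" "x0 \<noteq> 0" "g x0 = y0"
    using f_ball[OF y0(1)] gf[OF y0(1)] g0 y0(2) by (auto simp: x0_def)
  have "1 + 2 * a * y0 = 0" using a_nz by (simp add: y0_def field_simps)
  then have crit: "3 * y0\<^sup>2 * den y0 - y0 ^ 3 * (3 * a + 3 * (v - a) * y0\<^sup>2) = 0"
  proof -
    assume 1: "1 + 2 * a * y0 = 0"
    have "3 * y0\<^sup>2 * den y0 - y0 ^ 3 * (3 * a + 3 * (v - a) * y0\<^sup>2) = 3 * y0\<^sup>2 * (1 + 2 * a * y0)"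
      by (simp add: den_def algebra_simps power2_eq_square power3_eq_cube)
    then show ?thesis by (simp add: 1)
  qed
  have d_den: "(den has_field_derivative 3 * a + 3 * (v - a) * y0\<^sup>2) (at y0)"
    unfolding den_def by (rule derivative_eq_intros refl | simp)+
  have "(G has_field_derivative (3 * y0\<^sup>2 * den y0 - y0 ^ 3 * (3 * a + 3 * (v - a) * y0\<^sup>2)) / (den y0 * den y0)) (at y0)"
    unfolding G_def using den_nz[OF y0(1)]
    by (auto intro!: derivative_eq_intros d_den)
  then have dG: "(G has_field_derivative 0) (at (g x0))" unfolding crit x0(3) by simp
  have "(g has_field_derivative deriv g x0) (at x0)"
    using g_hol x0 by (intro holomorphic_derivI) auto
  from DERIV_chain2[OF dG this] have "((\<lambda>x. G (g x)) has_field_derivative 0) (at x0)" by simp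
  moreover have "(f has_field_derivative deriv f (G (g x0))) (at (G (g x0)))"
    using f_hol x0 G_S g_S open_S by (intro holomorphic_derivI) auto
  ultimately have "(b has_field_derivative 0) (at x0)"
    unfolding b_def using DERIV_chain2 by fastforce
  moreover have "(b has_field_derivative c * (3 * x0\<^sup>2)) (at x0)"
  proof (rule has_field_derivative_transform_within_open[of "\<lambda>x. c * x ^ 3" _ _ "ball 0 1"])
    show "((\<lambda>x. c * x ^ 3) has_field_derivative c * (3 * x0\<^sup>2)) (at x0)"
      by (auto intro!: derivative_eq_intros)
  qed (use x0 c in \<open>auto simp: bq\<close>)
  ultimately have "c * (3 * x0\<^sup>2) = 0" using DERIV_unique by blast
  then show False using c0 x0 by simp
qed

end

theorem free_critical_point_in_connected_filled_julia:
  assumes "connected (filled_julia F)" "fst F \<in> filled_julia F"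
  shows "- fst F \<in> filled_julia F"
proof (rule ccontr)
  assume "\<not> ?thesis"
  then interpret escaping_critical_point "fst F" "snd F" "filled_julia F"
    using assms by unfold_locales (auto simp flip: surjective_pairing)
  show False by (rule no_escaping_critical_point)
qed

section \<open>Inverse branches and convergence of holomorphic functions\<close>

lemma iterate_deriv_add: "iterate_deriv F (i + j) z = iterate_deriv F i ((cubic F ^^ j) z) * iterate_deriv F j z"
  by (induction i) (simp_all add: funpow_add)

lemma iterate_deriv_multiplier:
  assumes "(cubic F ^^ m) z = z"
  shows "iterate_deriv F (k * m) z = iterate_deriv F m z ^ k"
proof (induction k)
  case (Suc k)
  have "(cubic F ^^ (k * m)) z = z"
    using assms by (induction k) (auto simp: funpow_add)
  have "iterate_deriv F (m + k * m) z = iterate_deriv F m ((cubic F ^^ (k * m)) z) * iterate_deriv F (k * m) z"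
    by (rule iterate_deriv_add)
  then show ?case using Suc \<open>(cubic F ^^ (k * m)) z = z\<close> by simp
qed simp

lemma finite_orbit:
  fixes f :: "'a \<Rightarrow> 'a"
  assumes "m \<ge> 1" "(f ^^ (l + m)) x = (f ^^ l) x"
  shows "finite (range (\<lambda>n. (f ^^ n) x))"
proof -
  have "(f ^^ n) x \<in> (\<lambda>n. (f ^^ n) x) ` {..<l + m}" for n
  proof (induction n rule: less_induct)
    case (less n)
    show ?case
    proof (cases "n < l + m")
      case False
      define i where "i = n - (l + m)"
      have n: "n = i + (l + m)" using False by (simp add: i_def)
      have "(f ^^ n) x = (f ^^ i) ((f ^^ (l + m)) x)" unfolding n funpow_add[of i] by simp
      also have "\<dots> = (f ^^ i) ((f ^^ l) x)" by (simp only: assms(2))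
      also have "\<dots> = (f ^^ (i + l)) x" by (simp add: funpow_add)
      finally show ?thesis using less[of "i + l"] assms(1) n by simp
    qed simp
  qed
  then have "range (\<lambda>n. (f ^^ n) x) \<subseteq> (\<lambda>n. (f ^^ n) x) ` {..<l + m}" by blast
  then show ?thesis using finite_subset by blast
qed

lemma escape_at_infinity:
  assumes "w \<notin> filled_julia F"
  shows "filterlim (\<lambda>n. (cubic F ^^ n) w) at_infinity sequentially"
proof -
  define B where "B = norm (fst F) + norm (snd F)"
  have B0: "B \<ge> 0" by (simp add: B_def)
  obtain n0 where n0: "norm ((cubic F ^^ n0) w) > 3 * (B + 1)"
    using assms filled_julia_iff_bounded_by[of F B w] by (auto simp: B_def not_le)
  have low: "real n \<le> norm ((cubic F ^^ (n + n0)) w)" for n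
  proof -
    have "2 ^ n * 1 \<le> 2 ^ n * norm ((cubic F ^^ n0) w)" using n0 B0 by (intro mult_left_mono) auto
    also have "\<dots> \<le> norm ((cubic F ^^ n) ((cubic F ^^ n0) w))"
      using escape_iterate[of F B "(cubic F ^^ n0) w" n] n0 by (simp add: B_def)
    finally have "2 ^ n \<le> norm ((cubic F ^^ (n + n0)) w)" by (simp add: funpow_add)
    moreover have "real n < 2 ^ n" by (rule of_nat_less_two_power)
    ultimately show ?thesis by linarith
  qed
  have "filterlim (\<lambda>n. norm ((cubic F ^^ n) w)) at_top sequentially"
    unfolding filterlim_at_top
  proof
    fix Z :: real
    show "\<forall>\<^sub>F n in sequentially. Z \<le> norm ((cubic F ^^ n) w)"
      unfolding eventually_sequentially
    proof (intro exI allI impI)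
      fix n assume n: "n \<ge> nat \<lceil>Z\<rceil> + n0"
      then have "Z \<le> real (n - n0)" by linarith
      then show "Z \<le> norm ((cubic F ^^ n) w)" using low[of "n - n0"] n by simp
    qed
  qed
  then show ?thesis by (rule filterlim_norm_at_top_imp_at_infinity)
qed

lemma iterate_not_constant:
  assumes "open D" "z \<in> D"
  shows "\<not> (cubic F ^^ n) constant_on D"
proof
  assume "(cubic F ^^ n) constant_on D"
  then obtain c where c: "\<And>w. w \<in> D \<Longrightarrow> (cubic F ^^ n) w = c" by (auto simp: constant_on_def)
  have all: "(cubic F ^^ n) w = c" for w
    by (rule analytic_continuation_open[of D UNIV "cubic F ^^ n" "\<lambda>_. c"])
      (use assms c holomorphic_iterate in auto)
  define B where "B = norm (fst F) + norm (snd F)"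
  define w where "w = complex_of_real (3 * (B + 1) + norm c)"
  have B0: "B \<ge> 0" by (simp add: B_def)
  have w: "norm w = 3 * (B + 1) + norm c" unfolding w_def norm_of_real using B0 by simp
  have "2 ^ n * norm w \<le> norm ((cubic F ^^ n) w)"
    by (rule escape_iterate[of F B]) (auto simp: B_def w)
  moreover have "1 * norm w \<le> 2 ^ n * norm w" by (intro mult_right_mono) auto
  ultimately show False using all[of w] w B0 by simp
qed

text \<open>
  By Cauchy's inequality, derivatives of the iterates stay bounded at interior points of the filled
  Julia set, but at a repelling point they are powers of the multiplier.
\<close>

lemma repelling_not_in_interior:
  assumes m: "(cubic F ^^ m) a0 = a0" "norm (iterate_deriv F m a0) > 1"
    and e: "e > 0" "ball a0 e \<subseteq> filled_julia F"
  shows False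
proof -
  define B where "B = norm (fst F) + norm (snd F)"
  have le: "norm (iterate_deriv F m a0) ^ k \<le> 3 * (B + 1) / (e / 2)" for k
  proof -
    have "norm ((deriv ^^ 1) (cubic F ^^ (k * m)) a0) \<le> fact 1 * (3 * (B + 1)) / (e / 2) ^ 1"
    proof (rule Cauchy_inequality)
      show "norm ((cubic F ^^ (k * m)) x) \<le> 3 * (B + 1)" if "norm (a0 - x) = e / 2" for x
      proof -
        have "x \<in> filled_julia F" using that e by (auto simp: dist_norm subset_iff)
        then show ?thesis using filled_julia_iff_bounded_by[of F B x] by (simp add: B_def)
      qed
    qed (use e in \<open>auto intro: holomorphic_iterate continuous_iterate\<close>)
    then show ?thesis using iterate_deriv_multiplier[OF m(1), of k] by (simp add: deriv_iterate norm_power)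
  qed
  obtain k where "3 * (B + 1) / (e / 2) < norm (iterate_deriv F m a0) ^ k"
    using real_arch_pow[OF m(2)] by blast
  then show False using le[of k] by simp
qed

text \<open>
  On a disc that does not meet the postcritical set, all inverse branches of all iterates exist, and
  they are uniformly bounded because points far out escape. This bound makes them equicontinuous,
  which is what replaces normality arguments with omitted values.
\<close>

lemma inverse_branch:
  assumes P: "\<And>k. 1 \<le> k \<Longrightarrow> (cubic F ^^ k) (fst F) \<notin> ball x r" "\<And>k. 1 \<le> k \<Longrightarrow> (cubic F ^^ k) (- fst F) \<notin> ball x r"
    and z: "(cubic F ^^ n) z \<in> ball x r"
    and R: "3 * (norm (fst F) + norm (snd F) + 1) \<le> R" "norm x + r \<le> R"
  obtains g where "g holomorphic_on ball x r" "g ((cubic F ^^ n) z) = z"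
    "\<And>u. u \<in> ball x r \<Longrightarrow> (cubic F ^^ n) (g u) = u" "\<And>u. u \<in> ball x r \<Longrightarrow> norm (g u) \<le> R"
proof -
  let ?C = "(cubic F ^^ n) -` ball x r"
  have cov: "covering_space ?C (cubic F ^^ n) (ball x r)"
    using P by (intro iterate_covering_space) auto
  obtain g where g: "continuous_on (ball x r) g" "g \<in> ball x r \<rightarrow> ?C" "g ((cubic F ^^ n) z) = z"
      "\<And>u. u \<in> ball x r \<Longrightarrow> (cubic F ^^ n) (g u) = u"
    by (rule covering_space_lift_strong[OF cov, of z "(cubic F ^^ n) z" "ball x r" "\<lambda>u. u"])
      (use z in \<open>auto intro: convex_imp_simply_connected convex_imp_locally_path_connected\<close>)
  have "g holomorphic_on ball x r"
  proof (rule holomorphic_onI)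
    fix u assume u: "u \<in> ball x r"
    have "iterate_deriv F n (g u) \<noteq> 0"
    proof
      assume "iterate_deriv F n (g u) = 0"
      then obtain j where j: "j < n" "(cubic F ^^ j) (g u) = fst F \<or> (cubic F ^^ j) (g u) = - fst F"
        using iterate_deriv_eq_0_iff by auto
      have "u = (cubic F ^^ (n - j + j)) (g u)" using g(4)[OF u] j(1) by simp
      also have "\<dots> = (cubic F ^^ (n - j)) ((cubic F ^^ j) (g u))" unfolding funpow_add by simp
      finally show False using P[of "n - j"] u j by auto
    qed
    moreover have "isCont g u" using g(1) u by (simp add: continuous_on_eq_continuous_at)
    ultimately have "(g has_field_derivative inverse (iterate_deriv F n (g u))) (at u)"
      using g(4) u by (intro has_field_derivative_inverse_basic[OF has_field_derivative_iterate _ _ open_ball[of x r]]) auto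
    then show "g field_differentiable at u within ball x r"
      by (meson field_differentiable_at_within field_differentiable_def)
  qed
  moreover have "norm (g u) \<le> R" if u: "u \<in> ball x r" for u
  proof (rule ccontr)
    assume n: "\<not> norm (g u) \<le> R"
    have "2 ^ n * norm (g u) \<le> norm ((cubic F ^^ n) (g u))"
      using n R by (intro escape_iterate[of F "norm (fst F) + norm (snd F)"]) auto
    moreover have "1 * norm (g u) \<le> 2 ^ n * norm (g u)" by (intro mult_right_mono) auto
    moreover have "norm u < norm x + r"
      using u norm_triangle_ineq2[of u x] by (simp add: dist_norm norm_minus_commute)
    ultimately show False using n g(4)[OF u] R by simp
  qed
  ultimately show ?thesis using that g by blast
qed

lemma holomorphic_bounded_lipschitz:
  assumes f: "f holomorphic_on ball x (2 * r)" "\<And>u. u \<in> ball x (2 * r) \<Longrightarrow> norm (f u) \<le> R"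
    and r: "r > 0" and uw: "u \<in> ball x r" "w \<in> ball x r"
  shows "norm (f u - f w) \<le> (2 * R / r) * norm (u - w)"
proof (rule field_differentiable_bound[OF convex_ball[of x r]])
  fix y assume y: "y \<in> ball x r"
  have sub: "cball y (r / 2) \<subseteq> ball x (2 * r)"
  proof
    fix t assume "t \<in> cball y (r / 2)"
    then have "dist x t \<le> dist x y + dist y t" "dist y t \<le> r / 2" by (auto simp: dist_triangle)
    then show "t \<in> ball x (2 * r)" using y r by simp
  qed
  have yb: "y \<in> ball x (2 * r)" using y r by simp
  show "(f has_field_derivative deriv f y) (at y within ball x r)"
    using holomorphic_derivI[OF f(1) open_ball yb] by (rule has_field_derivative_at_within)
  have "norm ((deriv ^^ 1) f y) \<le> fact 1 * R / (r / 2) ^ 1"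
  proof (rule Cauchy_inequality)
    show "f holomorphic_on ball y (r / 2)" using sub ball_subset_cball f(1) holomorphic_on_subset by blast
    show "continuous_on (cball y (r / 2)) f"
      using f(1) sub holomorphic_on_imp_continuous_on continuous_on_subset by blast
    show "norm (f t) \<le> R" if "norm (y - t) = r / 2" for t
      using that sub by (intro f(2)) (auto simp: dist_norm subset_iff)
  qed (use r in auto)
  then show "norm (deriv f y) \<le> 2 * R / r" by (simp add: field_simps)
qed (use uw in auto)

text \<open>
  By Montel's theorem, a subsequence on which convergence fails would have a locally uniform limit;
  that limit agrees with \<open>h\<close> on \<open>U\<close>, hence everywhere.
\<close>

lemma vitali:
  assumes S: "open S" "connected S"
    and f: "\<And>k. f k holomorphic_on S" "\<And>k z. z \<in> S \<Longrightarrow> norm (f k z) \<le> B"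
    and h: "h holomorphic_on S"
    and U: "open U" "U \<noteq> {}" "U \<subseteq> S" "\<And>u. u \<in> U \<Longrightarrow> (\<lambda>k. f k u) \<longlonglongrightarrow> h u"
    and K: "compact K" "K \<subseteq> S"
  shows "uniform_limit K f h sequentially"
proof (rule ccontr)
  assume "\<not> ?thesis"
  then obtain \<epsilon> where e: "\<epsilon> > 0" "\<not> (\<forall>\<^sub>F k in sequentially. \<forall>x\<in>K. dist (f k x) (h x) < \<epsilon>)"
    unfolding uniform_limit_iff by blast
  then have "\<exists>\<^sub>F k in sequentially. \<exists>x\<in>K. \<not> dist (f k x) (h x) < \<epsilon>"
    by (auto simp: not_eventually)
  then have "infinite {k. \<exists>x\<in>K. \<not> dist (f k x) (h x) < \<epsilon>}"
    by (simp add: frequently_cofinite flip: cofinite_eq_sequentially)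
  then obtain s :: "nat \<Rightarrow> nat" where s0: "strict_mono s" "\<forall>k. s k \<in> {k. \<exists>x\<in>K. \<not> dist (f k x) (h x) < \<epsilon>}"
    using infinite_enumerate by blast
  then have s: "strict_mono s" "\<And>k. \<exists>x\<in>K. \<not> dist (f (s k) x) (h x) < \<epsilon>" by auto
  obtain g r where g: "g holomorphic_on S" "strict_mono (r :: nat \<Rightarrow> nat)"
      "\<And>x. x \<in> S \<Longrightarrow> ((\<lambda>n. f (s (r n)) x) \<longlongrightarrow> g x) sequentially"
      "\<And>K. \<lbrakk>compact K; K \<subseteq> S\<rbrakk> \<Longrightarrow> uniform_limit K ((\<lambda>k. f (s k)) \<circ> r) g sequentially"
    by (rule Montel[OF S(1), of "range f" "\<lambda>k. f (s k)"]) (use f in \<open>blast+\<close>)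
  have "g u = h u" if "u \<in> U" for u
  proof (rule LIMSEQ_unique)
    show "(\<lambda>n. f (s (r n)) u) \<longlonglongrightarrow> g u" using g(3) that U by blast
    have "strict_mono (s \<circ> r)" using s g by (simp add: strict_mono_o)
    then show "(\<lambda>n. f (s (r n)) u) \<longlonglongrightarrow> h u"
      using LIMSEQ_subseq_LIMSEQ[OF U(4)[OF that]] by (force simp: o_def)
  qed
  then have gh: "g z = h z" if "z \<in> S" for z
    using analytic_continuation_open[OF U(1) S(1) U(2) S(2) U(3) g(1) h] that by blast
  have "\<forall>\<^sub>F n in sequentially. \<forall>x\<in>K. dist (f (s (r n)) x) (g x) < \<epsilon>"
    using uniform_limitD[OF g(4)[OF K] e(1)] by simp
  then obtain n where "\<forall>x\<in>K. dist (f (s (r n)) x) (g x) < \<epsilon>"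
    using eventually_happens trivial_limit_sequentially by blast
  then show False using s(2)[of "r n"] gh K(2) by (metis subsetD)
qed

section \<open>Density of the marked basin\<close>

text \<open>
  The marked critical point is periodic and the free one lands on a repelling cycle. In particular,
  both critical orbits are finite.
\<close>

locale misiurewicz_map =
  fixes F :: "complex \<times> complex" and p l m :: nat and a0 :: complex
  assumes p: "p \<ge> 1" "(cubic F ^^ p) (fst F) = fst F"
    and a0: "(cubic F ^^ l) (- fst F) = a0" "m \<ge> 1" "(cubic F ^^ m) a0 = a0"
    and repelling: "norm (iterate_deriv F m a0) > 1"
begin

abbreviation "f \<equiv> cubic F"

text \<open>
  \<open>R\<close> is the escape radius that belongs to the size \<open>B\<close> of the parameters.
\<close>

definition B :: real where "B = norm (fst F) + norm (snd F)"
definition R :: real where "R = 3 * (B + 1)"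
definition postcritical :: "complex set" where "postcritical = range (\<lambda>n. (f ^^ n) (fst F)) \<union> range (\<lambda>n. (f ^^ n) (- fst F))"

lemma R_pos: "R > 0"
  unfolding R_def B_def by (simp add: add_nonneg_pos)

lemma K_iff: "z \<in> filled_julia F \<longleftrightarrow> (\<forall>n. norm ((f ^^ n) z) \<le> R)"
  using filled_julia_iff_bounded_by[of F B z] by (simp add: B_def R_def)

lemma finite_postcritical: "finite postcritical"
proof -
  have "(f ^^ (l + m)) (- fst F) = (f ^^ l) (- fst F)"
    using a0 by (simp add: add.commute[of l] funpow_add)
  then show ?thesis using finite_orbit[of p 0 f "fst F"] finite_orbit[of m l f "- fst F"] p a0
    by (simp add: postcritical_def)
qed

lemma ball_avoiding_postcritical:
  assumes "x \<notin> postcritical"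
  obtains r where "r > 0" "ball x (2 * r) \<inter> postcritical = {}"
proof -
  have "open (- postcritical)" using finite_postcritical by (simp add: finite_imp_closed open_Compl)
  then obtain e where "e > 0" "ball x e \<subseteq> - postcritical" using assms open_contains_ball by blast
  then show ?thesis using that[of "e / 2"] by auto
qed

lemma postcritical_inverse_branch:
  assumes "ball x r \<inter> postcritical = {}" "(f ^^ n) z \<in> ball x r" "R \<le> R'" "norm x + r \<le> R'"
  obtains g where "g holomorphic_on ball x r" "g ((f ^^ n) z) = z"
    "\<And>u. u \<in> ball x r \<Longrightarrow> (f ^^ n) (g u) = u" "\<And>u. u \<in> ball x r \<Longrightarrow> norm (g u) \<le> R'"
proof (rule inverse_branch[of F x r n z R'])
  show "(f ^^ k) (fst F) \<notin> ball x r" "(f ^^ k) (- fst F) \<notin> ball x r" for k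
    using assms(1) by (auto simp: postcritical_def)
qed (use assms that in \<open>auto simp: R_def B_def\<close>)

text \<open>
  \<open>returns \<mu> y\<close>: the iterates of orders \<open>\<mu> k\<close> tend to the identity near \<open>y\<close>, as they do for a
  suitable \<open>\<mu>\<close> on a rotation domain. The two lemmas that follow exclude this behaviour for a
  postcritically finite map.
\<close>

definition returns :: "(nat \<Rightarrow> nat) \<Rightarrow> complex \<Rightarrow> bool" where
  "returns \<mu> y \<longleftrightarrow> (\<exists>s>0. uniform_limit (ball y s) (\<lambda>k. f ^^ \<mu> k) (\<lambda>u. u) sequentially)"

text \<open>
  The property spreads to every point \<open>b\<close> of the closure off the postcritical set. From a nearby
  point \<open>y\<close> where it holds, the inverse branches of the iterates that send \<open>f\<^bsup>\<mu> k\<^esup> y\<close> back to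
  \<open>y\<close> exist on a fixed disc around \<open>b\<close>. They are uniformly bounded and tend to the identity near
  \<open>y\<close>, hence on the whole disc by \<open>vitali\<close>. Maps close to the identity are onto a slightly smaller
  disc, so the iterates themselves tend to the identity near \<open>b\<close>.
\<close>

lemma returns_spread:
  assumes b: "b \<notin> postcritical" "b \<in> closure {y. y \<notin> postcritical \<and> returns \<mu> y}"
  shows "returns \<mu> b"
proof -
  obtain r where r: "r > 0" "ball b (2 * r) \<inter> postcritical = {}" using ball_avoiding_postcritical b(1) by blast
  obtain y where y: "returns \<mu> y" "y \<in> ball b r"
    using closure_approachable[THEN iffD1, rule_format, OF b(2) r(1)] by (auto simp: dist_commute)
  then obtain s0 where s0: "s0 > 0" "uniform_limit (ball y s0) (\<lambda>k. f ^^ \<mu> k) (\<lambda>u. u) sequentially"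
    unfolding returns_def by blast
  obtain s1 where s1: "s1 > 0" "ball y s1 \<subseteq> ball b r" using y(2) open_contains_ball open_ball by blast
  define s where "s = min s0 s1 / 2"
  have s: "s > 0" "ball y s \<subseteq> ball y s0" "ball y (2 * s) \<subseteq> ball b r"
    using s0(1) s1 by (auto simp: s_def intro: order_trans[OF subset_ball s1(2)])
  have "\<forall>\<^sub>F k in sequentially. \<forall>u\<in>ball y s. dist ((f ^^ \<mu> k) u) u < s"
    using uniform_limitD[OF s0(2) s(1)] by eventually_elim (use s(2) in blast)
  then obtain N where N: "\<And>k u. k \<ge> N \<Longrightarrow> u \<in> ball y s \<Longrightarrow> dist ((f ^^ \<mu> k) u) u < s"
    unfolding eventually_sequentially by blast
  have stay: "(f ^^ \<mu> k) u \<in> ball y (2 * s)" if "k \<ge> N" "u \<in> ball y s" for k u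
    using N[OF that] that(2) dist_triangle[of y "(f ^^ \<mu> k) u" u] by (simp add: dist_commute)
  have yy: "y \<in> ball y s" using s(1) by simp
  define R' where "R' = max R (norm b + 2 * r)"
  have sub2: "ball b r \<subseteq> ball b (2 * r)" using r(1) by (intro subset_ball) auto
  have "\<exists>g. g holomorphic_on ball b (2 * r) \<and> g ((f ^^ \<mu> k) y) = y \<and>
      (\<forall>u\<in>ball b (2 * r). (f ^^ \<mu> k) (g u) = u) \<and> (\<forall>u\<in>ball b (2 * r). norm (g u) \<le> R')" if "k \<ge> N" for k
  proof -
    have "(f ^^ \<mu> k) y \<in> ball b (2 * r)" using stay[OF that yy] s(3) sub2 by blast
    moreover have "R \<le> R'" "norm b + 2 * r \<le> R'" by (auto simp: R'_def)
    ultimately show ?thesis by (rule postcritical_inverse_branch[OF r(2)]) blast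
  qed
  then have "\<exists>g. \<forall>j. g j holomorphic_on ball b (2 * r) \<and> g j ((f ^^ \<mu> (j + N)) y) = y \<and>
      (\<forall>u\<in>ball b (2 * r). (f ^^ \<mu> (j + N)) (g j u) = u) \<and> (\<forall>u\<in>ball b (2 * r). norm (g j u) \<le> R')"
    by (intro choice allI) simp
  then obtain g where g: "\<And>j. g j holomorphic_on ball b (2 * r)" "\<And>j. g j ((f ^^ \<mu> (j + N)) y) = y"
      "\<And>j u. u \<in> ball b (2 * r) \<Longrightarrow> (f ^^ \<mu> (j + N)) (g j u) = u"
      "\<And>j u. u \<in> ball b (2 * r) \<Longrightarrow> norm (g j u) \<le> R'" by blast
  have left: "g j ((f ^^ \<mu> (j + N)) u) = u" if u: "u \<in> ball y s" for j u
  proof -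
    define h where "h = f ^^ \<mu> (j + N)"
    have cov: "covering_space (h -` ball b (2 * r)) h (ball b (2 * r))"
      unfolding h_def using r(2) by (intro iterate_covering_space) (auto simp: postcritical_def)
    have hy: "h w \<in> ball b (2 * r)" if "w \<in> ball y s" for w
      using subsetD[OF sub2 subsetD[OF s(3) stay[OF _ that, of "j + N"]]] by (simp add: h_def)
    have ch: "continuous_on (ball y s) h" unfolding h_def by (rule continuous_iterate)
    have cg: "continuous_on (ball y s) (\<lambda>w. g j (h w))"
      using hy by (intro continuous_on_compose2[OF holomorphic_on_imp_continuous_on[OF g(1)] ch]) blast
    have "g j (h u) = u"
    proof (rule covering_space_lift_unique[OF cov, of "\<lambda>w. g j (h w)" y "\<lambda>w. w" "ball y s" h u])
      show "g j (h y) = y" using g(2) by (simp add: h_def)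
      show "(\<lambda>w. g j (h w)) \<in> ball y s \<rightarrow> h -` ball b (2 * r)"
        using g(3) hy by (auto simp: h_def)
      show "\<And>x. x \<in> ball y s \<Longrightarrow> h x = h (g j (h x))" using g(3)[OF hy] by (simp add: h_def)
    qed (use hy ch cg u yy in \<open>auto intro: continuous_intros\<close>)
    then show ?thesis by (simp add: h_def)
  qed
  have lim: "(\<lambda>j. g j u) \<longlonglongrightarrow> u" if u: "u \<in> ball y s" for u
  proof -
    have F1: "(\<lambda>k. (f ^^ \<mu> k) u) \<longlonglongrightarrow> u"
      using tendsto_uniform_limitI[OF s0(2)] u s(2) by blast
    have F2: "(\<lambda>j. (f ^^ \<mu> (j + N)) u) \<longlonglongrightarrow> u" using LIMSEQ_ignore_initial_segment[OF F1] .
    have "(\<lambda>j. g j u - u) \<longlonglongrightarrow> 0"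
    proof (rule Lim_null_comparison)
      show "\<forall>\<^sub>F j in sequentially. norm (g j u - u) \<le> (2 * R' / r) * norm (u - (f ^^ \<mu> (j + N)) u)"
      proof (intro always_eventually allI)
        fix j
        have "u \<in> ball y (2 * s)" using u s(1) by simp
        then have ub: "u \<in> ball b r" using s(3) by blast
        have fb: "(f ^^ \<mu> (j + N)) u \<in> ball b r" by (rule subsetD[OF s(3) stay[OF _ u]]) simp
        have "norm (g j u - g j ((f ^^ \<mu> (j + N)) u)) \<le> (2 * R' / r) * norm (u - (f ^^ \<mu> (j + N)) u)"
          by (rule holomorphic_bounded_lipschitz[OF g(1,4) r(1) ub fb])
        then show "norm (g j u - u) \<le> (2 * R' / r) * norm (u - (f ^^ \<mu> (j + N)) u)"
          by (simp only: left[OF u])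
      qed
      have "(\<lambda>j. (2 * R' / r) * norm (u - (f ^^ \<mu> (j + N)) u)) \<longlonglongrightarrow> (2 * R' / r) * norm (u - u)"
        by (intro tendsto_intros F2)
      then show "(\<lambda>j. (2 * R' / r) * norm (u - (f ^^ \<mu> (j + N)) u)) \<longlonglongrightarrow> 0" by simp
    qed
    then show ?thesis using Lim_null by blast
  qed
  have csub: "cball b r \<subseteq> ball b (2 * r)" using r(1) by auto
  have ysub: "ball y s \<subseteq> ball b (2 * r)" using s sub2 subset_ball[of s "2 * s" y] by auto
  have ul: "uniform_limit (cball b r) g (\<lambda>u. u) sequentially"
    by (rule vitali[of "ball b (2 * r)" g R' "\<lambda>u. u" "ball y s"])
      (use g lim ysub csub s(1) in \<open>auto simp: holomorphic_on_ident\<close>)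
  have "uniform_limit (ball b (r / 2)) (\<lambda>k. f ^^ \<mu> k) (\<lambda>u. u) sequentially"
  proof (rule uniform_limitI)
    fix e :: real assume e: "e > 0"
    define e' where "e' = min e (r / 2)"
    have "e' > 0" using e r by (simp add: e'_def)
    from uniform_limitD[OF ul this] obtain J where
      J: "\<And>j u. j \<ge> J \<Longrightarrow> u \<in> cball b r \<Longrightarrow> dist (g j u) u < e'" unfolding eventually_sequentially by blast
    show "\<forall>\<^sub>F k in sequentially. \<forall>u\<in>ball b (r / 2). dist ((f ^^ \<mu> k) u) u < e"
      unfolding eventually_sequentially
    proof (intro exI[of _ "J + N"] allI impI ballI)
      fix k u assume k: "k \<ge> J + N" and u: "u \<in> ball b (r / 2)"
      define j where "j = k - N"
      have j: "j \<ge> J" "k = j + N" using k by (auto simp: j_def)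
      have "\<exists>w\<in>cball b r. g j w = u"
      proof (rule brouwer_surjective_cball[of b r "g j" u "{u}"])
        show "continuous_on (cball b r) (g j)"
          using csub by (intro continuous_on_subset[OF holomorphic_on_imp_continuous_on[OF g(1)]])
        fix x y assume "x \<in> {u}" "y \<in> cball b r"
        then have "dist (g j y) y < r / 2" using J[OF j(1)] by (force simp: e'_def)
        moreover have "norm ((u - b) + (y - g j y)) \<le> norm (u - b) + norm (y - g j y)" by (rule norm_triangle_ineq)
        ultimately show "x + (y - g j y) \<in> cball b r"
          using u \<open>x \<in> {u}\<close> by (simp add: dist_norm norm_minus_commute algebra_simps)
      qed (use r in auto)
      then obtain w where w: "w \<in> cball b r" "g j w = u" by blast
      have "(f ^^ \<mu> k) u = w" using g(3)[of w j] w csub j(2) by blast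
      moreover have "dist u w < e" using J[OF j(1) w(1)] w(2) by (simp add: e'_def)
      ultimately show "dist ((f ^^ \<mu> k) u) u < e" by (simp add: dist_commute)
    qed
  qed
  then show ?thesis unfolding returns_def using r(1) by (intro exI[of _ "r / 2"]) auto
qed

text \<open>
  The complement of the finite postcritical set is connected, so if \<open>returns \<mu>\<close> held at one of its
  points it would hold at all of them, including points far out, which escape.
\<close>

lemma no_returns:
  assumes \<mu>: "\<And>k. \<mu> k \<ge> 1" and x: "x \<notin> postcritical" "returns \<mu> x"
  shows False
proof -
  define W where "W = {y. y \<notin> postcritical \<and> returns \<mu> y}"
  have "open W"
    unfolding open_contains_ball
  proof
    fix y assume y: "y \<in> W"
    then obtain s where s: "s > 0" "uniform_limit (ball y s) (\<lambda>k. f ^^ \<mu> k) (\<lambda>u. u) sequentially"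
      by (auto simp: W_def returns_def)
    obtain r where r: "r > 0" "ball y (2 * r) \<inter> postcritical = {}" using ball_avoiding_postcritical y by (auto simp: W_def)
    have "ball y (min s (2 * r)) \<subseteq> W"
    proof
      fix w assume w: "w \<in> ball y (min s (2 * r))"
      then have "w \<in> ball y s" by simp
      then obtain t where t: "t > 0" "ball w t \<subseteq> ball y s" by (rule openE[OF open_ball])
      then have "returns \<mu> w" unfolding returns_def using s uniform_limit_on_subset by blast
      then show "w \<in> W" using w r by (auto simp: W_def)
    qed
    then show "\<exists>e>0. ball y e \<subseteq> W" using s r by (intro exI[of _ "min s (2 * r)"]) auto
  qed
  moreover have "closedin (top_of_set (- postcritical)) W"
  proof -
    have "W = - postcritical \<inter> closure W"
      using returns_spread[of _ \<mu>] closure_subset[of W] by (auto simp: W_def)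
    then show ?thesis using closed_closure closedin_closed by metis
  qed
  moreover have "openin (top_of_set (- postcritical)) W"
  proof -
    have "W \<subseteq> - postcritical" by (auto simp: W_def)
    then show ?thesis using \<open>open W\<close> by (simp add: open_subset)
  qed
  moreover have "connected (- postcritical)"
    using finite_postcritical by (intro path_connected_imp_connected path_connected_complement_countable)
      (auto simp: countable_finite)
  ultimately have "W = {} \<or> W = - postcritical" by (simp add: connected_clopen)
  then have W: "W = - postcritical" using x by (auto simp: W_def)
  have "bounded (postcritical \<union> cball 0 R)" using finite_postcritical by (simp add: finite_imp_bounded)
  then obtain M where M: "\<And>y. y \<in> postcritical \<union> cball 0 R \<Longrightarrow> norm y \<le> M" unfolding bounded_iff by blast
  define y where "y = complex_of_real (\<bar>M\<bar> + 1)"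
  have ny: "norm y = \<bar>M\<bar> + 1" by (simp add: y_def)
  then have y: "y \<notin> postcritical" "norm y > R" using M[of y] by fastforce+
  then have "returns \<mu> y" using W by (auto simp: W_def)
  then obtain s where "s > 0" "uniform_limit (ball y s) (\<lambda>k. f ^^ \<mu> k) (\<lambda>u. u) sequentially"
    unfolding returns_def by blast
  then have lim: "(\<lambda>k. (f ^^ \<mu> k) y) \<longlonglongrightarrow> y" using tendsto_uniform_limitI by fastforce
  have "2 * norm y \<le> norm ((f ^^ \<mu> k) y)" for k
  proof -
    have "(2::real) ^ 1 \<le> 2 ^ \<mu> k" using \<mu>[of k] by (intro power_increasing) auto
    then have "2 * norm y \<le> 2 ^ \<mu> k * norm y" by (intro mult_right_mono) auto
    also have "\<dots> \<le> norm ((f ^^ \<mu> k) y)"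
      using y by (intro escape_iterate[of F B]) (auto simp: B_def R_def)
    finally show ?thesis .
  qed
  then have "2 * norm y \<le> norm y" using tendsto_norm[OF lim] by (intro LIMSEQ_le_const) auto
  then show False using ny by simp
qed

end

context misiurewicz_map
begin

text \<open>
  If an orbit inside the interior of the filled Julia set accumulates at a point \<open>x\<close> off the
  postcritical set, then iterates return to the identity near \<open>x\<close>. Along the times \<open>n k\<close> of approach
  the iterates converge near \<open>z\<close>, by Montel's theorem; the inverse branches near \<open>x\<close> that lead back to
  \<open>z\<close> have values near \<open>z\<close>, by equicontinuity. Going back by time \<open>n k\<close> and forward by time
  \<open>n (k + 1)\<close> is thus close to the identity near \<open>x\<close>.
\<close>

lemma no_recurrence:
  assumes D: "e > 0" "ball z e \<subseteq> filled_julia F"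
    and s: "strict_mono (s :: nat \<Rightarrow> nat)" "(\<lambda>k. (f ^^ s k) z) \<longlonglongrightarrow> x" and x: "x \<notin> postcritical"
  shows False
proof -
  obtain r where r: "r > 0" "ball x (2 * r) \<inter> postcritical = {}" using ball_avoiding_postcritical x by blast
  have bounded: "norm ((f ^^ k) w) \<le> R" if "w \<in> ball z e" for k w
    using D(2) that K_iff by blast
  obtain h r1 where h: "h holomorphic_on ball z e" "strict_mono (r1 :: nat \<Rightarrow> nat)"
      "\<And>x. x \<in> ball z e \<Longrightarrow> ((\<lambda>n. (f ^^ s (r1 n)) x) \<longlongrightarrow> h x) sequentially"
      "\<And>K. \<lbrakk>compact K; K \<subseteq> ball z e\<rbrakk> \<Longrightarrow> uniform_limit K ((\<lambda>k. f ^^ s k) \<circ> r1) h sequentially"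
  proof (rule Montel[of "ball z e" "range (\<lambda>k. f ^^ s k)" "\<lambda>k. f ^^ s k"])
    fix K assume "compact K" "K \<subseteq> ball z e"
    then show "\<exists>B. \<forall>h\<in>range (\<lambda>k. f ^^ s k). \<forall>z\<in>K. cmod (h z) \<le> B" using bounded by blast
  qed (auto intro: holomorphic_iterate)
  define n where "n k = s (r1 k)" for k
  have n_mono: "strict_mono n" using s(1) h(2) by (simp add: n_def strict_mono_def)
  have n_lim: "(\<lambda>k. (f ^^ n k) z) \<longlonglongrightarrow> x"
    using LIMSEQ_subseq_LIMSEQ[OF s(2) h(2)] by (simp add: n_def o_def)
  define R' where "R' = max R (norm x + 2 * r)"
  have R': "R' > 0" using R_pos by (simp add: R'_def)
  \<comment> \<open>With this radius the Lipschitz constant \<open>2 R' / r\<close> of the inverse branches keeps their values on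
    \<open>ball x t\<close> within distance \<open>e / 2\<close> of \<open>z\<close>.\<close>
  define t where "t = min r (e * r / (8 * R'))"
  have t: "t > 0" "t \<le> r" using r D R' by (auto simp: t_def)
  have t2: "(2 * R' / r) * (2 * t) \<le> e / 2"
  proof -
    have "t \<le> e * r / (8 * R')" by (simp add: t_def)
    then have "(2 * R' / r) * (2 * t) \<le> (2 * R' / r) * (2 * (e * r / (8 * R')))"
      using R' r by (intro mult_left_mono) auto
    also have "\<dots> = e / 2" using R' r by (simp add: field_simps)
    finally show ?thesis .
  qed
  have "\<forall>\<^sub>F k in sequentially. (f ^^ n k) z \<in> ball x t"
    using n_lim t by (auto dest!: tendstoD simp: dist_commute)
  then obtain N where N: "\<And>k. k \<ge> N \<Longrightarrow> (f ^^ n k) z \<in> ball x t" unfolding eventually_sequentially by blast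
  have tsub: "ball x t \<subseteq> ball x r" "ball x t \<subseteq> ball x (2 * r)" using t r by auto
  have near: "\<exists>w\<in>cball z (e / 2). (f ^^ n k) w = u" if k: "k \<ge> N" and u: "u \<in> ball x t" for k u
  proof -
    obtain g where g: "g holomorphic_on ball x (2 * r)" "g ((f ^^ n k) z) = z"
      "\<And>u. u \<in> ball x (2 * r) \<Longrightarrow> (f ^^ n k) (g u) = u" "\<And>u. u \<in> ball x (2 * r) \<Longrightarrow> norm (g u) \<le> R'"
    proof (rule postcritical_inverse_branch[OF r(2)])
      show "(f ^^ n k) z \<in> ball x (2 * r)" using N[OF k] tsub by blast
      show "R \<le> R'" "cmod x + 2 * r \<le> R'" by (auto simp: R'_def)
    qed blast
    have "norm (g u - g ((f ^^ n k) z)) \<le> (2 * R' / r) * norm (u - (f ^^ n k) z)"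
      using holomorphic_bounded_lipschitz[OF g(1,4) r(1)] u N[OF k] tsub by blast
    also have "\<dots> \<le> (2 * R' / r) * (2 * t)"
    proof (rule mult_left_mono)
      show "norm (u - (f ^^ n k) z) \<le> 2 * t"
        using u N[OF k] dist_triangle[of u "(f ^^ n k) z" x] by (simp add: dist_norm norm_minus_commute)
      show "0 \<le> 2 * R' / r" using R' r by simp
    qed
    finally have "norm (g u - z) \<le> e / 2" using t2 g(2) by simp
    then have "g u \<in> cball z (e / 2)" by (simp add: dist_norm norm_minus_commute)
    moreover have "(f ^^ n k) (g u) = u" using g(3) u tsub by blast
    ultimately show ?thesis by blast
  qed
  define \<mu> where "\<mu> k = n (Suc k) - n k" for k
  have n_less: "n k < n (Suc k)" for k using n_mono by (simp add: strict_mono_def)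
  have \<mu>1: "\<mu> k \<ge> 1" for k using n_less[of k] by (simp add: \<mu>_def)
  have "cball z (e / 2) \<subseteq> ball z e" using D by auto
  then have ul: "uniform_limit (cball z (e / 2)) (\<lambda>k. f ^^ n k) h sequentially"
    using h(4)[of "cball z (e / 2)"] by (simp add: n_def o_def)
  have "uniform_limit (ball x t) (\<lambda>k. f ^^ \<mu> k) (\<lambda>u. u) sequentially"
  proof (rule uniform_limitI)
    fix \<epsilon> :: real assume "\<epsilon> > 0"
    then have "\<epsilon> / 2 > 0" by simp
    from uniform_limitD[OF ul this] obtain J where
      J: "\<And>k w. k \<ge> J \<Longrightarrow> w \<in> cball z (e / 2) \<Longrightarrow> dist ((f ^^ n k) w) (h w) < \<epsilon> / 2"
      unfolding eventually_sequentially by blast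
    show "\<forall>\<^sub>F k in sequentially. \<forall>u\<in>ball x t. dist ((f ^^ \<mu> k) u) u < \<epsilon>"
      unfolding eventually_sequentially
    proof (intro exI[of _ "max N J"] allI impI ballI)
      fix k u assume k: "k \<ge> max N J" and u: "u \<in> ball x t"
      then obtain w where w: "w \<in> cball z (e / 2)" "(f ^^ n k) w = u" using near[of k u] by auto
      have "(f ^^ \<mu> k) u = (f ^^ (\<mu> k + n k)) w" by (simp add: w(2)[symmetric] funpow_add)
      also have "\<mu> k + n k = n (Suc k)" using n_less[of k] by (simp add: \<mu>_def)
      finally have "dist ((f ^^ \<mu> k) u) u = dist ((f ^^ n (Suc k)) w) ((f ^^ n k) w)" using w(2) by simp
      also have "\<dots> \<le> dist ((f ^^ n (Suc k)) w) (h w) + dist ((f ^^ n k) w) (h w)"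
        by (rule dist_triangle2)
      also have "\<dots> < \<epsilon>" using J[of "Suc k" w] J[of k w] k w(1) by auto
      finally show "dist ((f ^^ \<mu> k) u) u < \<epsilon>" .
    qed
  qed
  then have "returns \<mu> x" unfolding returns_def using t by blast
  then show False using no_returns \<mu>1 x by blast
qed

text \<open>
  An orbit that comes close to the repelling point \<open>a0\<close> without reaching it is pushed away again, and
  each time it passes through the annulus \<open>A\<close>. It therefore accumulates in \<open>A\<close>, which is chosen
  disjoint from the postcritical set.
\<close>

lemma repelled_orbit_accumulates_off_postcritical:
  assumes z: "\<And>n. (f ^^ n) z \<noteq> a0"
    and s: "strict_mono (s :: nat \<Rightarrow> nat)" "(\<lambda>k. (f ^^ s k) z) \<longlonglongrightarrow> a0"
  shows "\<exists>s' x. strict_mono (s' :: nat \<Rightarrow> nat) \<and> (\<lambda>k. (f ^^ s' k) z) \<longlonglongrightarrow> x \<and> x \<notin> postcritical"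
proof -
  define lam where "lam = iterate_deriv F m a0"
  define \<kappa> where "\<kappa> = (1 + norm lam) / 2"
  have \<kappa>: "\<kappa> > 1" "\<kappa> < norm lam" using repelling by (auto simp: \<kappa>_def lam_def)
  have der: "((f ^^ m) has_field_derivative lam) (at a0)"
    unfolding lam_def by (rule has_field_derivative_iterate)
  then have "((\<lambda>w. ((f ^^ m) w - (f ^^ m) a0) / (w - a0)) \<longlongrightarrow> lam) (at a0)"
    by (simp add: has_field_derivative_iff)
  from order_tendstoD(1)[OF tendsto_norm[OF this] \<kappa>(2)]
  obtain s1 where s1: "s1 > 0"
    "\<And>w. w \<noteq> a0 \<Longrightarrow> dist w a0 < s1 \<Longrightarrow> \<kappa> < norm (((f ^^ m) w - (f ^^ m) a0) / (w - a0))"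
    unfolding eventually_at by auto
  have expand: "\<kappa> * dist w a0 \<le> dist ((f ^^ m) w) a0" if "dist w a0 < s1" for w
  proof (cases "w = a0")
    case False
    then show ?thesis using s1(2)[OF False that] a0 by (simp add: norm_divide dist_norm field_simps)
  qed (use a0 in simp)
  obtain s2 where s2: "s2 > 0" "ball a0 s2 \<inter> (postcritical - {a0}) = {}"
  proof -
    have "closed (postcritical - {a0})" using finite_postcritical by (intro finite_imp_closed) auto
    then have "open (- (postcritical - {a0}))" by (rule open_Compl)
    then obtain e where "e > 0" "ball a0 e \<subseteq> - (postcritical - {a0})" by (rule openE) auto
    then show ?thesis using that by blast
  qed
  define t where "t = min s1 s2 / 2"
  have t: "t > 0" "t < s1" "t < s2" using s1 s2 by (auto simp: t_def)
  have "isCont (f ^^ m) a0" using der by (rule DERIV_isCont)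
  then obtain t1 where t1: "t1 > 0" "\<And>w. dist w a0 < t1 \<Longrightarrow> dist ((f ^^ m) w) a0 < t"
    using t(1) a0 unfolding continuous_at_eps_delta by metis
  define u where "u = min t1 t"
  have u: "u > 0" "u \<le> t" "u \<le> t1" using t t1 by (auto simp: u_def)
  define A where "A = cball a0 t - ball a0 u"
  have "compact A" unfolding A_def by (intro compact_diff) auto
  have AP: "x \<notin> postcritical" if "x \<in> A" for x
  proof -
    have "x \<noteq> a0" "x \<in> ball a0 s2" using that t u by (auto simp: A_def)
    then show ?thesis using s2 by blast
  qed
  define I where "I = {n. (f ^^ n) z \<in> A}"
  have "\<exists>n'\<ge>N. n' \<in> I" for N
  proof -
    have "\<forall>\<^sub>F k in sequentially. dist ((f ^^ s k) z) a0 < u" using s(2) u(1) by (rule tendstoD)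
    moreover have "\<forall>\<^sub>F k in sequentially. k \<ge> N" by (rule eventually_ge_at_top)
    ultimately have "\<forall>\<^sub>F k in sequentially. dist ((f ^^ s k) z) a0 < u \<and> k \<ge> N" by eventually_elim auto
    then obtain k where k: "dist ((f ^^ s k) z) a0 < u" "k \<ge> N"
      using eventually_happens trivial_limit_sequentially by blast
    define n where "n = s k"
    have n: "dist ((f ^^ n) z) a0 < u" "n \<ge> N" using k seq_suble[OF s(1), of k] by (auto simp: n_def)
    define w where "w j = (f ^^ (j * m + n)) z" for j
    have w_Suc: "w (Suc j) = (f ^^ m) (w j)" for j
      unfolding w_def using funpow_add[of m "j * m + n" f] by (simp add: add.assoc)
    have "\<exists>j. dist (w j) a0 \<ge> u"
    proof (rule ccontr)
      assume "\<not> ?thesis"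
      then have small: "dist (w j) a0 < u" for j by (meson not_le)
      have grow: "\<kappa> ^ j * dist (w 0) a0 \<le> dist (w j) a0" for j
      proof (induction j)
        case (Suc j)
        have "\<kappa> * (\<kappa> ^ j * dist (w 0) a0) \<le> \<kappa> * dist (w j) a0" using Suc \<kappa> by (intro mult_left_mono) auto
        also have "\<dots> \<le> dist (w (Suc j)) a0" unfolding w_Suc using small[of j] u t by (intro expand) linarith
        finally show ?case by (simp add: mult.assoc)
      qed simp
      have pos: "dist (w 0) a0 > 0" using z by (simp add: w_def)
      obtain j where "u / dist (w 0) a0 < \<kappa> ^ j" using real_arch_pow[OF \<kappa>(1)] by blast
      then have "u < \<kappa> ^ j * dist (w 0) a0" using pos by (simp add: field_simps)
      then show False using grow[of j] small[of j] by linarith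
    qed
    then obtain j where j: "dist (w j) a0 \<ge> u" "\<And>i. i < j \<Longrightarrow> dist (w i) a0 < u"
      using exists_least_iff[of "\<lambda>j. dist (w j) a0 \<ge> u"] by (auto simp: not_le)
    have "j \<noteq> 0" using j(1) n(1) by (cases "j = 0") (auto simp: w_def)
    then obtain i where i: "j = Suc i" by (cases j) auto
    have "dist (w i) a0 < t1" using j(2)[of i] i u by auto
    then have "dist (w j) a0 < t" unfolding i w_Suc by (rule t1(2))
    then have "w j \<in> A" using j(1) by (simp add: A_def dist_commute)
    then have "j * m + n \<in> I" by (simp add: I_def w_def)
    then show ?thesis using n(2) by (intro exI[of _ "j * m + n"]) auto
  qed
  then have "infinite I" by (auto simp: infinite_nat_iff_unbounded_le)
  then obtain r where r: "strict_mono (r :: nat \<Rightarrow> nat)" "\<forall>k. r k \<in> I" using infinite_enumerate by blast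
  then have "\<forall>k. (f ^^ r k) z \<in> A" by (simp add: I_def)
  then obtain x r' where x: "x \<in> A" "strict_mono (r' :: nat \<Rightarrow> nat)" "((\<lambda>k. (f ^^ r k) z) \<circ> r') \<longlonglongrightarrow> x"
    using \<open>compact A\<close> unfolding compact_def by metis
  show ?thesis
  proof (intro exI conjI)
    show "strict_mono (r \<circ> r')" using r x by (simp add: strict_mono_o)
    show "(\<lambda>k. (f ^^ (r \<circ> r') k) z) \<longlonglongrightarrow> x" using x(3) by (simp add: o_def)
    show "x \<notin> postcritical" using AP x(1) .
  qed
qed

text \<open>
  A disc in the filled Julia set has orbits that reach every neighbourhood of \<open>a\<close>. By \<open>no_recurrence\<close>
  the orbit of its centre accumulates only in the postcritical set, and the set of accumulation points
  is forward invariant, so it contains \<open>a\<close> or \<open>a0\<close>. The second is impossible: either the orbit hits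
  \<open>a0\<close>, which would be an interior point, or it accumulates off the postcritical set.
\<close>

lemma bounded_fatou_is_basin:
  assumes D: "e > 0" "ball z e \<subseteq> filled_julia F"
    and \<delta>: "\<delta> > 0" "\<And>w j. w \<in> ball z e \<Longrightarrow> (f ^^ j) w \<notin> ball (fst F) \<delta>"
  shows False
proof -
  define acc where "acc = {x. \<exists>s. strict_mono (s :: nat \<Rightarrow> nat) \<and> (\<lambda>k. (f ^^ s k) z) \<longlonglongrightarrow> x}"
  have accP: "acc \<subseteq> postcritical" using no_recurrence[OF D] by (auto simp: acc_def)
  have step: "(f ^^ n) x \<in> acc" if xa: "x \<in> acc" for x n
  proof -
    obtain s where s: "strict_mono (s :: nat \<Rightarrow> nat)" "(\<lambda>k. (f ^^ s k) z) \<longlonglongrightarrow> x"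
      using xa by (auto simp: acc_def)
    have "isCont (f ^^ n) x" using continuous_iterate[of UNIV] by (simp add: continuous_on_eq_continuous_at)
    from isCont_tendsto_compose[OF this s(2)]
    have "(\<lambda>k. (f ^^ (n + s k)) z) \<longlonglongrightarrow> (f ^^ n) x" by (simp add: funpow_add)
    moreover have "strict_mono (\<lambda>k. n + s k)" using s(1) by (simp add: strict_mono_def)
    ultimately show ?thesis unfolding acc_def by blast
  qed
  have "z \<in> filled_julia F" using D by auto
  then have bd: "\<forall>n. (f ^^ n) z \<in> cball 0 R" using K_iff by auto
  obtain x0 r0 where x0: "strict_mono (r0 :: nat \<Rightarrow> nat)" "((\<lambda>n. (f ^^ n) z) \<circ> r0) \<longlonglongrightarrow> x0"
    using compact_cball[of "0::complex" R] bd unfolding compact_def by metis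
  then have x0_acc: "x0 \<in> acc" unfolding acc_def by (auto simp: o_def)
  then consider i where "x0 = (f ^^ i) (fst F)" | i where "x0 = (f ^^ i) (- fst F)"
    using accP by (auto simp: postcritical_def)
  then show False
  proof cases
    case 1
    have "(f ^^ (i * p - i)) x0 = (f ^^ (i * p)) (fst F)"
      unfolding 1 using p(1) by (simp flip: funpow_add o_apply[of "f ^^ (i * p - i)"])
    also have "\<dots> = fst F" using p(2) by (induction i) (auto simp: funpow_add)
    finally have "fst F \<in> acc" using step[OF x0_acc] by metis
    then obtain s where s: "(\<lambda>k. (f ^^ s k) z) \<longlonglongrightarrow> fst F" by (auto simp: acc_def)
    from tendstoD[OF this \<delta>(1)] obtain k where "dist ((f ^^ s k) z) (fst F) < \<delta>"
      using eventually_happens trivial_limit_sequentially by blast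
    then show False using \<delta>(2)[of z "s k"] D by (simp add: dist_commute)
  next
    case 2
    have le: "i \<le> m * i" using a0(2) by simp
    have "(f ^^ (l + (m * i - i))) x0 = (f ^^ (l + (m * i - i) + i)) (- fst F)"
      unfolding 2 by (simp only: funpow_add o_apply)
    also have "l + (m * i - i) + i = m * i + l" using le by linarith
    also have "(f ^^ (m * i + l)) (- fst F) = (f ^^ (i * m)) a0" using a0(1) by (simp add: funpow_add mult.commute)
    also have "\<dots> = a0" using a0(3) by (induction i) (auto simp: funpow_add)
    finally have a0_acc: "a0 \<in> acc" using step[OF x0_acc] by metis
    then obtain s where s: "strict_mono (s :: nat \<Rightarrow> nat)" "(\<lambda>k. (f ^^ s k) z) \<longlonglongrightarrow> a0"
      by (auto simp: acc_def)
    have "(f ^^ n) z \<noteq> a0" for n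
    proof
      assume n: "(f ^^ n) z = a0"
      have "open ((f ^^ n) ` ball z e)"
        using D iterate_not_constant[of "ball z e" z n F]
        by (intro open_mapping_thm[of _ "ball z e"] holomorphic_iterate) auto
      moreover have "a0 \<in> (f ^^ n) ` ball z e" using n D by (metis centre_in_ball imageI)
      ultimately obtain d where d: "d > 0" "ball a0 d \<subseteq> (f ^^ n) ` ball z e" by (rule openE)
      moreover have "(f ^^ n) ` ball z e \<subseteq> filled_julia F" using D(2) filled_julia_iterate by blast
      ultimately show False using repelling_not_in_interior[OF a0(3) repelling d(1)] by blast
    qed
    from repelled_orbit_accumulates_off_postcritical[OF this s] show False using no_recurrence[OF D] by blast
  qed
qed

text \<open>
  The basin of the marked cycle is dense in the filled Julia set. A disc around a point \<open>z\<close> that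
  avoids the basin cannot lie in the filled Julia set, so it contains an escaping point \<open>w\<close>. The
  iterates omit a disc around \<open>a\<close>, so the functions \<open>1 / (f\<^sup>j - a)\<close> are bounded and have no zeros;
  a limit of them vanishes at \<open>w\<close> but not at \<open>z\<close>, which contradicts Hurwitz's theorem.
\<close>

theorem basin_dense:
  assumes z: "z \<in> filled_julia F" and e: "e > 0" and \<delta>: "\<delta> > 0"
  shows "\<exists>w\<in>ball z e. \<exists>j. (f ^^ j) w \<in> ball (fst F) \<delta>"
proof (rule ccontr)
  assume "\<not> ?thesis"
  then have avoid: "(f ^^ j) w \<notin> ball (fst F) \<delta>" if "w \<in> ball z e" for w j using that by blast
  have "\<not> ball z e \<subseteq> filled_julia F" using bounded_fatou_is_basin[OF e _ \<delta>] avoid by blast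
  then obtain w where w: "w \<in> ball z e" "w \<notin> filled_julia F" by blast
  define u where "u j y = inverse ((f ^^ j) y - fst F)" for j y
  have nz: "(f ^^ j) y - fst F \<noteq> 0" if "y \<in> ball z e" for y j using avoid[OF that, of j] \<delta> by auto
  have u_hol: "u j holomorphic_on ball z e" for j
    unfolding u_def using nz by (intro holomorphic_intros holomorphic_iterate) auto
  have u_bd: "norm (u j y) \<le> inverse \<delta>" if "y \<in> ball z e" for j y
  proof -
    have "\<delta> \<le> norm ((f ^^ j) y - fst F)" using avoid[OF that, of j] by (simp add: dist_norm norm_minus_commute)
    then show ?thesis unfolding u_def norm_inverse using \<delta> by (intro le_imp_inverse_le) auto
  qed
  obtain g r where g: "g holomorphic_on ball z e" "strict_mono (r :: nat \<Rightarrow> nat)"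
      "\<And>x. x \<in> ball z e \<Longrightarrow> ((\<lambda>n. u (r n) x) \<longlongrightarrow> g x) sequentially"
      "\<And>K. \<lbrakk>compact K; K \<subseteq> ball z e\<rbrakk> \<Longrightarrow> uniform_limit K (u \<circ> r) g sequentially"
  proof (rule Montel[of "ball z e" "range u" u])
    fix K assume "compact K" "K \<subseteq> ball z e"
    then show "\<exists>B. \<forall>h\<in>range u. \<forall>z\<in>K. cmod (h z) \<le> B" using u_bd by blast
  qed (use u_hol in auto)
  have "filterlim (\<lambda>n. (f ^^ n) w - fst F) at_infinity sequentially"
    using tendsto_add_filterlim_at_infinity'[OF escape_at_infinity[OF w(2)] tendsto_const[of "- fst F"]] by simp
  then have "(\<lambda>n. u n w) \<longlonglongrightarrow> 0"
    unfolding u_def using filterlim_compose[OF tendsto_inverse_0] by blast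
  then have "(\<lambda>n. u (r n) w) \<longlonglongrightarrow> 0" using LIMSEQ_subseq_LIMSEQ[OF _ g(2)] by (force simp: o_def)
  then have gw: "g w = 0" using g(3)[OF w(1)] LIMSEQ_unique by blast
  have zb: "z \<in> ball z e" using e by simp
  have "inverse (R + norm (fst F)) \<le> norm (u j z)" for j
  proof -
    have "norm ((f ^^ j) z - fst F) \<le> R + norm (fst F)"
      using z K_iff norm_triangle_ineq4[of "(f ^^ j) z" "fst F"] by (meson add_right_mono order_trans)
    then show ?thesis unfolding u_def norm_inverse using nz[OF zb, of j] by (intro le_imp_inverse_le) auto
  qed
  then have "inverse (R + norm (fst F)) \<le> norm (g z)"
    using tendsto_norm[OF g(3)[OF zb]] by (intro LIMSEQ_le_const) auto
  moreover have "inverse (R + norm (fst F)) > 0" using R_pos by (simp add: add_pos_nonneg)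
  ultimately have gz: "g z \<noteq> 0" by auto
  have "g w \<noteq> 0"
  proof (rule Hurwitz_no_zeros[of "ball z e" "u \<circ> r" g w])
    show "\<not> g constant_on ball z e" using gw gz w zb unfolding constant_on_def by metis
    show "(u \<circ> r) n y \<noteq> 0" if "y \<in> ball z e" for n y using nz[OF that] by (simp add: u_def)
  qed (use g u_hol w in auto)
  then show False using gw by simp
qed

end

section \<open>Poincare functions and perturbed orbits\<close>

text \<open>
  A sequence that obeys a linear recursion up to quadratic errors follows the linear one with an error
  quadratic in its size \<open>D norm lam ^ j\<close>, as long as this size is small. The constant is the solution
  of \<open>\<mu> c + 5 C = \<mu>\<^sup>2 c\<close> with \<open>\<mu> = norm lam\<close>; the factor 5 comes from \<open>norm (E j) \<le> 2 d\<close> and \<open>\<tau> \<le> d\<close>.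
\<close>

lemma near_linear_orbit:
  fixes lam :: complex and E :: "nat \<Rightarrow> complex"
  assumes \<mu>: "norm lam > 1" and C: "C \<ge> 0"
    and D: "norm (E 0) \<le> D" "0 \<le> \<tau>" "\<tau> \<le> D"
    and small: "5 * C / ((norm lam)\<^sup>2 - norm lam) * (D * norm lam ^ n) \<le> 1" "2 * (D * norm lam ^ n) \<le> \<delta>"
    and step: "\<And>j. j < n \<Longrightarrow> norm (E j) \<le> \<delta> \<Longrightarrow> norm (E (Suc j) - lam * E j) \<le> C * ((norm (E j))\<^sup>2 + \<tau>\<^sup>2)"
    and j: "j \<le> n"
  shows "norm (E j - lam ^ j * E 0) \<le> 5 * C / ((norm lam)\<^sup>2 - norm lam) * (D * norm lam ^ j)\<^sup>2"
  using j
proof (induction j)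
  case 0
  have "norm lam * 1 < norm lam * norm lam" using \<mu> by (intro mult_strict_left_mono) auto
  then have "(norm lam)\<^sup>2 - norm lam > 0" by (simp add: power2_eq_square)
  then show ?case using C by simp
next
  case (Suc j)
  define \<mu> where "\<mu> = norm lam"
  define C' where "C' = 5 * C / (\<mu>\<^sup>2 - \<mu>)"
  have \<mu>1: "\<mu> > 1" using assms(1) by (simp add: \<mu>_def)
  have den: "\<mu>\<^sup>2 - \<mu> > 0" using \<mu>1 by (simp add: power2_eq_square)
  have C'0: "C' \<ge> 0" using C den by (simp add: C'_def)
  define d where "d = D * \<mu> ^ j"
  have D0: "D \<ge> 0" using D by linarith
  have d0: "d \<ge> 0" using D0 \<mu>1 by (simp add: d_def)
  have IH: "norm (E j - lam ^ j * E 0) \<le> C' * d\<^sup>2" using Suc by (simp add: C'_def d_def \<mu>_def)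
  have dn: "d \<le> D * \<mu> ^ n" unfolding d_def using D0 \<mu>1 Suc.prems by (intro mult_left_mono power_increasing) auto
  have "C' * d \<le> C' * (D * \<mu> ^ n)" using dn C'0 by (intro mult_left_mono)
  also have "\<dots> \<le> 1" using small(1) by (simp add: C'_def \<mu>_def)
  finally have "C' * d * d \<le> 1 * d" using d0 by (intro mult_right_mono)
  then have Cd: "C' * d\<^sup>2 \<le> d" by (simp add: power2_eq_square mult.assoc)
  have "norm (lam ^ j * E 0) \<le> d"
  proof -
    have "norm (E 0) * \<mu> ^ j \<le> d" unfolding d_def using D(1) \<mu>1 by (intro mult_right_mono) auto
    then show ?thesis by (simp add: norm_mult norm_power \<mu>_def mult.commute)
  qed
  then have Ej: "norm (E j) \<le> 2 * d"
    using IH Cd norm_triangle_sub[of "E j" "lam ^ j * E 0"] by linarith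
  then have "norm (E j) \<le> \<delta>" using dn small(2) by (simp add: \<mu>_def)
  then have "norm (E (Suc j) - lam * E j) \<le> C * ((norm (E j))\<^sup>2 + \<tau>\<^sup>2)" using step Suc.prems by simp
  also have "\<dots> \<le> C * (5 * d\<^sup>2)"
  proof (rule mult_left_mono[OF _ C])
    have "D * 1 \<le> d" unfolding d_def using D0 \<mu>1 by (intro mult_left_mono) auto
    then have "\<tau> \<le> d" using D(3) by linarith
    then have "\<tau>\<^sup>2 \<le> d\<^sup>2" using D by (intro power_mono) auto
    moreover have "(norm (E j))\<^sup>2 \<le> (2 * d)\<^sup>2" using Ej by (intro power_mono) auto
    ultimately show "(norm (E j))\<^sup>2 + \<tau>\<^sup>2 \<le> 5 * d\<^sup>2" by (simp add: power_mult_distrib)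
  qed
  finally have 1: "norm (E (Suc j) - lam * E j) \<le> 5 * C * d\<^sup>2" by simp
  have eq: "E (Suc j) - lam ^ Suc j * E 0 = (E (Suc j) - lam * E j) + lam * (E j - lam ^ j * E 0)"
    by (simp add: algebra_simps)
  have "norm (E (Suc j) - lam ^ Suc j * E 0) \<le> norm (E (Suc j) - lam * E j) + \<mu> * norm (E j - lam ^ j * E 0)"
    unfolding eq by (rule order_trans[OF norm_triangle_ineq]) (simp add: norm_mult \<mu>_def)
  also have "\<dots> \<le> 5 * C * d\<^sup>2 + \<mu> * (C' * d\<^sup>2)" using 1 IH \<mu>1 by (intro add_mono mult_left_mono) auto
  also have "5 * C = C' * (\<mu>\<^sup>2 - \<mu>)" using den by (simp add: C'_def)
  also have "C' * (\<mu>\<^sup>2 - \<mu>) * d\<^sup>2 + \<mu> * (C' * d\<^sup>2) = C' * (D * \<mu> ^ Suc j)\<^sup>2"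
    by (simp add: d_def algebra_simps power2_eq_square)
  finally show ?case by (simp add: C'_def \<mu>_def)
qed

lemma uniform_limit_shift:
  assumes "uniform_limit S (\<lambda>N. f (N + n)) h sequentially"
  shows "uniform_limit S f h sequentially"
  unfolding uniform_limit_iff
proof (intro allI impI)
  fix e :: real assume "e > 0"
  from uniform_limitD[OF assms this]
  show "\<forall>\<^sub>F N in sequentially. \<forall>x\<in>S. dist (f N x) (h x) < e"
    using eventually_sequentially_seg[of "\<lambda>N. \<forall>x\<in>S. dist (f N x) (h x) < e" n] by simp
qed

text \<open>
  The Poincare function of a repelling fixed point, the limit of \<open>f\<^sup>N (a0 + w / lam\<^sup>N)\<close>. Near 0 these
  functions are bounded by \<open>near_linear_orbit\<close>, hence equicontinuous, and consecutive ones differ by a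
  geometrically decreasing amount. The functional equation \<open>P (N + n) w = f\<^sup>n (P N (w / lam\<^sup>n))\<close>
  carries uniform convergence from a small disc to every disc.
\<close>

theorem poincare_function:
  fixes f :: "complex \<Rightarrow> complex"
  assumes hol: "f holomorphic_on UNIV" and fixed: "f a0 = a0" and lam: "norm lam > 1"
    and quad: "\<delta> > 0" "\<And>e. norm e < \<delta> \<Longrightarrow> norm (f (a0 + e) - a0 - lam * e) \<le> C * (norm e)\<^sup>2"
  obtains \<phi> where "\<phi> holomorphic_on UNIV" "\<not> \<phi> constant_on UNIV"
    "\<And>W. uniform_limit (cball 0 W) (\<lambda>N w. (f ^^ N) (a0 + w / lam ^ N)) \<phi> sequentially"
proof -
  define \<mu> where "\<mu> = norm lam"
  have \<mu>: "\<mu> > 1" "\<mu> \<noteq> 0" using lam by (auto simp: \<mu>_def)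
  have lam0: "lam \<noteq> 0" using lam by auto
  have den: "\<mu>\<^sup>2 - \<mu> > 0" using \<mu> by (simp add: power2_eq_square)
  define C0 where "C0 = \<bar>C\<bar> + 1"
  have C0: "C0 > 0" by (simp add: C0_def)
  have quad0: "norm (f (a0 + e) - a0 - lam * e) \<le> C0 * (norm e)\<^sup>2" if "norm e < \<delta>" for e
  proof -
    have "C * (norm e)\<^sup>2 \<le> C0 * (norm e)\<^sup>2" by (intro mult_right_mono) (auto simp: C0_def)
    then show ?thesis using quad(2)[OF that] by linarith
  qed
  define C' where "C' = 5 * C0 / (\<mu>\<^sup>2 - \<mu>)"
  have C': "C' > 0" using C0 den by (simp add: C'_def)
  define P where "P = (\<lambda>N w. (f ^^ N) (a0 + w / lam ^ N))"
  have itc: "(f ^^ n) holomorphic_on UNIV" for n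
  proof (induction n)
    case 0 then show ?case by (simp add: id_def holomorphic_on_ident)
  next
    case (Suc n) then show ?case
      using holomorphic_on_compose_gen[OF Suc hol] by (simp add: o_def)
  qed
  have P_hol: "P N holomorphic_on S" for N S
  proof -
    have "(\<lambda>w. a0 + w / lam ^ N) holomorphic_on S" using lam0 by (intro holomorphic_intros) auto
    from holomorphic_on_compose_gen[OF this itc] show ?thesis by (simp add: P_def o_def)
  qed
  define W0 where "W0 = min (1 / C') (\<delta> / 4)"
  have W0: "W0 > 0" using C' quad by (simp add: W0_def)
  have near: "norm (P N w - a0 - w) \<le> C' * (norm w)\<^sup>2" if w: "norm w \<le> W0" for N w
  proof -
    define E where "E j = (f ^^ j) (a0 + w / lam ^ N) - a0" for j
    define D where "D = norm w / \<mu> ^ N"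
    have DN: "D * \<mu> ^ N = norm w" using \<mu> by (simp add: D_def)
    have E0: "E 0 = w / lam ^ N" by (simp add: E_def)
    have "norm (E N - lam ^ N * E 0) \<le> 5 * C0 / ((norm lam)\<^sup>2 - norm lam) * (D * norm lam ^ N)\<^sup>2"
    proof (rule near_linear_orbit[of lam C0 E D 0 N "\<delta> / 2"])
      show "norm (E 0) \<le> D" by (simp add: E0 D_def \<mu>_def norm_divide norm_power)
      have "C' * norm w \<le> C' * (1 / C')" using w C' by (intro mult_left_mono) (auto simp: W0_def)
      then have "C' * (D * \<mu> ^ N) \<le> 1" using C' DN by simp
      then show "5 * C0 / ((norm lam)\<^sup>2 - norm lam) * (D * norm lam ^ N) \<le> 1"
        by (simp only: C'_def \<mu>_def)
      show "2 * (D * norm lam ^ N) \<le> \<delta> / 2" using DN w by (simp add: \<mu>_def W0_def)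
      show "norm (E (Suc j) - lam * E j) \<le> C0 * ((norm (E j))\<^sup>2 + 0\<^sup>2)" if "norm (E j) \<le> \<delta> / 2" for j
        using quad0[of "E j"] that quad(1) by (simp add: E_def)
      show "0 \<le> D" using \<mu> by (simp add: D_def)
    qed (use lam C0 in auto)
    also have "E N - lam ^ N * E 0 = P N w - a0 - w" using lam0 by (simp add: E0) (simp add: E_def P_def)
    finally show ?thesis using DN by (simp add: C'_def \<mu>_def)
  qed
  have P_bd: "norm (P N w) \<le> norm a0 + 2 * W0" if w: "norm w \<le> W0" for N w
  proof -
    have "C' * (norm w)\<^sup>2 \<le> norm w"
    proof -
      have "C' * norm w \<le> C' * (1 / C')" using w C' by (intro mult_left_mono) (auto simp: W0_def)
      then have "C' * norm w * norm w \<le> 1 * norm w" using C' by (intro mult_right_mono) auto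
      then show ?thesis by (simp add: power2_eq_square mult.assoc)
    qed
    then have "norm (P N w - a0 - w) \<le> W0" using near[OF w, of N] w by linarith
    moreover have "norm (P N w) \<le> norm (P N w - a0 - w) + norm (a0 + w)"
      using norm_triangle_ineq[of "P N w - a0 - w" "a0 + w"] by simp
    moreover have "norm (a0 + w) \<le> norm a0 + W0" using norm_triangle_ineq[of a0 w] w by linarith
    ultimately show ?thesis by linarith
  qed
  define r where "r = W0 / 2"
  have r: "r > 0" using W0 by (simp add: r_def)
  define L where "L = 2 * (norm a0 + 2 * W0) / r"
  have L0: "L \<ge> 0" using r W0 by (simp add: L_def)
  have lip: "norm (P N u - P N w) \<le> L * norm (u - w)" if "norm u < r" "norm w < r" for N u w
    unfolding L_def
    by (rule holomorphic_bounded_lipschitz[of "P N" 0 r, OF P_hol])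
      (use that r P_bd[of _ N] in \<open>auto simp: r_def\<close>)
  define W1 where "W1 = min (r / 2) (1 / (2 * C0))"
  have W1: "W1 > 0" "W1 \<le> r / 2" "C0 * W1 \<le> 1 / 2"
  proof -
    show "W1 > 0" "W1 \<le> r / 2" using r C0 by (auto simp: W1_def)
    have "C0 * W1 \<le> C0 * (1 / (2 * C0))" using C0 by (intro mult_left_mono) (auto simp: W1_def)
    then show "C0 * W1 \<le> 1 / 2" using C0 by simp
  qed
  have diff: "norm (P (Suc N) w - P N w) \<le> L * (C0 * W1\<^sup>2) * (1 / \<mu>) ^ N" if w: "norm w \<le> W1" for N w
  proof -
    define e where "e = w / lam ^ Suc N"
    define u where "u = lam ^ N * (f (a0 + e) - a0)"
    have "f (a0 + e) = a0 + u / lam ^ N" using lam0 by (simp add: u_def)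
    moreover have "P (Suc N) w = (f ^^ N) (f (a0 + e))" by (simp add: P_def e_def funpow_Suc_right del: funpow.simps)
    ultimately have PS: "P (Suc N) w = P N u" by (simp add: P_def)
    have en: "norm e * \<mu> ^ Suc N = norm w" using \<mu> by (simp add: e_def norm_divide norm_mult norm_power \<mu>_def)
    have "1 \<le> \<mu> ^ Suc N" using \<mu> by (intro one_le_power) auto
    then have "norm e * 1 \<le> norm e * \<mu> ^ Suc N" by (intro mult_left_mono) auto
    then have ew: "norm e \<le> norm w" using en by simp
    then have "norm e < \<delta>" using w W1 quad(1) by (auto simp: r_def W0_def)
    note q = quad0[OF this]
    have "u - w = lam ^ N * (f (a0 + e) - a0 - lam * e)"
      using lam0 by (simp add: u_def e_def algebra_simps)
    then have "norm (u - w) = \<mu> ^ N * norm (f (a0 + e) - a0 - lam * e)" by (simp add: norm_mult norm_power \<mu>_def)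
    also have "\<dots> \<le> \<mu> ^ N * (C0 * (norm e)\<^sup>2)" using q \<mu> by (intro mult_left_mono) auto
    also have "\<dots> \<le> C0 * (norm w)\<^sup>2 * (1 / \<mu>) ^ N"
    proof -
      have "norm e = norm w * (1 / \<mu>) ^ Suc N" using en \<mu> by (simp add: field_simps)
      then have "\<mu> ^ N * (C0 * (norm e)\<^sup>2) = C0 * (norm w)\<^sup>2 * (\<mu> ^ N * ((1 / \<mu>) ^ N * (1 / \<mu>) ^ N) * (1 / \<mu>)\<^sup>2)"
        by (simp add: power2_eq_square algebra_simps)
      also have "\<mu> ^ N * ((1 / \<mu>) ^ N * (1 / \<mu>) ^ N) = (1 / \<mu>) ^ N" using \<mu> by (simp add: power_divide)
      also have "(1 / \<mu>) ^ N * (1 / \<mu>)\<^sup>2 \<le> (1 / \<mu>) ^ N * 1" using \<mu> by (intro mult_left_mono power_le_one) auto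
      finally show ?thesis using C0 by (simp add: mult_left_mono)
    qed
    finally have uw: "norm (u - w) \<le> C0 * (norm w)\<^sup>2 * (1 / \<mu>) ^ N" .
    have "C0 * (norm w)\<^sup>2 \<le> C0 * W1\<^sup>2" using w C0 by (intro mult_left_mono power_mono) auto
    then have uw2: "norm (u - w) \<le> C0 * W1\<^sup>2 * (1 / \<mu>) ^ N"
      using uw \<mu> by (meson order_trans mult_right_mono zero_le_power zero_le_divide_1_iff less_imp_le zero_less_one less_trans)
    have "C0 * W1\<^sup>2 * (1 / \<mu>) ^ N \<le> C0 * W1\<^sup>2 * 1" using \<mu> C0 by (intro mult_left_mono power_le_one) auto
    also have "C0 * W1\<^sup>2 * 1 = (C0 * W1) * W1" by (simp add: power2_eq_square)
    also have "\<dots> \<le> 1 / 2 * W1" using W1 by (intro mult_right_mono) auto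
    finally have "norm (u - w) \<le> W1 / 2" using uw2 by simp
    then have "norm u < r" "norm w < r" using w W1 norm_triangle_sub[of u w] by auto
    then have "norm (P N u - P N w) \<le> L * norm (u - w)" by (rule lip)
    also have "\<dots> \<le> L * (C0 * W1\<^sup>2 * (1 / \<mu>) ^ N)" using uw2 L0 by (rule mult_left_mono)
    finally show ?thesis by (simp add: PS mult.assoc)
  qed
  have "uniform_limit (cball 0 W1) (\<lambda>n w. \<Sum>i<n. P (Suc i) w - P i w) (\<lambda>w. suminf (\<lambda>i. P (Suc i) w - P i w)) sequentially"
  proof (rule Weierstrass_m_test)
    show "norm (P (Suc n) w - P n w) \<le> L * (C0 * W1\<^sup>2) * (1 / \<mu>) ^ n" if "w \<in> cball 0 W1" for n w
      using diff[of w n] that by simp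
    show "summable (\<lambda>n. L * (C0 * W1\<^sup>2) * (1 / \<mu>) ^ n)"
      using \<mu> by (intro summable_mult summable_geometric) auto
  qed
  moreover have "(\<Sum>i<n. P (Suc i) w - P i w) = P n w - P 0 w" for n w by (rule sum_lessThan_telescope)
  ultimately obtain h0 where h0: "uniform_limit (cball 0 W1) (\<lambda>n w. P n w - P 0 w) h0 sequentially"
    by (simp only:)
  define h1 where "h1 w = h0 w + P 0 w" for w
  have h1: "uniform_limit (cball 0 W1) P h1 sequentially"
    using h0 unfolding uniform_limit_iff dist_norm h1_def by (simp add: algebra_simps)
  have h1_bd: "norm (h1 w) \<le> norm a0 + 2 * W0" if "norm w \<le> W1" for w
  proof (rule LIMSEQ_le_const2)
    show "(\<lambda>N. norm (P N w)) \<longlonglongrightarrow> norm (h1 w)"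
      using that by (intro tendsto_norm tendsto_uniform_limitI[OF h1]) auto
    show "\<exists>N. \<forall>n\<ge>N. norm (P n w) \<le> norm a0 + 2 * W0"
      using P_bd that W1 r by (auto simp: r_def)
  qed
  have ext: "\<exists>h. uniform_limit (cball 0 W) P h sequentially" for W
  proof -
    obtain n where "W / W1 < \<mu> ^ n" using real_arch_pow[OF \<mu>(1)] by blast
    then have n: "W \<le> W1 * \<mu> ^ n" using W1 by (simp add: field_simps)
    have wn: "norm (w / lam ^ n) \<le> W1" if "w \<in> cball 0 W" for w
    proof -
      have "norm w \<le> W1 * \<mu> ^ n" using that n by simp
      then show ?thesis using \<mu> by (simp add: norm_divide norm_power \<mu>_def field_simps)
    qed
    define M where "M = norm a0 + 2 * W0"
    have "uniformly_continuous_on (cball 0 M) (f ^^ n)"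
      by (intro compact_uniformly_continuous holomorphic_on_imp_continuous_on holomorphic_on_subset[OF itc]) auto
    have "uniform_limit (cball 0 W) (\<lambda>N. P (N + n)) (\<lambda>w. (f ^^ n) (h1 (w / lam ^ n))) sequentially"
      unfolding uniform_limit_iff
    proof (intro allI impI)
      fix \<epsilon> :: real assume "\<epsilon> > 0"
      then obtain d where d: "d > 0" "\<And>x y. x \<in> cball 0 M \<Longrightarrow> y \<in> cball 0 M \<Longrightarrow> dist y x < d \<Longrightarrow> dist ((f ^^ n) y) ((f ^^ n) x) < \<epsilon>"
        using \<open>uniformly_continuous_on (cball 0 M) (f ^^ n)\<close> unfolding uniformly_continuous_on_def by metis
      from uniform_limitD[OF h1 d(1)]
      show "\<forall>\<^sub>F N in sequentially. \<forall>w\<in>cball 0 W. dist (P (N + n) w) ((f ^^ n) (h1 (w / lam ^ n))) < \<epsilon>"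
      proof eventually_elim
        fix N assume N: "\<forall>w\<in>cball 0 W1. dist (P N w) (h1 w) < d"
        show "\<forall>w\<in>cball 0 W. dist (P (N + n) w) ((f ^^ n) (h1 (w / lam ^ n))) < \<epsilon>"
        proof
          fix w :: complex assume w: "w \<in> cball 0 W"
          have "P (N + n) w = (f ^^ n) (P N (w / lam ^ n))"
            unfolding P_def by (simp add: add.commute[of N] funpow_add power_add)
          moreover have "dist ((f ^^ n) (P N (w / lam ^ n))) ((f ^^ n) (h1 (w / lam ^ n))) < \<epsilon>"
          proof (rule d(2))
            have "norm (w / lam ^ n) \<le> W0" using wn[OF w] W1 W0 by (simp add: r_def)
            then show "P N (w / lam ^ n) \<in> cball 0 M" using P_bd by (simp add: M_def)
            show "h1 (w / lam ^ n) \<in> cball 0 M" using h1_bd[OF wn[OF w]] by (simp add: M_def)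
            show "dist (P N (w / lam ^ n)) (h1 (w / lam ^ n)) < d" using N wn[OF w] by simp
          qed
          ultimately show "dist (P (N + n) w) ((f ^^ n) (h1 (w / lam ^ n))) < \<epsilon>" by simp
        qed
      qed
    qed
    then show ?thesis using uniform_limit_shift by blast
  qed
  define \<phi> where "\<phi> w = lim (\<lambda>N. P N w)" for w
  have ul: "uniform_limit (cball 0 W) P \<phi> sequentially" for W
  proof -
    obtain h where h: "uniform_limit (cball 0 W) P h sequentially" using ext by blast
    have "h w = \<phi> w" if "w \<in> cball 0 W" for w
      unfolding \<phi>_def using tendsto_uniform_limitI[OF h that] by (simp add: limI)
    then show ?thesis using h uniform_limit_cong'[of "cball 0 W" P P h \<phi>] by simp
  qed
  have "\<phi> holomorphic_on UNIV"
  proof (rule holomorphic_uniform_sequence[of UNIV P])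
    fix w :: complex
    have "cball w 1 \<subseteq> cball 0 (norm w + 1)"
    proof
      fix u assume "u \<in> cball w 1"
      then show "u \<in> cball 0 (norm w + 1)" using norm_triangle_sub[of u w] by (simp add: dist_norm norm_minus_commute)
    qed
    then show "\<exists>d>0. cball w d \<subseteq> UNIV \<and> uniform_limit (cball w d) P \<phi> sequentially"
      using uniform_limit_on_subset[OF ul] by (intro exI[of _ 1]) auto
  qed (auto intro: P_hol)
  moreover have "\<not> \<phi> constant_on UNIV"
  proof
    assume "\<phi> constant_on UNIV"
    then have const: "\<phi> w = \<phi> 0" for w by (auto simp: constant_on_def)
    have lim: "(\<lambda>N. P N w) \<longlonglongrightarrow> \<phi> w" for w
      using tendsto_uniform_limitI[OF ul[of "norm w"], of w] by simp
    have near_phi: "norm (\<phi> w - a0 - w) \<le> C' * (norm w)\<^sup>2" if "norm w \<le> W0" for w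
    proof (rule LIMSEQ_le_const2)
      show "(\<lambda>N. norm (P N w - a0 - w)) \<longlonglongrightarrow> norm (\<phi> w - a0 - w)" by (intro tendsto_intros lim)
      show "\<exists>N. \<forall>n\<ge>N. norm (P n w - a0 - w) \<le> C' * (norm w)\<^sup>2" using near[OF that] by blast
    qed
    have "\<phi> 0 = a0" using near_phi[of 0] W0 by simp
    define w where "w = complex_of_real (W0 / 2)"
    have nw: "norm w = W0 / 2" using W0 by (simp add: w_def)
    have "norm (\<phi> w - a0 - w) \<le> C' * (norm w)\<^sup>2" using nw W0 by (intro near_phi) auto
    then have "norm w \<le> C' * (norm w)\<^sup>2" using const[of w] \<open>\<phi> 0 = a0\<close> by simp
    then have "norm w * 1 \<le> norm w * (C' * norm w)" by (simp add: power2_eq_square algebra_simps)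
    moreover have "norm w > 0" using nw W0 by linarith
    ultimately have "1 \<le> C' * norm w" by (rule mult_left_le_imp_le)
    moreover have "C' * (W0 / 2) \<le> C' * (1 / C' / 2)" using C' by (intro mult_left_mono) (auto simp: W0_def)
    ultimately show False using C' nw by simp
  qed
  ultimately show ?thesis using that ul unfolding P_def by blast
qed

text \<open>
  The Poincare function is also the limit of orbits under maps \<open>f t\<close> that vary with the scale, started
  at \<open>x t\<close> near the repelling point of \<open>f 0\<close>. To first order the fixed point of \<open>f t\<close> is
  \<open>a0 - b t\<close> with \<open>b = \<beta> / (lam - 1)\<close>, so the relevant displacement is \<open>E = f\<^sup>j (x t) - a0 + b t\<close>;
  it starts at about \<open>\<kappa> t\<close> and is multiplied by \<open>lam\<close> in each step, up to quadratic errors. With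
  \<open>t = w / (\<kappa> lam\<^sup>k)\<close> it is about \<open>w / lam\<^sup>N\<close> after \<open>k - N\<close> steps, for a large but fixed \<open>N\<close>.
  The remaining \<open>N\<close> steps are fixed in number, so the dependence on \<open>t\<close> disappears in the limit.
\<close>

theorem perturbed_orbit_limit:
  fixes f :: "complex \<Rightarrow> complex \<Rightarrow> complex" and x :: "complex \<Rightarrow> complex"
  assumes lam: "norm lam > 1"
    and quad: "\<delta> > 0"
      "\<And>t e. norm t < \<delta> \<Longrightarrow> norm e < \<delta> \<Longrightarrow>
        norm (f t (a0 + e) - a0 - lam * e - \<beta> * t) \<le> C * ((norm t)\<^sup>2 + (norm e)\<^sup>2)"
    and x: "x 0 = a0" "(x has_field_derivative x') (at 0)"
    and \<kappa>: "\<kappa> = x' + \<beta> / (lam - 1)" "\<kappa> \<noteq> 0"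
    and cont: "d > 0" "\<And>N. continuous_on (cball 0 d \<times> UNIV) (\<lambda>(t, z). (f t ^^ N) z)"
    and \<phi>: "\<And>W. uniform_limit (cball 0 W) (\<lambda>N w. (f 0 ^^ N) (a0 + w / lam ^ N)) \<phi> sequentially"
      "continuous_on UNIV \<phi>"
    and w: "w \<longlonglongrightarrow> w0"
  shows "(\<lambda>k. (f (w k / (\<kappa> * lam ^ k)) ^^ k) (x (w k / (\<kappa> * lam ^ k)))) \<longlonglongrightarrow> \<phi> w0"
proof (rule tendstoI)
  fix \<epsilon> :: real assume \<epsilon>: "\<epsilon> > 0"
  define \<mu> where "\<mu> = norm lam"
  have \<mu>: "\<mu> > 1" using lam by (simp add: \<mu>_def)
  have lam0: "lam \<noteq> 0" "lam \<noteq> 1" using lam by auto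
  have den: "\<mu>\<^sup>2 - \<mu> > 0" using \<mu> by (simp add: power2_eq_square)
  define t where "t k = w k / (\<kappa> * lam ^ k)" for k
  define b where "b = \<beta> / (lam - 1)"
  define E where "E k j = (f (t k) ^^ j) (x (t k)) - a0 + b * t k" for k j
  define C1 where "C1 = \<bar>C\<bar> * (2 * (norm b)\<^sup>2 + 2)"
  have C1: "C1 \<ge> 0" by (simp add: C1_def)
  have step: "norm (E k (Suc j) - lam * E k j) \<le> C1 * ((norm (E k j))\<^sup>2 + (norm (t k))\<^sup>2)"
    if tk: "norm (t k) < \<delta>" "norm (b * t k) < \<delta> / 2" and Ej: "norm (E k j) \<le> \<delta> / 4" for k j
  proof -
    define e where "e = (f (t k) ^^ j) (x (t k)) - a0"
    have Ee: "e = E k j - b * t k" by (simp add: e_def E_def)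
    have ne: "norm e \<le> norm (E k j) + norm b * norm (t k)"
      unfolding Ee using norm_triangle_ineq4[of "E k j" "b * t k"] by (simp add: norm_mult)
    then have "norm e < \<delta>" using tk Ej quad(1) by (simp add: norm_mult)
    from quad(2)[OF tk(1) this]
    have q: "norm (f (t k) (a0 + e) - a0 - lam * e - \<beta> * t k) \<le> \<bar>C\<bar> * ((norm (t k))\<^sup>2 + (norm e)\<^sup>2)"
      by (rule order_trans) (intro mult_right_mono, auto)
    have \<beta>: "\<beta> = b * (lam - 1)" using lam0 by (simp add: b_def)
    have "f (t k) (a0 + e) - a0 - lam * e - \<beta> * t k = f (t k) (a0 + e) - a0 + b * t k - lam * (e + b * t k)"
      unfolding \<beta> by (simp add: algebra_simps)
    also have "\<dots> = E k (Suc j) - lam * E k j" by (simp add: E_def e_def)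
    finally have eq: "norm (E k (Suc j) - lam * E k j) \<le> \<bar>C\<bar> * ((norm (t k))\<^sup>2 + (norm e)\<^sup>2)" using q by simp
    have "(norm e)\<^sup>2 \<le> (norm (E k j) + norm b * norm (t k))\<^sup>2" using ne by (intro power_mono) auto
    also have "\<dots> \<le> 2 * (norm (E k j))\<^sup>2 + 2 * (norm b * norm (t k))\<^sup>2"
      using zero_le_power2[of "norm (E k j) - norm b * norm (t k)"] by (simp add: power2_eq_square algebra_simps)
    finally have "(norm e)\<^sup>2 \<le> 2 * (norm (E k j))\<^sup>2 + 2 * ((norm b)\<^sup>2 * (norm (t k))\<^sup>2)"
      by (simp add: power_mult_distrib)
    moreover have "(norm b)\<^sup>2 * (norm (E k j))\<^sup>2 \<ge> 0" "(norm (t k))\<^sup>2 \<ge> 0" by auto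
    moreover have "(2 * (norm b)\<^sup>2 + 2) * ((norm (E k j))\<^sup>2 + (norm (t k))\<^sup>2) = 2 * ((norm b)\<^sup>2 * (norm (E k j))\<^sup>2)
        + 2 * ((norm b)\<^sup>2 * (norm (t k))\<^sup>2) + 2 * (norm (E k j))\<^sup>2 + 2 * (norm (t k))\<^sup>2"
      by (simp add: algebra_simps)
    ultimately have "(norm (t k))\<^sup>2 + (norm e)\<^sup>2 \<le> (2 * (norm b)\<^sup>2 + 2) * ((norm (E k j))\<^sup>2 + (norm (t k))\<^sup>2)"
      by linarith
    then have "\<bar>C\<bar> * ((norm (t k))\<^sup>2 + (norm e)\<^sup>2) \<le> C1 * ((norm (E k j))\<^sup>2 + (norm (t k))\<^sup>2)"
      unfolding C1_def mult.assoc by (intro mult_left_mono) auto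
    then show ?thesis using eq by linarith
  qed
  have invlam: "(\<lambda>k. inverse (lam ^ k)) \<longlonglongrightarrow> 0"
    using LIMSEQ_inverse_realpow_zero[OF \<mu>] tendsto_norm_zero_iff[of "\<lambda>k. inverse (lam ^ k)"]
    by (simp add: norm_inverse norm_power \<mu>_def)
  have t_lim: "t \<longlonglongrightarrow> 0"
  proof -
    have "(\<lambda>k. w k * inverse \<kappa> * inverse (lam ^ k)) \<longlonglongrightarrow> w0 * inverse \<kappa> * 0"
      by (intro tendsto_intros w invlam)
    then show ?thesis by (simp add: t_def[abs_def] divide_inverse mult.assoc)
  qed
  have E0_lim: "(\<lambda>k. lam ^ k * E k 0) \<longlonglongrightarrow> w0"
  proof -
    define g where "g s = (if s = 0 then x' else (x s - x 0) / s)" for s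
    have "isCont g 0"
    proof -
      have "((\<lambda>s. (x s - x 0) / (s - 0)) \<longlongrightarrow> x') (at 0)" using x(2) by (simp add: has_field_derivative_iff)
      then have "(g \<longlongrightarrow> x') (at 0)" by (rule Lim_transform_within[of _ _ _ _ 1]) (auto simp: g_def)
      then show ?thesis by (simp add: isCont_def g_def)
    qed
    then have "(\<lambda>k. g (t k)) \<longlonglongrightarrow> x'" using isCont_tendsto_compose[OF _ t_lim, of g] by (simp add: g_def)
    then have "(\<lambda>k. (g (t k) + b) * (w k / \<kappa>)) \<longlonglongrightarrow> (x' + b) * (w0 / \<kappa>)"
      using \<kappa> by (intro tendsto_intros w)
    moreover have "(x' + b) * (w0 / \<kappa>) = w0" using \<kappa> by (simp add: b_def)
    moreover have "(g (t k) + b) * (w k / \<kappa>) = lam ^ k * E k 0" for k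
    proof -
      have "x (t k) - a0 = g (t k) * t k" using x by (simp add: g_def)
      then have "E k 0 = (g (t k) + b) * t k" by (simp add: E_def algebra_simps)
      then show ?thesis using lam0 by (simp add: t_def)
    qed
    ultimately show ?thesis by simp
  qed
  \<comment> \<open>\<open>Wm / \<mu>\<^sup>k\<close> bounds both \<open>E k 0\<close> and the parameter \<open>t k\<close>.\<close>
  define Wm where "Wm = norm w0 + 1 + (norm w0 + 1) / norm \<kappa>"
  have Wm: "Wm > 0" "norm w0 + 1 \<le> Wm" "(norm w0 + 1) / norm \<kappa> \<le> Wm"
  proof -
    have "(norm w0 + 1) / norm \<kappa> \<ge> 0" by simp
    then show "Wm > 0" "norm w0 + 1 \<le> Wm" "(norm w0 + 1) / norm \<kappa> \<le> Wm"
      unfolding Wm_def using norm_ge_zero[of w0] by linarith+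
  qed
  define C' where "C' = 5 * C1 / (\<mu>\<^sup>2 - \<mu>)"
  have C'0: "C' \<ge> 0" using C1 den by (simp add: C'_def)
  obtain \<eta> where \<eta>: "\<eta> > 0" "\<eta> < 1" "\<And>u. dist u w0 < \<eta> \<Longrightarrow> dist (\<phi> u) (\<phi> w0) < \<epsilon> / 3"
  proof -
    have "isCont \<phi> w0" using \<phi>(2) by (simp add: continuous_on_eq_continuous_at)
    then obtain e where "e > 0" "\<And>u. dist u w0 < e \<Longrightarrow> dist (\<phi> u) (\<phi> w0) < \<epsilon> / 3"
      unfolding continuous_at_eps_delta using \<epsilon> by (metis divide_pos_pos zero_less_numeral)
    then show ?thesis using that[of "min e (1/2)"] by auto
  qed
  have pow0: "(\<lambda>N. inverse (\<mu> ^ N)) \<longlonglongrightarrow> 0" by (rule LIMSEQ_inverse_realpow_zero[OF \<mu>])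
  have "\<forall>\<^sub>F N in sequentially. (C' * Wm\<^sup>2 * inverse (\<mu> ^ N) < \<eta> / 2 \<and> C' * Wm * inverse (\<mu> ^ N) < 1)
      \<and> (2 * Wm * inverse (\<mu> ^ N) < \<delta> / 4 \<and>
      (\<forall>u\<in>cball 0 (norm w0 + 1). dist ((f 0 ^^ N) (a0 + u / lam ^ N)) (\<phi> u) < \<epsilon> / 3))"
  proof (intro eventually_conj)
    have z: "(\<lambda>N. c * inverse (\<mu> ^ N)) \<longlonglongrightarrow> 0" for c using tendsto_mult_right_zero[OF pow0] by simp
    show "\<forall>\<^sub>F N in sequentially. C' * Wm\<^sup>2 * inverse (\<mu> ^ N) < \<eta> / 2"
      by (rule order_tendstoD(2)[OF z]) (use \<eta> in simp)
    show "\<forall>\<^sub>F N in sequentially. C' * Wm * inverse (\<mu> ^ N) < 1" by (rule order_tendstoD(2)[OF z]) simp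
    show "\<forall>\<^sub>F N in sequentially. 2 * Wm * inverse (\<mu> ^ N) < \<delta> / 4" by (rule order_tendstoD(2)[OF z]) (use quad(1) in simp)
    show "\<forall>\<^sub>F N in sequentially. \<forall>u\<in>cball 0 (norm w0 + 1). dist ((f 0 ^^ N) (a0 + u / lam ^ N)) (\<phi> u) < \<epsilon> / 3"
      by (rule uniform_limitD[OF \<phi>(1)]) (use \<epsilon> in simp)
  qed
  then obtain N where N: "C' * Wm\<^sup>2 * inverse (\<mu> ^ N) < \<eta> / 2" "C' * Wm * inverse (\<mu> ^ N) < 1"
      "2 * Wm * inverse (\<mu> ^ N) < \<delta> / 4"
      "\<And>u. norm u \<le> norm w0 + 1 \<Longrightarrow> dist ((f 0 ^^ N) (a0 + u / lam ^ N)) (\<phi> u) < \<epsilon> / 3"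
    unfolding eventually_sequentially by force
  define M where "M = norm a0 + (norm w0 + 1) + 1"
  have "uniformly_continuous_on (cball 0 d \<times> cball 0 M) (\<lambda>(t, z). (f t ^^ N) z)"
    by (intro compact_uniformly_continuous continuous_on_subset[OF cont(2)] compact_Times) auto
  then obtain d' where d': "d' > 0" "\<And>y y'. y \<in> cball 0 d \<times> cball 0 M \<Longrightarrow> y' \<in> cball 0 d \<times> cball 0 M \<Longrightarrow>
      dist y' y < d' \<Longrightarrow> dist ((\<lambda>(t, z). (f t ^^ N) z) y') ((\<lambda>(t, z). (f t ^^ N) z) y) < \<epsilon> / 3"
    unfolding uniformly_continuous_on_def using \<epsilon> by (metis divide_pos_pos zero_less_numeral)
  have small_t: "\<forall>\<^sub>F k in sequentially. norm (c * t k) < s" if "s > 0" for c s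
  proof -
    have "(\<lambda>k. norm (c * t k)) \<longlonglongrightarrow> norm (c * 0)" by (intro tendsto_intros t_lim)
    then show ?thesis using order_tendstoD(2) that by fastforce
  qed
  have "\<forall>\<^sub>F k in sequentially. norm (w k) < norm w0 + 1"
    using order_tendstoD(2)[OF tendsto_norm[OF w]] by simp
  moreover have "\<forall>\<^sub>F k in sequentially. dist (lam ^ k * E k 0) w0 < \<eta> / 2"
    by (rule tendstoD[OF E0_lim]) (use \<eta> in simp)
  moreover have "\<forall>\<^sub>F k in sequentially. norm (1 * t k) < min (min \<delta> d) (d' / 2)"
    using quad cont d' by (intro small_t) auto
  moreover have "\<forall>\<^sub>F k in sequentially. norm (b * t k) < min (\<delta> / 2) (min 1 (d' / 2))"
    using quad d' by (intro small_t) auto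
  moreover have "\<forall>\<^sub>F k in sequentially. k \<ge> N" by (rule eventually_ge_at_top)
  ultimately show "\<forall>\<^sub>F k in sequentially.
      dist ((f (w k / (\<kappa> * lam ^ k)) ^^ k) (x (w k / (\<kappa> * lam ^ k)))) (\<phi> w0) < \<epsilon>"
  proof eventually_elim
    case (elim k)
    have tk: "norm (t k) < \<delta>" "norm (t k) < d" "norm (t k) < d' / 2"
      "norm (b * t k) < \<delta> / 2" "norm (b * t k) < 1" "norm (b * t k) < d' / 2"
      using elim by auto
    define n where "n = k - N"
    have k: "k = N + n" using elim by (simp add: n_def)
    define D where "D = Wm / \<mu> ^ k"
    have Dn: "D * \<mu> ^ n = Wm * inverse (\<mu> ^ N)" using \<mu> by (simp add: D_def k power_add field_simps)
    have "norm (E k n - lam ^ n * E k 0) \<le> 5 * C1 / ((norm lam)\<^sup>2 - norm lam) * (D * norm lam ^ n)\<^sup>2"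
    proof (rule near_linear_orbit[of lam C1 "E k" D "norm (t k)" n "\<delta> / 4"])
      have "norm (lam ^ k * E k 0) \<le> norm w0 + 1"
        using elim(2) \<eta>(2) norm_triangle_sub[of "lam ^ k * E k 0" w0] by (simp add: dist_norm)
      then have "\<mu> ^ k * norm (E k 0) \<le> Wm" using Wm by (simp add: norm_mult norm_power \<mu>_def)
      then show "norm (E k 0) \<le> D" using \<mu> by (simp add: D_def field_simps)
      have "norm (t k) = norm (w k) / norm \<kappa> / \<mu> ^ k" by (simp add: t_def norm_divide norm_mult norm_power \<mu>_def)
      also have "\<dots> \<le> (norm w0 + 1) / norm \<kappa> / \<mu> ^ k" using elim(1) \<mu> by (intro divide_right_mono) auto
      also have "\<dots> \<le> D" unfolding D_def using Wm \<mu> by (intro divide_right_mono) auto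
      finally show "norm (t k) \<le> D" .
      show "5 * C1 / ((norm lam)\<^sup>2 - norm lam) * (D * norm lam ^ n) \<le> 1"
        using N(2) Dn unfolding C'_def \<mu>_def by (simp add: mult.assoc)
      show "2 * (D * norm lam ^ n) \<le> \<delta> / 4" using N(3) Dn unfolding \<mu>_def by (simp add: mult.assoc)
      show "norm (E k (Suc j) - lam * E k j) \<le> C1 * ((norm (E k j))\<^sup>2 + (norm (t k))\<^sup>2)"
        if "norm (E k j) \<le> \<delta> / 4" for j by (rule step[OF tk(1,4) that])
    qed (use lam C1 in auto)
    then have En: "norm (E k n - lam ^ n * E k 0) \<le> C' * (Wm * inverse (\<mu> ^ N))\<^sup>2"
      using Dn by (simp add: C'_def \<mu>_def)
    define v where "v = lam ^ N * E k n"
    have "norm (v - lam ^ k * E k 0) = \<mu> ^ N * norm (E k n - lam ^ n * E k 0)"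
    proof -
      have "v - lam ^ k * E k 0 = lam ^ N * (E k n - lam ^ n * E k 0)"
        by (simp add: v_def k power_add algebra_simps)
      then show ?thesis by (simp add: norm_mult norm_power \<mu>_def)
    qed
    also have "\<dots> \<le> \<mu> ^ N * (C' * (Wm * inverse (\<mu> ^ N))\<^sup>2)" using En \<mu> by (intro mult_left_mono) auto
    also have "\<dots> = C' * Wm\<^sup>2 * inverse (\<mu> ^ N)" using \<mu> by (simp add: power2_eq_square field_simps)
    finally have "norm (v - lam ^ k * E k 0) < \<eta> / 2" using N(1) by linarith
    then have vw: "dist v w0 < \<eta>"
      using elim(2) dist_triangle[of v w0 "lam ^ k * E k 0"] by (simp add: dist_norm)
    then have vn: "norm v \<le> norm w0 + 1" using \<eta>(2) norm_triangle_sub[of v w0] by (simp add: dist_norm)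
    have orb: "(f (t k) ^^ n) (x (t k)) = a0 + v / lam ^ N - b * t k"
      using lam0 by (simp add: v_def E_def)
    have vl: "norm (v / lam ^ N) \<le> norm v"
    proof -
      have "norm v * 1 \<le> norm v * \<mu> ^ N" using \<mu> by (intro mult_left_mono) auto
      moreover have "\<mu> ^ N > 0" using \<mu> by simp
      ultimately have "norm v / \<mu> ^ N \<le> norm v" by (simp add: divide_le_eq)
      then show ?thesis by (simp add: norm_divide norm_power \<mu>_def)
    qed
    have "dist ((\<lambda>(t, z). (f t ^^ N) z) (t k, a0 + v / lam ^ N - b * t k)) ((\<lambda>(t, z). (f t ^^ N) z) (0, a0 + v / lam ^ N)) < \<epsilon> / 3"
    proof (rule d'(2))
      show "(0, a0 + v / lam ^ N) \<in> cball 0 d \<times> cball 0 M"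
        using cont(1) vn vl norm_triangle_ineq[of a0 "v / lam ^ N"] by (simp add: M_def)
      show "(t k, a0 + v / lam ^ N - b * t k) \<in> cball 0 d \<times> cball 0 M"
        using tk vn vl norm_triangle_ineq[of a0 "v / lam ^ N"] norm_triangle_ineq4[of "a0 + v / lam ^ N" "b * t k"]
        by (simp add: M_def)
      have "dist (t k, a0 + v / lam ^ N - b * t k) (0, a0 + v / lam ^ N) \<le> norm (t k) + norm (b * t k)"
        unfolding dist_Pair_Pair by (intro order_trans[OF sqrt_sum_squares_le_sum]) (auto simp: dist_norm)
      then show "dist (t k, a0 + v / lam ^ N - b * t k) (0, a0 + v / lam ^ N) < d'" using tk by linarith
    qed
    then have "dist ((f (t k) ^^ N) ((f (t k) ^^ n) (x (t k)))) ((f 0 ^^ N) (a0 + v / lam ^ N)) < \<epsilon> / 3"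
      by (simp add: orb)
    moreover have "dist ((f 0 ^^ N) (a0 + v / lam ^ N)) (\<phi> v) < \<epsilon> / 3" by (rule N(4)[OF vn])
    moreover have "dist (\<phi> v) (\<phi> w0) < \<epsilon> / 3" by (rule \<eta>(3)[OF vw])
    moreover have "(f (t k) ^^ N) ((f (t k) ^^ n) (x (t k))) = (f (t k) ^^ k) (x (t k))"
      by (simp add: k funpow_add)
    ultimately have "dist ((f (t k) ^^ k) (x (t k))) (\<phi> w0) < \<epsilon>"
      using dist_triangle[of "(f (t k) ^^ k) (x (t k))" "\<phi> w0" "(f 0 ^^ N) (a0 + v / lam ^ N)"]
        dist_triangle[of "(f 0 ^^ N) (a0 + v / lam ^ N)" "\<phi> w0" "\<phi> v"] by simp
    then show ?case by (simp add: t_def)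
  qed
qed

section \<open>Hausdorff limits and persistence\<close>

text \<open>
  Hausdorff convergence of truncations from sequential conditions. The lower condition is needed only
  up to small displacements of the point, and the circle that truncation adds takes care of points at the
  boundary of the disc.
\<close>

lemma hausdorff_truncate:
  fixes E :: "nat \<Rightarrow> complex set" and L :: "complex set"
  assumes r: "r > 0" and L: "closed L"
    and E_closed: "\<forall>\<^sub>F k in sequentially. closed (cball 0 r \<inter> E k)"
    and upper: "\<And>w w0. w \<longlonglongrightarrow> w0 \<Longrightarrow> \<exists>\<^sub>F k in sequentially. w k \<in> E k \<Longrightarrow> w0 \<in> L"
    and lower: "\<And>w e. w \<in> L \<Longrightarrow> e > 0 \<Longrightarrow> \<exists>w'\<in>ball w e. \<forall>\<^sub>F k in sequentially. w' \<in> E k"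
  shows "hausdorff_converges (\<lambda>k. truncate (E k) r) (truncate L r)"
  unfolding hausdorff_converges_def
proof (intro conjI allI impI)
  have ne: "truncate A r \<noteq> {}" for A
  proof -
    have "complex_of_real r \<in> truncate A r" using r by (simp add: truncate_def)
    then show ?thesis by blast
  qed
  have cpt: "compact (truncate A r)" if "closed (cball 0 r \<inter> A)" for A
  proof -
    have "bounded (cball 0 r \<inter> A)" by (rule bounded_subset[OF bounded_cball]) auto
    then have "compact (cball 0 r \<inter> A)" using that by (simp add: compact_eq_bounded_closed)
    then show ?thesis unfolding truncate_def by (intro compact_Un) auto
  qed
  show cL: "compact (truncate L r)" using L by (intro cpt closed_Int) auto
  show "truncate L r \<noteq> {}" by (rule ne)
  show "\<forall>\<^sub>F k in sequentially. compact (truncate (E k) r) \<and> truncate (E k) r \<noteq> {}"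
    using E_closed by eventually_elim (use cpt ne in auto)
  fix \<epsilon> :: real assume \<epsilon>: "\<epsilon> > 0"
  have low: "\<forall>\<^sub>F k in sequentially. truncate L r \<subseteq> eps_nbhd \<epsilon> (truncate (E k) r)"
  proof -
    have "\<exists>w'. w' \<in> ball w (\<epsilon> / 2) \<and> (\<forall>\<^sub>F k in sequentially. w' \<in> truncate (E k) r)" if w: "w \<in> truncate L r" for w
    proof (cases "norm w = r")
      case True
      then show ?thesis using \<epsilon> by (intro exI[of _ w]) (auto simp: truncate_def)
    next
      case False
      then have w: "norm w < r" "w \<in> L" using w by (auto simp: truncate_def)
      then obtain w' where w': "w' \<in> ball w (min (\<epsilon> / 2) (r - norm w))" "\<forall>\<^sub>F k in sequentially. w' \<in> E k"
        using lower[of w "min (\<epsilon> / 2) (r - norm w)"] \<epsilon> by auto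
      have "norm w' \<le> norm w + dist w w'" using norm_triangle_sub[of w' w] by (simp add: dist_norm norm_minus_commute)
      then have "norm w' \<le> r" using w'(1) by auto
      from w'(2) have "\<forall>\<^sub>F k in sequentially. w' \<in> truncate (E k) r"
        by eventually_elim (use \<open>norm w' \<le> r\<close> in \<open>auto simp: truncate_def\<close>)
      then show ?thesis using w'(1) by auto
    qed
    then obtain c where c: "\<And>w. w \<in> truncate L r \<Longrightarrow> c w \<in> ball w (\<epsilon> / 2)"
      "\<And>w. w \<in> truncate L r \<Longrightarrow> \<forall>\<^sub>F k in sequentially. c w \<in> truncate (E k) r" by metis
    have "truncate L r \<subseteq> (\<Union>w\<in>truncate L r. ball w (\<epsilon> / 2))" using \<epsilon> by force
    then obtain S where S: "S \<subseteq> truncate L r" "finite S" "truncate L r \<subseteq> (\<Union>w\<in>S. ball w (\<epsilon> / 2))"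
      by (rule compactE_image[OF cL, rotated]) auto
    have "\<forall>\<^sub>F k in sequentially. \<forall>w\<in>S. c w \<in> truncate (E k) r"
      using S c(2) by (intro eventually_ball_finite) auto
    then show ?thesis
    proof eventually_elim
      case (elim k)
      show ?case
      proof
        fix v assume "v \<in> truncate L r"
        then obtain w where w: "w \<in> S" "v \<in> ball w (\<epsilon> / 2)" using S(3) by blast
        have "dist (c w) v < \<epsilon>"
          using c(1)[of w] w S(1) dist_triangle[of "c w" v w] by (auto simp: dist_commute)
        then show "v \<in> eps_nbhd \<epsilon> (truncate (E k) r)" using elim w(1) by (auto simp: eps_nbhd_def)
      qed
    qed
  qed
  have up: "\<forall>\<^sub>F k in sequentially. truncate (E k) r \<subseteq> eps_nbhd \<epsilon> (truncate L r)"
  proof (rule ccontr)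
    assume "\<not> ?thesis"
    then have "\<exists>\<^sub>F k in sequentially. \<not> truncate (E k) r \<subseteq> eps_nbhd \<epsilon> (truncate L r)"
      by (simp add: not_eventually)
    then have "infinite {k. \<not> truncate (E k) r \<subseteq> eps_nbhd \<epsilon> (truncate L r)}"
      by (simp add: frequently_cofinite flip: cofinite_eq_sequentially)
    then obtain s :: "nat \<Rightarrow> nat" where s: "strict_mono s"
      "\<forall>k. s k \<in> {k. \<not> truncate (E k) r \<subseteq> eps_nbhd \<epsilon> (truncate L r)}"
      using infinite_enumerate by blast
    then have "\<forall>k. \<exists>v. v \<in> truncate (E (s k)) r \<and> v \<notin> eps_nbhd \<epsilon> (truncate L r)" by auto
    then obtain v where v: "\<And>k. v k \<in> truncate (E (s k)) r" "\<And>k. v k \<notin> eps_nbhd \<epsilon> (truncate L r)" by metis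
    have nsph: "v k \<notin> truncate L r" for k using v(2)[of k] \<epsilon> by (force simp: eps_nbhd_def)
    then have vE: "v k \<in> cball 0 r" "v k \<in> E (s k)" for k
      using v(1)[of k] nsph[of k] by (auto simp: truncate_def)
    then obtain v0 s' where v0: "v0 \<in> cball 0 r" "strict_mono (s' :: nat \<Rightarrow> nat)" "(v \<circ> s') \<longlonglongrightarrow> v0"
      using compact_cball[of "0::complex" r] unfolding compact_def by metis
    define u where "u = s \<circ> s'"
    have u: "strict_mono u" using s v0 by (simp add: u_def strict_mono_o)
    \<comment> \<open>The upper condition speaks of full sequences, so the subsequence is filled up with its limit.\<close>
    define w where "w n = (if n \<in> range u then v (s' (inv u n)) else v0)" for n
    have wu: "w (u k) = v (s' k)" for k using strict_mono_imp_inj_on[OF u] by (simp add: w_def)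
    have "w \<longlonglongrightarrow> v0"
    proof (rule tendstoI)
      fix e :: real assume e: "e > 0"
      from tendstoD[OF v0(3) this] obtain K where K: "\<And>k. k \<ge> K \<Longrightarrow> dist (v (s' k)) v0 < e"
        by (auto simp: eventually_sequentially)
      show "\<forall>\<^sub>F n in sequentially. dist (w n) v0 < e"
        unfolding eventually_sequentially
      proof (intro exI[of _ "u K"] allI impI)
        fix n assume n: "n \<ge> u K"
        show "dist (w n) v0 < e"
        proof (cases "n \<in> range u")
          case True
          then obtain k where k: "n = u k" by blast
          then have "K \<le> k" using n u by (simp add: strict_mono_less_eq)
          then show ?thesis using K wu k by simp
        qed (use e in \<open>simp add: w_def\<close>)
      qed
    qed
    moreover have "\<exists>\<^sub>F k in sequentially. w k \<in> E k"
      unfolding frequently_sequentially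
    proof
      fix N
      have "u N \<ge> N" using u by (rule seq_suble)
      moreover have "w (u N) \<in> E (u N)" using vE(2)[of "s' N"] wu[of N] by (simp add: u_def)
      ultimately show "\<exists>n\<ge>N. w n \<in> E n" by blast
    qed
    ultimately have "v0 \<in> L" by (rule upper)
    then have "v0 \<in> truncate L r" using v0(1) by (simp add: truncate_def)
    from tendstoD[OF v0(3) \<epsilon>] obtain k where "dist v0 (v (s' k)) < \<epsilon>"
      by (auto simp: eventually_sequentially dist_commute)
    then have "v (s' k) \<in> eps_nbhd \<epsilon> (truncate L r)" using \<open>v0 \<in> truncate L r\<close> by (auto simp: eps_nbhd_def)
    then show False using v(2) by blast
  qed
  from low up show "\<forall>\<^sub>F k in sequentially. truncate L r \<subseteq> eps_nbhd \<epsilon> (truncate (E k) r) \<and>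
      truncate (E k) r \<subseteq> eps_nbhd \<epsilon> (truncate L r)" by (rule eventually_conj)
qed

lemma continuous_iterate_family:
  assumes "continuous_on S \<gamma>"
  shows "continuous_on (S \<times> UNIV) (\<lambda>(t, z). (cubic (\<gamma> t) ^^ n) z)"
  unfolding case_prod_unfold
proof (induction n)
  case 0 show ?case by (simp add: continuous_on_snd continuous_on_id)
next
  case (Suc n)
  have "continuous_on (S \<times> UNIV) (\<lambda>x. \<gamma> (fst x))"
    by (rule continuous_on_compose2[OF assms]) (auto intro: continuous_intros)
  then show ?case using Suc by (simp add: cubic_def) (intro continuous_intros)
qed

locale misiurewicz_family = misiurewicz_map +
  fixes \<gamma> :: "complex \<Rightarrow> complex \<times> complex" and d B' :: real
  assumes d: "d > 0" and \<gamma>_cont: "continuous_on (cball 0 d) \<gamma>" and \<gamma>0: "\<gamma> 0 = F"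
    and bound: "\<And>t. t \<in> cball 0 d \<Longrightarrow> norm (fst (\<gamma> t)) + norm (snd (\<gamma> t)) \<le> B'"
begin

lemma iterate_tendsto:
  assumes "T \<longlonglongrightarrow> 0" "Z \<longlonglongrightarrow> z"
  shows "(\<lambda>k. (cubic (\<gamma> (T k)) ^^ n) (Z k)) \<longlonglongrightarrow> (f ^^ n) z"
proof -
  have "isCont (\<lambda>(t, z). (cubic (\<gamma> t) ^^ n) z) (0, z)"
  proof -
    have "continuous_on (ball 0 d \<times> UNIV) (\<lambda>(t, z). (cubic (\<gamma> t) ^^ n) z)"
      by (rule continuous_on_subset[OF continuous_iterate_family[OF \<gamma>_cont]]) auto
    moreover have "open (ball (0::complex) d \<times> (UNIV :: complex set))" by (intro open_Times) auto
    ultimately show ?thesis using d by (simp add: continuous_on_eq_continuous_at)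
  qed
  from isCont_tendsto_compose[OF this tendsto_Pair[OF assms]] show ?thesis by (simp add: \<gamma>0)
qed

text \<open>
  A disc around the superattracting point \<open>a\<close> is mapped well into itself by \<open>f\<^sup>p\<close>, and therefore
  into itself by nearby maps.
\<close>

lemma persistent_basin:
  obtains \<delta> d' where "\<delta> > 0" "d' > 0" "\<And>t. norm t < d' \<Longrightarrow> cball (fst F) \<delta> \<subseteq> filled_julia (\<gamma> t)"
proof -
  let ?a = "fst F"
  have "iterate_deriv F p ?a = 0" using iterate_deriv_eq_0_iff[of F p ?a] p(1) by (auto intro!: exI[of _ 0])
  then have "((f ^^ p) has_field_derivative 0) (at ?a)" using has_field_derivative_iterate[of p F ?a UNIV] by simp
  then have "((\<lambda>z. ((f ^^ p) z - (f ^^ p) ?a) / (z - ?a)) \<longlongrightarrow> 0) (at ?a)"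
    by (simp add: has_field_derivative_iff)
  from tendstoD[OF this, of "1/2"] obtain \<delta>0 where \<delta>0: "\<delta>0 > 0"
    "\<And>z. z \<noteq> ?a \<Longrightarrow> dist z ?a < \<delta>0 \<Longrightarrow> norm (((f ^^ p) z - (f ^^ p) ?a) / (z - ?a)) < 1/2"
    unfolding eventually_at by auto
  define \<delta> where "\<delta> = \<delta>0 / 2"
  have \<delta>: "\<delta> > 0" using \<delta>0 by (simp add: \<delta>_def)
  have contract: "dist ((f ^^ p) z) ?a \<le> \<delta> / 2" if z: "z \<in> cball ?a \<delta>" for z
  proof (cases "z = ?a")
    case True then show ?thesis using p \<delta> by simp
  next
    case False
    have "dist z ?a < \<delta>0" using z \<delta>0(1) by (simp add: \<delta>_def dist_commute)
    from \<delta>0(2)[OF False this] have "dist ((f ^^ p) z) ?a \<le> 1/2 * dist z ?a"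
      using False p by (simp add: norm_divide dist_norm field_simps)
    then show ?thesis using z by (simp add: dist_commute)
  qed
  have "uniformly_continuous_on (cball 0 d \<times> cball ?a \<delta>) (\<lambda>(t, z). (cubic (\<gamma> t) ^^ p) z)"
    by (intro compact_uniformly_continuous continuous_on_subset[OF continuous_iterate_family[OF \<gamma>_cont]] compact_Times) auto
  then obtain d1 where d1: "d1 > 0" "\<And>y y'. y \<in> cball 0 d \<times> cball ?a \<delta> \<Longrightarrow> y' \<in> cball 0 d \<times> cball ?a \<delta> \<Longrightarrow>
      dist y' y < d1 \<Longrightarrow> dist ((\<lambda>(t, z). (cubic (\<gamma> t) ^^ p) z) y') ((\<lambda>(t, z). (cubic (\<gamma> t) ^^ p) z) y) < \<delta> / 2"
    unfolding uniformly_continuous_on_def using \<delta> by (metis half_gt_zero)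
  have "cball ?a \<delta> \<subseteq> filled_julia (\<gamma> t)" if t: "norm t < min d d1" for t
  proof
    fix z assume z: "z \<in> cball ?a \<delta>"
    have inv: "(cubic (\<gamma> t) ^^ p) y \<in> cball ?a \<delta>" if y: "y \<in> cball ?a \<delta>" for y
    proof -
      have "dist ((\<lambda>(t, z). (cubic (\<gamma> t) ^^ p) z) (t, y)) ((\<lambda>(t, z). (cubic (\<gamma> t) ^^ p) z) (0, y)) < \<delta> / 2"
        using t d y by (intro d1(2)) (auto simp: dist_Pair_Pair)
      then have "dist ((cubic (\<gamma> t) ^^ p) y) ((f ^^ p) y) < \<delta> / 2" by (simp add: \<gamma>0)
      then show ?thesis
        using contract[OF y] dist_triangle[of ?a "(cubic (\<gamma> t) ^^ p) y" "(f ^^ p) y"] by (simp add: dist_commute)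
    qed
    have stay: "(cubic (\<gamma> t) ^^ (k * p)) z \<in> cball ?a \<delta>" for k
      by (induction k) (use z inv in \<open>simp_all add: funpow_add\<close>)
    show "z \<in> filled_julia (\<gamma> t)"
    proof (rule ccontr)
      assume "z \<notin> filled_julia (\<gamma> t)"
      from filterlim_at_infinity_imp_norm_at_top[OF escape_at_infinity[OF this]]
      have "\<forall>\<^sub>F n in sequentially. norm ((cubic (\<gamma> t) ^^ n) z) \<ge> norm ?a + \<delta> + 1"
        unfolding filterlim_at_top by blast
      then obtain N where N: "\<And>n. n \<ge> N \<Longrightarrow> norm ((cubic (\<gamma> t) ^^ n) z) \<ge> norm ?a + \<delta> + 1"
        unfolding eventually_sequentially by blast
      have "N * p \<ge> N" using p(1) by simp
      from N[OF this] stay[of N] show False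
        using norm_triangle_sub[of "(cubic (\<gamma> t) ^^ (N * p)) z" ?a] by (simp add: dist_norm norm_minus_commute)
    qed
  qed
  then show ?thesis using that[of \<delta> "min d d1"] \<delta> d d1 by auto
qed

text \<open>
  Upper semicontinuity of the filled Julia set: its points obey the closed conditions of staying in one
  common disc.
\<close>

lemma upper_limit:
  assumes T: "T \<longlonglongrightarrow> 0" and Z: "Z \<longlonglongrightarrow> z"
    and freq: "\<exists>\<^sub>F k in sequentially. Z k \<in> filled_julia (\<gamma> (T k))"
  shows "z \<in> filled_julia F"
proof -
  define R' where "R' = 3 * (B' + 1)"
  have "norm ((f ^^ n) z) \<le> R'" for n
  proof (rule ccontr)
    assume "\<not> ?thesis"
    then have "\<forall>\<^sub>F k in sequentially. norm ((cubic (\<gamma> (T k)) ^^ n) (Z k)) > R'"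
      using order_tendstoD(1)[OF tendsto_norm[OF iterate_tendsto[OF T Z, of n]]] by simp
    moreover have "\<forall>\<^sub>F k in sequentially. dist (T k) 0 < d" using tendstoD[OF T d] .
    ultimately have "\<forall>\<^sub>F k in sequentially. Z k \<notin> filled_julia (\<gamma> (T k))"
    proof eventually_elim
      case (elim k)
      then have "norm (fst (\<gamma> (T k))) + norm (snd (\<gamma> (T k))) \<le> B'" by (intro bound) simp
      from filled_julia_iff_bounded_by[OF this, of "Z k"] elim show ?case by (auto simp: R'_def not_le)
    qed
    then show False using freq by (simp add: frequently_def)
  qed
  then have "bounded (range (\<lambda>n. (f ^^ n) z))" unfolding bounded_iff by auto
  then show ?thesis by (simp add: filled_julia_def)
qed

text \<open>
  Near a point \<open>w\<close> where \<open>\<phi>\<close> takes a value in the filled Julia set there is, as the basin is dense and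
  \<open>\<phi>\<close> is open, a point \<open>w'\<close> whose value is in the basin. That is an open condition which persists
  for the nearby maps and nearby values.
\<close>

lemma lower_limit:
  assumes \<phi>: "\<phi> holomorphic_on UNIV" "\<not> \<phi> constant_on UNIV"
    and TZ: "\<And>w. (\<lambda>k. T k w) \<longlonglongrightarrow> 0" "\<And>w. (\<lambda>k. Z k w) \<longlonglongrightarrow> \<phi> w"
    and w: "\<phi> w \<in> filled_julia F" "e > 0"
  shows "\<exists>w'\<in>ball w e. \<forall>\<^sub>F k in sequentially. Z k w' \<in> filled_julia (\<gamma> (T k w'))"
proof -
  obtain \<delta> d' where \<delta>: "\<delta> > 0" "d' > 0" "\<And>t. norm t < d' \<Longrightarrow> cball (fst F) \<delta> \<subseteq> filled_julia (\<gamma> t)"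
    using persistent_basin by blast
  have "open (\<phi> ` ball w e)"
    by (rule open_mapping_thm[OF \<phi>(1) open_UNIV connected_UNIV open_ball subset_UNIV \<phi>(2)])
  moreover have "\<phi> w \<in> \<phi> ` ball w e" using w(2) by simp
  ultimately obtain e' where e': "e' > 0" "ball (\<phi> w) e' \<subseteq> \<phi> ` ball w e" by (rule openE)
  obtain u j where u: "u \<in> ball (\<phi> w) e'" "(f ^^ j) u \<in> ball (fst F) \<delta>"
    using basin_dense[OF w(1) e'(1) \<delta>(1)] by blast
  then obtain w' where w': "w' \<in> ball w e" "u = \<phi> w'" using e'(2) by blast
  have "(\<lambda>k. (cubic (\<gamma> (T k w')) ^^ j) (Z k w')) \<longlonglongrightarrow> (f ^^ j) (\<phi> w')"
    by (rule iterate_tendsto[OF TZ])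
  then have "\<forall>\<^sub>F k in sequentially. (cubic (\<gamma> (T k w')) ^^ j) (Z k w') \<in> ball (fst F) \<delta>"
    using u(2) w'(2) by (intro topological_tendstoD) auto
  moreover have "\<forall>\<^sub>F k in sequentially. dist (T k w') 0 < d'" using tendstoD[OF TZ(1) \<delta>(2)] .
  ultimately have "\<forall>\<^sub>F k in sequentially. Z k w' \<in> filled_julia (\<gamma> (T k w'))"
  proof eventually_elim
    case (elim k)
    then have "(cubic (\<gamma> (T k w')) ^^ j) (Z k w') \<in> filled_julia (\<gamma> (T k w'))" using \<delta>(3)[of "T k w'"] by auto
    then show ?case by (simp add: filled_julia_iterate)
  qed
  then show ?thesis using w'(1) by blast
qed

end

section \<open>First variations and second-order expansions\<close>

text \<open>
  The derivative of the \<open>n\<close>-th point of an orbit when \<open>a\<close>, \<open>v\<close> and the starting point \<open>z\<close> move with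
  velocities \<open>a'\<close>, \<open>v'\<close> and \<open>z'\<close>.
\<close>

primrec first_variation :: "complex \<times> complex \<Rightarrow> complex \<Rightarrow> complex \<Rightarrow> complex \<Rightarrow> complex \<Rightarrow> nat \<Rightarrow> complex" where
  "first_variation F a' v' z z' 0 = z'"
| "first_variation F a' v' z z' (Suc n) = 3 * (((cubic F ^^ n) z)\<^sup>2 - (fst F)\<^sup>2) * first_variation F a' v' z z' n
     + 6 * fst F * (fst F - (cubic F ^^ n) z) * a' + v'"

lemma has_field_derivative_iterate_family:
  assumes A: "((\<lambda>s. fst (\<gamma> s)) has_field_derivative a') (at s0)"
    and V: "((\<lambda>s. snd (\<gamma> s)) has_field_derivative v') (at s0)"
    and w: "(w has_field_derivative z') (at s0)"
  shows "((\<lambda>s. (cubic (\<gamma> s) ^^ n) (w s)) has_field_derivative first_variation (\<gamma> s0) a' v' (w s0) z' n) (at s0)"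
proof (induction n)
  case 0 then show ?case using w by simp
next
  case (Suc n)
  define g where "g s = (cubic (\<gamma> s) ^^ n) (w s)" for s
  have g: "(g has_field_derivative first_variation (\<gamma> s0) a' v' (w s0) z' n) (at s0)"
    using Suc by (simp add: g_def[abs_def])
  have "((\<lambda>s. g s ^ 3 - 3 * (fst (\<gamma> s))\<^sup>2 * g s + (2 * fst (\<gamma> s) ^ 3 + snd (\<gamma> s)))
      has_field_derivative first_variation (\<gamma> s0) a' v' (w s0) z' (Suc n)) (at s0)"
    by (rule derivative_eq_intros A V g refl)+ (simp add: g_def algebra_simps power2_eq_square)
  then show ?case by (simp add: cubic_def[abs_def] g_def[abs_def])
qed

lemma first_variation_affine: "first_variation F a' v' z z' n = first_variation F a' v' z 0 n + iterate_deriv F n z * z'"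
  by (induction n) (simp_all add: algebra_simps)

lemma first_variation_add: "first_variation F a' v' z z' (l + n) = first_variation F a' v' ((cubic F ^^ l) z) (first_variation F a' v' z z' l) n"
proof (induction n)
  case (Suc n)
  have "(cubic F ^^ (l + n)) z = (cubic F ^^ n) ((cubic F ^^ l) z)"
    unfolding add.commute[of l] funpow_add by simp
  then show ?case using Suc by simp
qed simp

text \<open>
  \<open>h t e = c + \<beta> t + lam e\<close> up to a quadratic error near \<open>(0, 0)\<close>. Differentiability alone would not
  suffice for \<open>near_linear_orbit\<close>, where the errors of about \<open>k\<close> steps have to remain summable.
\<close>

definition second_order :: "(complex \<Rightarrow> complex \<Rightarrow> complex) \<Rightarrow> complex \<Rightarrow> complex \<Rightarrow> complex \<Rightarrow> bool" where
  "second_order h c \<beta> lam \<longleftrightarrow> (\<exists>C \<delta>. \<delta> > 0 \<and> C \<ge> 0 \<and> (\<forall>t e. norm t < \<delta> \<longrightarrow> norm e < \<delta> \<longrightarrow>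
     norm (h t e - c - \<beta> * t - lam * e) \<le> C * (norm t + norm e)\<^sup>2))"

lemma second_orderI:
  assumes "\<delta> > 0" "\<And>t e. norm t < \<delta> \<Longrightarrow> norm e < \<delta> \<Longrightarrow> norm (h t e - c - \<beta> * t - lam * e) \<le> C * (norm t + norm e)\<^sup>2"
  shows "second_order h c \<beta> lam"
proof -
  have "norm (h t e - c - \<beta> * t - lam * e) \<le> \<bar>C\<bar> * (norm t + norm e)\<^sup>2" if "norm t < \<delta>" "norm e < \<delta>" for t e
  proof -
    have "C * (norm t + norm e)\<^sup>2 \<le> \<bar>C\<bar> * (norm t + norm e)\<^sup>2" by (intro mult_right_mono) auto
    then show ?thesis using assms(2)[OF that] by linarith
  qed
  then show ?thesis unfolding second_order_def using assms(1) abs_ge_zero by blast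
qed

lemma second_order_add:
  assumes "second_order h c \<beta> l" "second_order h' c' \<beta>' l'"
  shows "second_order (\<lambda>t e. h t e + h' t e) (c + c') (\<beta> + \<beta>') (l + l')"
proof -
  obtain C \<delta> C' \<delta>' where 1: "\<delta> > 0" "\<And>t e. norm t < \<delta> \<Longrightarrow> norm e < \<delta> \<Longrightarrow> norm (h t e - c - \<beta> * t - l * e) \<le> C * (norm t + norm e)\<^sup>2"
    and 2: "\<delta>' > 0" "\<And>t e. norm t < \<delta>' \<Longrightarrow> norm e < \<delta>' \<Longrightarrow> norm (h' t e - c' - \<beta>' * t - l' * e) \<le> C' * (norm t + norm e)\<^sup>2"
    using assms unfolding second_order_def by blast
  show ?thesis
  proof (rule second_orderI[of "min \<delta> \<delta>'" _ _ _ _ "C + C'"])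
    fix t e :: complex assume te: "norm t < min \<delta> \<delta>'" "norm e < min \<delta> \<delta>'"
    have eq: "h t e + h' t e - (c + c') - (\<beta> + \<beta>') * t - (l + l') * e =
        (h t e - c - \<beta> * t - l * e) + (h' t e - c' - \<beta>' * t - l' * e)" by (simp add: algebra_simps)
    show "norm (h t e + h' t e - (c + c') - (\<beta> + \<beta>') * t - (l + l') * e) \<le> (C + C') * (norm t + norm e)\<^sup>2"
      unfolding eq
      using norm_triangle_ineq[of "h t e - c - \<beta> * t - l * e" "h' t e - c' - \<beta>' * t - l' * e"]
        1(2)[of t e] 2(2)[of t e] te by (simp add: distrib_right[of C])
  qed (use 1 2 in auto)
qed

lemma second_order_mult:
  assumes "second_order h c \<beta> l" "second_order h' c' \<beta>' l'"
  shows "second_order (\<lambda>t e. h t e * h' t e) (c * c') (c * \<beta>' + c' * \<beta>) (c * l' + c' * l)"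
proof -
  obtain C \<delta> C' \<delta>' where 1: "\<delta> > 0" "C \<ge> 0" "\<And>t e. norm t < \<delta> \<Longrightarrow> norm e < \<delta> \<Longrightarrow> norm (h t e - c - \<beta> * t - l * e) \<le> C * (norm t + norm e)\<^sup>2"
    and 2: "\<delta>' > 0" "C' \<ge> 0" "\<And>t e. norm t < \<delta>' \<Longrightarrow> norm e < \<delta>' \<Longrightarrow> norm (h' t e - c' - \<beta>' * t - l' * e) \<le> C' * (norm t + norm e)\<^sup>2"
    using assms unfolding second_order_def by blast
  define M where "M = norm \<beta> + norm l"
  define M' where "M' = norm \<beta>' + norm l'"
  have M: "M \<ge> 0" "M' \<ge> 0" by (auto simp: M_def M'_def)
  have lin: "norm (\<beta> * t + l * e) \<le> (norm \<beta> + norm l) * (norm t + norm e)" for \<beta> l t e :: complex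
  proof -
    have "norm (\<beta> * t + l * e) \<le> norm \<beta> * norm t + norm l * norm e"
      by (rule order_trans[OF norm_triangle_ineq]) (simp add: norm_mult)
    also have "\<dots> \<le> (norm \<beta> + norm l) * (norm t + norm e)" by (simp add: algebra_simps)
    finally show ?thesis .
  qed
  define K where "K = M * M' + C * (norm c' + M' + C') + (norm c + M) * C'"
  show ?thesis
  proof (rule second_orderI[of "min (min \<delta> \<delta>') (1/2)" _ _ _ _ K])
    fix t e :: complex assume te: "norm t < min (min \<delta> \<delta>') (1/2)" "norm e < min (min \<delta> \<delta>') (1/2)"
    define s where "s = norm t + norm e"
    have s: "0 \<le> s" "s \<le> 1" using te by (auto simp: s_def)
    then have s2: "s\<^sup>2 \<le> 1" "s\<^sup>2 \<ge> 0" by (auto simp: power_le_one)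
    define L L' Q Q' where "L = \<beta> * t + l * e" and "L' = \<beta>' * t + l' * e"
      and "Q = h t e - c - L" and "Q' = h' t e - c' - L'"
    have L: "norm L \<le> M * s" "norm L' \<le> M' * s" unfolding L_def L'_def M_def M'_def s_def by (rule lin)+
    have Q: "norm Q \<le> C * s\<^sup>2" "norm Q' \<le> C' * s\<^sup>2"
      using 1(3)[of t e] 2(3)[of t e] te by (auto simp: Q_def Q'_def L_def L'_def s_def diff_diff_eq add.assoc)
    have "M * s \<le> M * 1" "M' * s \<le> M' * 1" "C' * s\<^sup>2 \<le> C' * 1" 
      using mult_left_mono[OF s(2) M(1)] mult_left_mono[OF s(2) M(2)] mult_left_mono[OF s2(1) 2(2)] by auto
    then have L1: "norm L \<le> M" "norm L' \<le> M'" "norm Q' \<le> C'" using L Q by auto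
    have eq: "h t e * h' t e - c * c' - (c * \<beta>' + c' * \<beta>) * t - (c * l' + c' * l) * e
        = L * L' + Q * (c' + L' + Q') + (c + L) * Q'"
      by (simp add: Q_def Q'_def L_def L'_def algebra_simps)
    have "norm (c' + L' + Q') \<le> norm c' + M' + C'"
      using norm_triangle_ineq[of "c' + L'" Q'] norm_triangle_ineq[of c' L'] L1 by linarith
    then have "norm (Q * (c' + L' + Q')) \<le> (C * s\<^sup>2) * (norm c' + M' + C')"
      unfolding norm_mult using Q 1(2) s2 by (intro mult_mono) auto
    moreover have "norm (L * L') \<le> (M * s) * (M' * s)"
      unfolding norm_mult using L M s by (intro mult_mono) auto
    moreover have "norm (c + L) \<le> norm c + M" using norm_triangle_ineq[of c L] L1 by linarith
    then have "norm ((c + L) * Q') \<le> (norm c + M) * (C' * s\<^sup>2)"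
      unfolding norm_mult using Q M by (intro mult_mono) auto
    ultimately have "norm (L * L' + Q * (c' + L' + Q') + (c + L) * Q')
        \<le> (M * s) * (M' * s) + (C * s\<^sup>2) * (norm c' + M' + C') + (norm c + M) * (C' * s\<^sup>2)"
      by (intro order_trans[OF norm_triangle_ineq] add_mono)
    also have "\<dots> = K * s\<^sup>2" by (simp add: K_def algebra_simps power2_eq_square)
    finally show "norm (h t e * h' t e - c * c' - (c * \<beta>' + c' * \<beta>) * t - (c * l' + c' * l) * e) \<le> K * (norm t + norm e)\<^sup>2"
      unfolding eq s_def .
  qed (use 1 2 in auto)
qed

lemma second_order_const: "second_order (\<lambda>t e. c) c 0 0"
  by (rule second_orderI[of 1 _ _ _ _ 0]) auto

lemma second_order_shift: "second_order (\<lambda>t e. c + e) c 0 1"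
  by (rule second_orderI[of 1 _ _ _ _ 0]) auto

lemma second_order_holomorphic:
  assumes g: "g holomorphic_on ball 0 d" "d > 0" and g': "(g has_field_derivative g') (at 0)"
  shows "second_order (\<lambda>t e. g t) (g 0) g' 0"
proof -
  define h where "h z = (if z = 0 then deriv g 0 else (g z - g 0) / (z - 0))" for z
  have h: "h holomorphic_on ball 0 d" using pole_lemma_open[OF g(1) open_ball, of 0] by (simp only: h_def[abs_def])
  define r where "r = d / 4"
  have r: "r > 0" using g by (simp add: r_def)
  have "bounded (h ` cball 0 (2 * r))"
    using g(2) by (intro compact_imp_bounded compact_continuous_image holomorphic_on_imp_continuous_on
        holomorphic_on_subset[OF h]) (auto simp: r_def)
  then obtain R where R: "\<And>z. z \<in> cball 0 (2 * r) \<Longrightarrow> norm (h z) \<le> R" unfolding bounded_iff by blast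
  have h2: "h holomorphic_on ball 0 (2 * r)" using g(2) by (intro holomorphic_on_subset[OF h]) (auto simp: r_def)
  have h0: "h 0 = g'" using DERIV_imp_deriv[OF g'] by (simp add: h_def)
  show ?thesis
  proof (rule second_orderI[of r _ _ _ _ "2 * \<bar>R\<bar> / r"])
    fix t e :: complex assume t: "norm t < r"
    have "norm (h t - h 0) \<le> (2 * R / r) * norm (t - 0)"
      by (rule holomorphic_bounded_lipschitz[OF h2 R r]) (use t r in auto)
    also have "\<dots> \<le> (2 * \<bar>R\<bar> / r) * norm t"
      using r by (simp add: mult_right_mono divide_right_mono)
    finally have "norm (h t - g') * norm t \<le> (2 * \<bar>R\<bar> / r) * norm t * norm t"
      unfolding h0 by (rule mult_right_mono) simp
    moreover have "g t - g 0 - g' * t - 0 * e = (h t - g') * t"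
      by (cases "t = 0") (simp_all add: h_def left_diff_distrib[of _ g'])
    ultimately have "norm (g t - g 0 - g' * t - 0 * e) \<le> (2 * \<bar>R\<bar> / r) * (norm t)\<^sup>2"
      by (simp add: norm_mult power2_eq_square mult.assoc)
    also have "\<dots> \<le> (2 * \<bar>R\<bar> / r) * (norm t + norm e)\<^sup>2" using r by (intro mult_left_mono power_mono) auto
    finally show "norm (g t - g 0 - g' * t - 0 * e) \<le> (2 * \<bar>R\<bar> / r) * (norm t + norm e)\<^sup>2" .
  qed (rule r)
qed

lemma second_order_cong:
  "second_order h c b l \<Longrightarrow> (\<And>t e. h t e = h' t e) \<Longrightarrow> c = c' \<Longrightarrow> b = b' \<Longrightarrow> l = l' \<Longrightarrow> second_order h' c' b' l'"
  by (simp add: second_order_def)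

lemma second_order_cubic:
  assumes A: "second_order (\<lambda>t e. fst (\<gamma> t)) (fst F) a' 0" and V: "second_order (\<lambda>t e. snd (\<gamma> t)) (snd F) v' 0"
    and h: "second_order h c b l"
  shows "second_order (\<lambda>t e. cubic (\<gamma> t) (h t e)) (cubic F c)
    (3 * (c\<^sup>2 - (fst F)\<^sup>2) * b + 6 * fst F * (fst F - c) * a' + v') (3 * (c\<^sup>2 - (fst F)\<^sup>2) * l)"
proof -
  note h3 = second_order_mult[OF second_order_mult[OF h h] h]
  note A2 = second_order_mult[OF A A]
  note lin = second_order_mult[OF second_order_mult[OF second_order_const[of "- 3"] A2] h]
  note A3 = second_order_mult[OF second_order_const[of 2] second_order_mult[OF A2 A]]
  note all = second_order_add[OF second_order_add[OF h3 lin] second_order_add[OF A3 V]]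
  show ?thesis
    by (rule second_order_cong[OF all])
      (simp_all add: cubic_def algebra_simps power2_eq_square power3_eq_cube)
qed

lemma second_order_iterate:
  assumes A: "second_order (\<lambda>t e. fst (\<gamma> t)) (fst F) a' 0" and V: "second_order (\<lambda>t e. snd (\<gamma> t)) (snd F) v' 0"
  shows "second_order (\<lambda>t e. (cubic (\<gamma> t) ^^ n) (z + e)) ((cubic F ^^ n) z) (first_variation F a' v' z 0 n) (iterate_deriv F n z)"
proof (induction n)
  case 0 then show ?case using second_order_shift[of z] by simp
next
  case (Suc n)
  then show ?case using second_order_cubic[OF A V Suc] by simp
qed

text \<open>
  One-parameter families through \<open>F\<close>. Both sides of the main theorem are instances: the constant
  family with a moving starting point, and the local parametrization of the period-\<open>p\<close> curve.
\<close>

locale misiurewicz_holomorphic_family = misiurewicz_family +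
  fixes a' v' :: complex
  assumes A_hol: "(\<lambda>t. fst (\<gamma> t)) holomorphic_on ball 0 d" and V_hol: "(\<lambda>t. snd (\<gamma> t)) holomorphic_on ball 0 d"
    and A': "((\<lambda>t. fst (\<gamma> t)) has_field_derivative a') (at 0)"
    and V': "((\<lambda>t. snd (\<gamma> t)) has_field_derivative v') (at 0)"
begin

text \<open>
  The condition on \<open>\<kappa>\<close> says that \<open>\<kappa> (lam - 1)\<close> is the derivative at 0 of the difference of the
  \<open>(l + m)\<close>-th and the \<open>l\<close>-th orbit point, which measures the speed of the \<open>l\<close>-th point relative to the
  moving repelling point.
\<close>

lemma rescaled_orbit_limit:
  assumes start: "(s has_field_derivative s') (at 0)" "(cubic F ^^ l) (s 0) = a0"
    and \<kappa>: "\<kappa> * (iterate_deriv F m a0 - 1) = first_variation F a' v' (s 0) s' (l + m) - first_variation F a' v' (s 0) s' l"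
      "\<kappa> \<noteq> 0"
    and \<phi>: "\<And>W. uniform_limit (cball 0 W) (\<lambda>N w. ((cubic F ^^ m) ^^ N) (a0 + w / iterate_deriv F m a0 ^ N)) \<phi> sequentially"
      "continuous_on UNIV \<phi>"
    and w: "w \<longlonglongrightarrow> w0"
  shows "(\<lambda>k. (cubic (\<gamma> (w k / (\<kappa> * iterate_deriv F m a0 ^ k))) ^^ (m * k + l)) (s (w k / (\<kappa> * iterate_deriv F m a0 ^ k)))) \<longlonglongrightarrow> \<phi> w0"
proof -
  define lam where "lam = iterate_deriv F m a0"
  define x where "x t = (cubic (\<gamma> t) ^^ l) (s t)" for t
  define g where "g t = cubic (\<gamma> t) ^^ m" for t
  define \<beta> where "\<beta> = first_variation F a' v' a0 0 m"
  define x' where "x' = first_variation F a' v' (s 0) s' l"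
  have lam: "norm lam > 1" using repelling by (simp add: lam_def)
  then have lam1: "lam - 1 \<noteq> 0" by auto
  have SA: "second_order (\<lambda>t e. fst (\<gamma> t)) (fst F) a' 0" using second_order_holomorphic[OF A_hol d A'] by (simp add: \<gamma>0)
  have SV: "second_order (\<lambda>t e. snd (\<gamma> t)) (snd F) v' 0" using second_order_holomorphic[OF V_hol d V'] by (simp add: \<gamma>0)
  from second_order_iterate[OF SA SV, of m a0]
  obtain C \<delta> where C: "\<delta> > 0" "C \<ge> 0" "\<And>t e. norm t < \<delta> \<Longrightarrow> norm e < \<delta> \<Longrightarrow>
      norm (g t (a0 + e) - a0 - \<beta> * t - lam * e) \<le> C * (norm t + norm e)\<^sup>2"
    unfolding second_order_def g_def \<beta>_def lam_def using a0(3) by auto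
  have quad: "norm (g t (a0 + e) - a0 - lam * e - \<beta> * t) \<le> (2 * C) * ((norm t)\<^sup>2 + (norm e)\<^sup>2)"
    if te: "norm t < \<delta>" "norm e < \<delta>" for t e
  proof -
    have "(norm t + norm e)\<^sup>2 \<le> 2 * ((norm t)\<^sup>2 + (norm e)\<^sup>2)"
      using zero_le_power2[of "norm t - norm e"] by (simp add: power2_eq_square algebra_simps)
    then have "C * (norm t + norm e)\<^sup>2 \<le> C * (2 * ((norm t)\<^sup>2 + (norm e)\<^sup>2))" using C(2) by (rule mult_left_mono)
    then show ?thesis using C(3)[OF te] by (simp add: algebra_simps)
  qed
  have x0: "x 0 = a0" using start by (simp add: x_def \<gamma>0)
  have xd: "(x has_field_derivative x') (at 0)"
    using has_field_derivative_iterate_family[OF A' V' start(1), of l] by (simp add: x_def[abs_def] x'_def \<gamma>0)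
  have "\<kappa> * (lam - 1) = x' * (lam - 1) + \<beta>"
    using \<kappa>(1) first_variation_add[of F a' v' "s 0" s' l m] first_variation_affine[of F a' v' a0 x' m]
    unfolding start(2) by (simp add: lam_def \<beta>_def x'_def algebra_simps)
  then have \<kappa>': "\<kappa> = x' + \<beta> / (lam - 1)" using lam1 by (simp add: field_simps)
  have iter: "(g t ^^ N) = cubic (\<gamma> t) ^^ (m * N)" for t N
    by (simp add: g_def funpow_mult mult.commute)
  have cont: "continuous_on (cball 0 d \<times> UNIV) (\<lambda>(t, z). (g t ^^ N) z)" for N
    unfolding iter by (rule continuous_iterate_family[OF \<gamma>_cont])
  have "(\<lambda>k. (g (w k / (\<kappa> * lam ^ k)) ^^ k) (x (w k / (\<kappa> * lam ^ k)))) \<longlonglongrightarrow> \<phi> w0"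
  proof (rule perturbed_orbit_limit[OF lam C(1) quad x0 xd \<kappa>' \<kappa>(2) d cont _ \<phi>(2) w])
    show "uniform_limit (cball 0 W) (\<lambda>N w. (g 0 ^^ N) (a0 + w / lam ^ N)) \<phi> sequentially" for W
      using \<phi>(1) by (simp add: g_def \<gamma>0 lam_def)
  qed
  then show ?thesis unfolding iter x_def lam_def by (simp add: funpow_add)
qed

end

section \<open>Similarity at a Misiurewicz map\<close>

lemma (in misiurewicz_map) cycle_avoids_critical_points:
  "(f ^^ j) a0 \<noteq> fst F" "(f ^^ j) a0 \<noteq> - fst F"
proof -
  have "\<not> ((f ^^ j) a0 = fst F \<or> (f ^^ j) a0 = - fst F)"
  proof
    assume h: "(f ^^ j) a0 = fst F \<or> (f ^^ j) a0 = - fst F"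
    have "(f ^^ (j mod m)) a0 = (f ^^ j) a0" by (rule funpow_mod_eq[OF a0(3)])
    moreover have "j mod m < m" using a0(2) by simp
    ultimately have "iterate_deriv F m a0 = 0"
      using h iterate_deriv_eq_0_iff[of F m a0] by metis
    then show False using repelling by simp
  qed
  then show "(f ^^ j) a0 \<noteq> fst F" "(f ^^ j) a0 \<noteq> - fst F" by auto
qed

text \<open>
  A free critical orbit that met a critical point again would do so infinitely often, hence also on the
  repelling cycle.
\<close>

lemma (in misiurewicz_map) free_orbit_avoids_critical_points:
  shows "(f ^^ n) (- fst F) \<noteq> fst F" "n \<ge> 1 \<Longrightarrow> (f ^^ n) (- fst F) \<noteq> - fst F"
proof -
  have tail: "\<exists>j. (f ^^ k) (- fst F) = (f ^^ j) a0" if "k \<ge> l" for k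
  proof -
    have "(f ^^ (k - l + l)) (- fst F) = (f ^^ (k - l)) a0" using a0(1) by (simp only: funpow_add o_apply)
    then show ?thesis using that by auto
  qed
  show "(f ^^ n) (- fst F) \<noteq> fst F"
  proof
    assume h: "(f ^^ n) (- fst F) = fst F"
    have "(f ^^ (l * p + n)) (- fst F) = (f ^^ (l * p)) (fst F)" using h by (simp only: funpow_add o_apply)
    also have "\<dots> = fst F" using p(2) by (rule funpow_mult_fixed)
    finally have "(f ^^ (l * p + n)) (- fst F) = fst F" .
    moreover have "l * p + n \<ge> l" using p(1) by (simp add: trans_le_add1)
    ultimately show False using tail cycle_avoids_critical_points(1) by metis
  qed
  show "(f ^^ n) (- fst F) \<noteq> - fst F" if "n \<ge> 1"
  proof
    assume h: "(f ^^ n) (- fst F) = - fst F"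
    then have "(f ^^ (l * n)) (- fst F) = - fst F" by (rule funpow_mult_fixed)
    moreover have "l * n \<ge> l" using that by simp
    ultimately show False using tail cycle_avoids_critical_points(2) by metis
  qed
qed

lemma connectedness_locus_iff:
  assumes "G \<in> period_curve p"
  shows "G \<in> connectedness_locus p \<longleftrightarrow> - fst G \<in> filled_julia G"
proof -
  have "fst G \<in> filled_julia G"
    using assms periodic_in_filled_julia[of p G "fst G"] by (auto simp: period_curve_def has_min_period_def)
  then have "connected (filled_julia G) \<longleftrightarrow> - fst G \<in> filled_julia G"
    using connected_filled_juliaI[of G] free_critical_point_in_connected_filled_julia[of G] by blast
  then show ?thesis using assms by (simp add: connectedness_locus_def)
qed

lemma rescale_eq:
  assumes "c \<noteq> 0" shows "rescale c A z0 = {w. z0 + w / c \<in> A}"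
proof (intro set_eqI iffI)
  fix w assume "w \<in> {w. z0 + w / c \<in> A}"
  then show "w \<in> rescale c A z0"
    unfolding rescale_def using assms by (intro image_eqI[of _ _ "z0 + w / c"]) auto
qed (use assms in \<open>auto simp: rescale_def\<close>)

lemma (in misiurewicz_family) closed_free_critical_point_bounded:
  "closed {t \<in> cball 0 d. - fst (\<gamma> t) \<in> filled_julia (\<gamma> t)}"
proof -
  define R' where "R' = 3 * (B' + 1)"
  have "{t \<in> cball 0 d. - fst (\<gamma> t) \<in> filled_julia (\<gamma> t)}
      = (\<Inter>n. {t \<in> cball 0 d. norm ((cubic (\<gamma> t) ^^ n) (- fst (\<gamma> t))) \<le> R'})"
    using filled_julia_iff_bounded_by[OF bound] by (auto simp: R'_def)
  moreover have "closed {t \<in> cball 0 d. norm ((cubic (\<gamma> t) ^^ n) (- fst (\<gamma> t))) \<le> R'}" for n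
  proof (rule continuous_on_closed_Collect_le)
    have "continuous_on (cball 0 d) (\<lambda>t. (\<lambda>(t, z). (cubic (\<gamma> t) ^^ n) z) (t, - fst (\<gamma> t)))"
      by (rule continuous_on_compose2[OF continuous_iterate_family[OF \<gamma>_cont]])
        (auto intro!: continuous_intros \<gamma>_cont)
    then show "continuous_on (cball 0 d) (\<lambda>t. norm ((cubic (\<gamma> t) ^^ n) (- fst (\<gamma> t))))"
      by (simp add: continuous_on_norm)
  qed auto
  ultimately show ?thesis by auto
qed

lemma scaled_parameter_tendsto_0:
  fixes w :: "nat \<Rightarrow> complex"
  assumes "norm lam > 1" "w \<longlonglongrightarrow> w0"
  shows "(\<lambda>k. w k / (\<kappa> * lam ^ k)) \<longlonglongrightarrow> 0"
proof -
  have "(\<lambda>k. inverse (lam ^ k)) \<longlonglongrightarrow> 0"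
    using LIMSEQ_inverse_realpow_zero[OF assms(1)] tendsto_norm_zero_iff[of "\<lambda>k. inverse (lam ^ k)"]
    by (simp add: norm_inverse norm_power)
  then have "(\<lambda>k. w k * inverse \<kappa> * inverse (lam ^ k)) \<longlonglongrightarrow> w0 * inverse \<kappa> * 0"
    by (intro tendsto_intros assms)
  then show ?thesis by (simp add: divide_inverse mult.assoc)
qed

theorem theorem1:
  fixes p :: nat and F :: "complex \<times> complex"
    and U :: "complex set" and \<gamma> :: "complex \<Rightarrow> complex \<times> complex"
  assumes "p \<ge> 1"
    and "F \<in> period_curve p"
    and "misiurewicz p F"
    and "local_parametrization p F U \<gamma>"
  shows "\<exists>(\<phi> :: complex \<Rightarrow> complex) (\<rho> :: nat \<Rightarrow> complex) (q :: complex).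
           \<phi> holomorphic_on UNIV \<and> \<not> \<phi> constant_on UNIV \<and>
           (\<forall>k. \<rho> k \<noteq> 0) \<and> \<rho> \<longlonglongrightarrow> 0 \<and> q \<noteq> 0 \<and>
           (\<exists>R>0. \<forall>r>R.
              hausdorff_converges
                (\<lambda>k. truncate (rescale (inverse (\<rho> k)) (filled_julia F) (2 * fst F)) r)
                (truncate (\<phi> -` filled_julia F) r) \<and>
              hausdorff_converges
                (\<lambda>k. truncate (rescale (inverse (\<rho> k) * q)
                        {t \<in> U. \<gamma> t \<in> connectedness_locus p} 0) r)
                (truncate (\<phi> -` filled_julia F) r))"
proof -
  define a where "a = fst F"
  define v where "v = snd F"
  have F: "F = (a, v)" by (simp add: a_def v_def)
  have per: "(cubic F ^^ p) a = a" using assms(2) by (simp add: period_curve_def has_min_period_def a_def)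
  obtain l m a0 where lm: "l \<ge> 1" "(cubic F ^^ l) (- fst F) = a0" "(cubic F ^^ l) (2 * fst F) = a0"
      "m \<ge> 1" "(cubic F ^^ m) a0 = a0" "norm (iterate_deriv F m a0) > 1"
    using assms(3) unfolding misiurewicz_def has_min_period_def by (auto simp: deriv_iterate)
  interpret misiurewicz_map F p l m a0
    using assms(1) per lm by unfold_locales (auto simp: a_def)
  define lam where "lam = iterate_deriv F m a0"
  have lam: "norm lam > 1" using repelling by (simp add: lam_def)
  then have lam1: "lam - 1 \<noteq> 0" and lam0: "lam \<noteq> 0" by auto
  \<comment> \<open>The Hamiltonian velocity of the local parameter at \<open>F\<close>, in terms of first variations.\<close>
  define a' where "a' = first_variation F 0 1 a 0 p"
  define v' where "v' = 1 - first_variation F 1 0 a 1 p"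
  have par: "open U" "0 \<in> U" "\<gamma> 0 = F" "\<gamma> ` U \<subseteq> period_curve p"
    and dpar: "\<And>t. t \<in> U \<Longrightarrow> ((\<lambda>s. fst (\<gamma> s)) has_field_derivative deriv (\<lambda>v. eta p (fst (\<gamma> t)) v) (snd (\<gamma> t))) (at t)"
      "\<And>t. t \<in> U \<Longrightarrow> ((\<lambda>s. snd (\<gamma> s)) has_field_derivative - deriv (\<lambda>a. eta p a (snd (\<gamma> t))) (fst (\<gamma> t))) (at t)"
    using assms(4) openin_imp_subset unfolding local_parametrization_def by blast+
  have "((\<lambda>s. (cubic (a, s) ^^ p) a - a) has_field_derivative a' - 0) (at v)"
    unfolding a'_def F
    by (rule DERIV_diff[OF has_field_derivative_iterate_family[of "\<lambda>s. (a, s)" 0 v 1 "\<lambda>_. a" 0]]) auto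
  then have eta_v: "deriv (eta p a) v = a'" by (simp add: eta_def[abs_def] DERIV_imp_deriv)
  have "((\<lambda>s. (cubic (s, v) ^^ p) s - s) has_field_derivative first_variation F 1 0 a 1 p - 1) (at a)"
    unfolding F
    by (rule DERIV_diff[OF has_field_derivative_iterate_family[of "\<lambda>s. (s, v)" 1 a 0 "\<lambda>s. s" 1]]) auto
  then have eta_a: "deriv (\<lambda>a. eta p a v) a = - v'" by (simp add: eta_def v'_def DERIV_imp_deriv)
  have A': "((\<lambda>t. fst (\<gamma> t)) has_field_derivative a') (at 0)"
    and V': "((\<lambda>t. snd (\<gamma> t)) has_field_derivative v') (at 0)"
    using dpar[OF par(2)] eta_v eta_a by (auto simp: par(3) F)
  obtain d where d: "d > 0" "cball 0 d \<subseteq> U" using par(1,2) open_contains_cball by blast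
  have A_cont: "continuous_on U (\<lambda>t. fst (\<gamma> t))" "continuous_on U (\<lambda>t. snd (\<gamma> t))"
    using dpar by (meson DERIV_isCont continuous_at_imp_continuous_on)+
  have \<gamma>_cont: "continuous_on (cball 0 d) \<gamma>"
    using continuous_on_Pair[OF A_cont] d(2) continuous_on_subset by (simp add: continuous_on_subset)
  have hol: "(\<lambda>t. fst (\<gamma> t)) holomorphic_on ball 0 d" "(\<lambda>t. snd (\<gamma> t)) holomorphic_on ball 0 d"
  proof -
    have sub: "ball 0 d \<subseteq> U" using d(2) ball_subset_cball by blast
    show "(\<lambda>t. fst (\<gamma> t)) holomorphic_on ball 0 d" "(\<lambda>t. snd (\<gamma> t)) holomorphic_on ball 0 d"
      using dpar sub by (auto simp: holomorphic_on_open)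
  qed
  have "compact ((\<lambda>t. norm (fst (\<gamma> t)) + norm (snd (\<gamma> t))) ` cball 0 d)"
    by (intro compact_continuous_image continuous_intros \<gamma>_cont) auto
  then have "bounded ((\<lambda>t. norm (fst (\<gamma> t)) + norm (snd (\<gamma> t))) ` cball 0 d)" by (rule compact_imp_bounded)
  then obtain B' where B': "\<And>t. t \<in> cball 0 d \<Longrightarrow> \<bar>norm (fst (\<gamma> t)) + norm (snd (\<gamma> t))\<bar> \<le> B'"
    unfolding bounded_iff by (metis imageI real_norm_def)
  interpret par: misiurewicz_holomorphic_family F p l m a0 \<gamma> d B' a' v'
  proof unfold_locales
    show "norm (fst (\<gamma> t)) + norm (snd (\<gamma> t)) \<le> B'" if "t \<in> cball 0 d" for t
      using B'[OF that] by linarith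
  qed (fact d(1) \<gamma>_cont par(3) hol A' V')+
  interpret dyn: misiurewicz_holomorphic_family F p l m a0 "\<lambda>_. F" 1 "norm (fst F) + norm (snd F)" 0 0
    by unfold_locales auto
  define D where "D = first_variation F a' v' (- a) (- a')"
  \<comment> \<open>The magnification factors: \<open>\<kappa>2\<close> is nonzero by transversality, and \<open>\<kappa>1\<close> because the orbit from \<open>2 a\<close>
    to the repelling cycle contains no critical point.\<close>
  define \<kappa>2 where "\<kappa>2 = (D (l + m) - D l) / (lam - 1)"
  have "D (l + m) \<noteq> D l"
  proof (rule cubic_transversality[of "first_variation F 0 1 a 0" a v "first_variation F 1 0 a 1" D p m l])
    show "(cubic (a, v) ^^ (l + m)) (- a) = (cubic (a, v) ^^ l) (- a)"
      using a0(1,3) by (simp add: add.commute[of l] funpow_add F)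
    show "(cubic (a, v) ^^ n) (- a) \<noteq> a" for n
      using free_orbit_avoids_critical_points(1)[of n] by (simp add: F)
    show "(cubic (a, v) ^^ n) (- a) \<noteq> - a" if "n \<ge> 1" for n
      using free_orbit_avoids_critical_points(2)[OF that] by (simp add: F)
  qed (use assms(1) per lm(4) in \<open>simp_all add: D_def a'_def v'_def F\<close>)
  then have \<kappa>2: "\<kappa>2 \<noteq> 0" using lam1 by (simp add: \<kappa>2_def)
  define \<kappa>1 where "\<kappa>1 = iterate_deriv F l (2 * a)"
  have \<kappa>1: "\<kappa>1 \<noteq> 0"
  proof
    assume "\<kappa>1 = 0"
    then obtain j where j: "(cubic F ^^ j) (2 * a) = a \<or> (cubic F ^^ j) (2 * a) = - a"
      using iterate_deriv_eq_0_iff[of F l "2 * a"] by (auto simp: \<kappa>1_def a_def)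
    have "a \<noteq> 0" using free_orbit_avoids_critical_points(1)[of 0] by (simp add: a_def)
    show False
    proof (cases "j \<ge> 1")
      case True
      then show False using j iterate_free_cocritical[OF True, of F]
          free_orbit_avoids_critical_points[of j] by (simp add: a_def)
    next
      case False
      then have "j = 0" by simp
      then have "2 * a - a = 0 \<or> 2 * a + a = 0" using j by auto
      then show False using \<open>a \<noteq> 0\<close> by simp
    qed
  qed
  have so: "second_order (\<lambda>t e. (cubic F ^^ m) (a0 + e)) a0 (first_variation F 0 0 a0 0 m) lam"
    using second_order_iterate[of "\<lambda>_. F" F 0 0 m a0] second_order_const a0(3) by (simp add: lam_def)
  then obtain C \<delta> where C: "\<delta> > 0" "\<And>t e. norm t < \<delta> \<Longrightarrow> norm e < \<delta> \<Longrightarrow>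
      norm ((cubic F ^^ m) (a0 + e) - a0 - first_variation F 0 0 a0 0 m * t - lam * e) \<le> C * (norm t + norm e)\<^sup>2"
    unfolding second_order_def by blast
  have "norm ((cubic F ^^ m) (a0 + e) - a0 - lam * e) \<le> C * (norm e)\<^sup>2" if "norm e < \<delta>" for e
    using C(2)[of 0 e] C(1) that by simp
  from poincare_function[OF holomorphic_iterate a0(3) lam C(1) this]
  obtain \<phi> where \<phi>: "\<phi> holomorphic_on UNIV" "\<not> \<phi> constant_on UNIV"
    "\<And>W. uniform_limit (cball 0 W) (\<lambda>N w. ((cubic F ^^ m) ^^ N) (a0 + w / lam ^ N)) \<phi> sequentially" by blast
  have \<phi>_cont: "continuous_on UNIV \<phi>" using \<phi>(1) by (rule holomorphic_on_imp_continuous_on)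
  \<comment> \<open>\<open>T1\<close> and \<open>T2\<close> are the displacement from \<open>2 a\<close> and the parameter that correspond to the magnified
    coordinate \<open>w\<close>; \<open>Z1\<close> and \<open>Z2\<close> are the orbit points that decide membership in the two sets.\<close>
  define T1 where "T1 k w = w / (\<kappa>1 * lam ^ k)" for k w
  define T2 where "T2 k w = w / (\<kappa>2 * lam ^ k)" for k w
  define Z1 where "Z1 k w = (cubic F ^^ (m * k + l)) (2 * a + T1 k w)" for k w
  define Z2 where "Z2 k w = (cubic (\<gamma> (T2 k w)) ^^ (m * k + l)) (- fst (\<gamma> (T2 k w)))" for k w
  have T1: "(\<lambda>k. T1 k (w k)) \<longlonglongrightarrow> 0" if "w \<longlonglongrightarrow> w0" for w w0
    unfolding T1_def using lam that by (rule scaled_parameter_tendsto_0)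
  have T2: "(\<lambda>k. T2 k (w k)) \<longlonglongrightarrow> 0" if "w \<longlonglongrightarrow> w0" for w w0
    unfolding T2_def using lam that by (rule scaled_parameter_tendsto_0)
  have first_variation_const: "first_variation F 0 0 z z' n = iterate_deriv F n z * z'" for z z' n
    by (induction n) auto
  have Z1: "(\<lambda>k. Z1 k (w k)) \<longlonglongrightarrow> \<phi> w0" if "w \<longlonglongrightarrow> w0" for w w0
    unfolding Z1_def T1_def lam_def
  proof (rule dyn.rescaled_orbit_limit[of "\<lambda>t. 2 * a + t" 1 \<kappa>1 \<phi> w w0])
    show "((\<lambda>t. 2 * a + t) has_field_derivative 1) (at 0)" by (auto intro!: derivative_eq_intros)
    show "(cubic F ^^ l) (2 * a + 0) = a0" using lm(3) by (simp add: a_def)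
    then have orbit: "(cubic F ^^ l) (2 * a) = a0" by simp
    have "iterate_deriv F (l + m) (2 * a) = lam * \<kappa>1"
      using iterate_deriv_add[of F m l "2 * a"] unfolding add.commute[of l m] orbit lam_def \<kappa>1_def .
    then show "\<kappa>1 * (iterate_deriv F m a0 - 1) = first_variation F 0 0 (2 * a + 0) 1 (l + m) - first_variation F 0 0 (2 * a + 0) 1 l"
      unfolding first_variation_const add_0_right mult_1_right lam_def[symmetric] \<kappa>1_def[symmetric]
      by (simp only: left_diff_distrib mult_1_left mult.commute[of \<kappa>1])
  qed (use \<kappa>1 \<phi>(3) \<phi>_cont that in \<open>simp_all add: lam_def\<close>)
  have Z2: "(\<lambda>k. Z2 k (w k)) \<longlonglongrightarrow> \<phi> w0" if "w \<longlonglongrightarrow> w0" for w w0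
    unfolding Z2_def T2_def lam_def
  proof (rule par.rescaled_orbit_limit[of "\<lambda>t. - fst (\<gamma> t)" "- a'" \<kappa>2 \<phi> w w0])
    show "((\<lambda>t. - fst (\<gamma> t)) has_field_derivative - a') (at 0)" by (intro DERIV_minus A')
    show "(cubic F ^^ l) (- fst (\<gamma> 0)) = a0" using lm(2) by (simp add: par(3))
    show "\<kappa>2 * (iterate_deriv F m a0 - 1) = first_variation F a' v' (- fst (\<gamma> 0)) (- a') (l + m) - first_variation F a' v' (- fst (\<gamma> 0)) (- a') l"
      using lam1 by (simp add: \<kappa>2_def D_def par(3) lam_def flip: a_def)
  qed (use \<kappa>2 \<phi>(3) \<phi>_cont that in \<open>simp_all add: lam_def\<close>)
  define \<rho> where "\<rho> k = inverse (\<kappa>1 * lam ^ k)" for k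
  define q where "q = \<kappa>2 / \<kappa>1"
  have E1: "rescale (inverse (\<rho> k)) (filled_julia F) (2 * fst F) = {w. Z1 k w \<in> filled_julia F}" for k
    using rescale_eq[of "\<kappa>1 * lam ^ k"] \<kappa>1 lam0
    by (simp add: \<rho>_def Z1_def T1_def filled_julia_iterate a_def)
  have E2: "rescale (inverse (\<rho> k) * q) {t \<in> U. \<gamma> t \<in> connectedness_locus p} 0
      = {w. T2 k w \<in> U \<and> Z2 k w \<in> filled_julia (\<gamma> (T2 k w))}" for k
  proof -
    have "inverse (\<rho> k) * q = \<kappa>2 * lam ^ k" using \<kappa>1 by (simp add: \<rho>_def q_def)
    moreover have "\<gamma> t \<in> connectedness_locus p \<longleftrightarrow> - fst (\<gamma> t) \<in> filled_julia (\<gamma> t)" if "t \<in> U" for t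
      using par(4) that by (intro connectedness_locus_iff) blast
    ultimately show ?thesis
      using rescale_eq[of "\<kappa>2 * lam ^ k"] \<kappa>2 lam0
      by (auto simp: Z2_def T2_def filled_julia_iterate)
  qed
  have L_closed: "closed (\<phi> -` filled_julia F)"
    using closed_filled_julia \<phi>_cont by (rule closed_vimage)
  have conv1: "hausdorff_converges (\<lambda>k. truncate (rescale (inverse (\<rho> k)) (filled_julia F) (2 * fst F)) r)
      (truncate (\<phi> -` filled_julia F) r)" if r: "r > 0" for r
    unfolding E1
  proof (rule hausdorff_truncate[OF r L_closed])
    have "continuous_on UNIV (Z1 k)" for k
      unfolding Z1_def T1_def using \<kappa>1 lam0
      by (intro continuous_on_compose2[OF continuous_iterate[of UNIV]] continuous_intros) auto
    then have "closed (Z1 k -` filled_julia F)" for k by (rule closed_vimage[OF closed_filled_julia])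
    then have "closed (cball 0 r \<inter> {w. Z1 k w \<in> filled_julia F})" for k
      unfolding vimage_def by (rule closed_Int[OF closed_cball])
    then show "\<forall>\<^sub>F k in sequentially. closed (cball 0 r \<inter> {w. Z1 k w \<in> filled_julia F})" by simp
    show "w0 \<in> \<phi> -` filled_julia F"
      if "w \<longlonglongrightarrow> w0" "\<exists>\<^sub>F k in sequentially. w k \<in> {w. Z1 k w \<in> filled_julia F}" for w w0
      using dyn.upper_limit[OF T1[OF that(1)] Z1[OF that(1)]] that(2) by simp
    show "\<exists>w'\<in>ball w e. \<forall>\<^sub>F k in sequentially. w' \<in> {w. Z1 k w \<in> filled_julia F}"
      if "w \<in> \<phi> -` filled_julia F" "e > 0" for w e
      using dyn.lower_limit[OF \<phi>(1,2), of T1 Z1 w e] T1[OF tendsto_const] Z1[OF tendsto_const] that by simp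
  qed
  have conv2: "hausdorff_converges (\<lambda>k. truncate (rescale (inverse (\<rho> k) * q)
        {t \<in> U. \<gamma> t \<in> connectedness_locus p} 0) r) (truncate (\<phi> -` filled_julia F) r)" if r: "r > 0" for r
    unfolding E2
  proof (rule hausdorff_truncate[OF r L_closed])
    have "\<forall>\<^sub>F k in sequentially. dist (T2 k (of_real r)) 0 < d"
      using tendstoD[OF T2[OF tendsto_const] d(1)] .
    then show "\<forall>\<^sub>F k in sequentially. closed (cball 0 r \<inter> {w. T2 k w \<in> U \<and> Z2 k w \<in> filled_julia (\<gamma> (T2 k w))})"
    proof eventually_elim
      case (elim k)
      have small: "T2 k w \<in> cball 0 d" if "w \<in> cball 0 r" for w
      proof -
        have "norm (T2 k w) \<le> norm (T2 k (of_real r))"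
          using that r by (simp add: T2_def norm_divide divide_right_mono)
        then show ?thesis using elim by simp
      qed
      have "cball 0 r \<inter> {w. T2 k w \<in> U \<and> Z2 k w \<in> filled_julia (\<gamma> (T2 k w))}
          = cball 0 r \<inter> T2 k -` {t \<in> cball 0 d. - fst (\<gamma> t) \<in> filled_julia (\<gamma> t)}"
        using small d(2) by (auto simp: Z2_def filled_julia_iterate)
      moreover have "continuous_on UNIV (T2 k)"
        unfolding T2_def using \<kappa>2 lam0 by (intro continuous_intros) auto
      then have "closed (T2 k -` {t \<in> cball 0 d. - fst (\<gamma> t) \<in> filled_julia (\<gamma> t)})"
        by (rule closed_vimage[OF par.closed_free_critical_point_bounded])
      then have "closed (cball 0 r \<inter> T2 k -` {t \<in> cball 0 d. - fst (\<gamma> t) \<in> filled_julia (\<gamma> t)})"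
        by (rule closed_Int[OF closed_cball])
      ultimately show ?case by (simp only:)
    qed
    show "w0 \<in> \<phi> -` filled_julia F"
      if "w \<longlonglongrightarrow> w0" "\<exists>\<^sub>F k in sequentially. w k \<in> {w. T2 k w \<in> U \<and> Z2 k w \<in> filled_julia (\<gamma> (T2 k w))}" for w w0
    proof -
      have "\<exists>\<^sub>F k in sequentially. Z2 k (w k) \<in> filled_julia (\<gamma> (T2 k (w k)))"
        using that(2) by (rule frequently_elim1) simp
      then show ?thesis using par.upper_limit[OF T2[OF that(1)] Z2[OF that(1)]] by simp
    qed
    show "\<exists>w'\<in>ball w e. \<forall>\<^sub>F k in sequentially. w' \<in> {w. T2 k w \<in> U \<and> Z2 k w \<in> filled_julia (\<gamma> (T2 k w))}"
      if w: "w \<in> \<phi> -` filled_julia F" "e > 0" for w e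
    proof -
      obtain w' where w': "w' \<in> ball w e" "\<forall>\<^sub>F k in sequentially. Z2 k w' \<in> filled_julia (\<gamma> (T2 k w'))"
        using par.lower_limit[OF \<phi>(1,2), of T2 Z2 w e] T2[OF tendsto_const] Z2[OF tendsto_const] w by auto
      have "\<forall>\<^sub>F k in sequentially. T2 k w' \<in> U"
        using topological_tendstoD[OF T2[OF tendsto_const] par(1,2)] .
      with w'(2) have "\<forall>\<^sub>F k in sequentially. w' \<in> {w. T2 k w \<in> U \<and> Z2 k w \<in> filled_julia (\<gamma> (T2 k w))}"
        by eventually_elim simp
      then show ?thesis using w'(1) by blast
    qed
  qed
  have "\<rho> \<longlonglongrightarrow> 0"
    using scaled_parameter_tendsto_0[OF lam tendsto_const[of 1], of \<kappa>1] by (simp add: \<rho>_def[abs_def] inverse_eq_divide)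
  then show ?thesis
    using \<phi>(1,2) \<kappa>1 \<kappa>2 lam0 conv1 conv2
    by (intro exI[of _ \<phi>] exI[of _ \<rho>] exI[of _ q] conjI exI[of _ "1::real"] allI impI) (auto simp: \<rho>_def q_def)
qed

end
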